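(* Let $p$ be an $r$-bit prime, let $g$ be an integer with $p\nmid g$, let $u_0\in\{1,\ldots,p-1\}$, and let $k$ be an integer with $1\le k\le r$. Let $t$ be the cycle length of the sequence $\{u_n\}$ and $\tau_k$ the cycle length of the sequence $\{\xi^{(k)}_n\}$ of $k$ least significant bits of $u_n$. Then $$ \tau_k \ge t\, p^{o(1)}\cdot \left\{\begin{array}{ll} (2^k/p)^{1/3}, & \text{if } k/r \ge 17/20,\\ 2^{7k/6} p^{-25/24}, & \text{if } 17/20 > k/r \ge 13/16,\\ (2^k/p)^{1/2}, & \text{if } 13/16 > k/r \ge 3/5,\\ 2^{4k/3} p^{-1}, & \text{if } 3/5 > k/r \ge 3/8,\\ p^{-1/2}, & \text{if } 3/8 > k/r \ge 1/4,\\ 2^{2k} p^{-1}, & \text{if } 1/4 > k/r. \end{array}\right. $$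
   Context: An $r$-bit prime is a prime $p$ with $2^{r-1}\le p<2^r$. Given a prime $p$, an integer $g$ with $p\nmid g$ and $u_0\in\{1,\ldots,p-1\}$, the sequence $\{u_n\}_{n\ge 0}$ is defined recursively by $u_n\equiv g^{u_{n-1}} \pmod p$, $1\le u_n\le p-1$, for $n=1,2,\ldots$ (the exponent $u_{n-1}$ is taken as an integer). It is eventually periodic, and its cycle length $t$ is the smallest positive integer such that for some $s\ge 0$ one has $u_n=u_{n+t}$ for all $n\ge s$. For an integer $k\ge1$, $\xi^{(k)}_n\in\{0,\ldots,2^k-1\}$ denotes the integer formed by the $k$ least significant bits of $u_n$ (that is, $u_n$ reduced modulo $2^k$). The sequence $\{\xi^{(k)}_n\}$ is eventually periodic, and $\tau_k$ denotes its cycle length (its smallest eventual period). The notation $p^{o(1)}$ is understood as $p\to\infty$, uniformly in $g$, $u_0$ and $k$: for every $\varepsilon>0$ there is $p_0(\varepsilon)$ such that for all $p\ge p_0(\varepsilon)$ the inequality holds with $p^{o(1)}$ replaced by $p^{-\varepsilon}$. *)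

theory Defs
  imports Complex_Main "HOL-Number_Theory.Cong" "HOL-Computational_Algebra.Primes"
begin

text \<open>For \<open>r = 0\<close> the two bounds contradict each other, so \<open>r \<ge> 1\<close> is implied.\<close>
definition bit_prime :: "nat \<Rightarrow> nat \<Rightarrow> bool" where
  "bit_prime r p \<longleftrightarrow> prime p \<and> 2 ^ (r - 1) \<le> p \<and> p < 2 ^ r"

primrec exp_seq :: "nat \<Rightarrow> int \<Rightarrow> nat \<Rightarrow> nat \<Rightarrow> nat" where
  "exp_seq p g u0 0 = u0"
| "exp_seq p g u0 (Suc n) = nat (g ^ exp_seq p g u0 n mod int p)"

text \<open>The least nonnegative residue in the recursion is the representative in
  \<open>{1..p - 1}\<close>, because \<open>p\<close> does not divide \<open>g\<close>.\<close>

lemma exp_seq_cong: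
  assumes "prime p"
  shows "[int (exp_seq p g u0 (Suc n)) = g ^ exp_seq p g u0 n] (mod int p)"
  using prime_gt_0_nat[OF assms] by (simp add: cong_def)

lemma exp_seq_range:
  assumes "prime p" "\<not> int p dvd g" "u0 \<in> {1..p - 1}"
  shows "exp_seq p g u0 n \<in> {1..p - 1}"
proof (cases n)
  case 0
  then show ?thesis using assms(3) by simp
next
  case (Suc m)
  have p: "int p > 0" using prime_gt_0_nat[OF assms(1)] by simp
  let ?x = "g ^ exp_seq p g u0 m mod int p"
  have "\<not> int p dvd g ^ exp_seq p g u0 m"
    using assms(1,2) by (meson prime_dvd_power prime_nat_int_transfer)
  then have "?x \<noteq> 0" by (simp add: dvd_eq_mod_eq_0)
  moreover have "0 \<le> ?x" "?x < int p" using p by simp_all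
  ultimately show ?thesis using Suc by (simp add: Suc_le_eq)
qed

definition low_bits :: "nat \<Rightarrow> (nat \<Rightarrow> nat) \<Rightarrow> nat \<Rightarrow> nat" where
  "low_bits k u n = u n mod 2 ^ k"

definition cycle_length :: "(nat \<Rightarrow> 'a) \<Rightarrow> nat" where
  "cycle_length x = (LEAST t. 0 < t \<and> (\<exists>s. \<forall>n\<ge>s. x n = x (n + t)))"

lemma exp_seq_eventually_periodic:
  assumes "prime p" "\<not> int p dvd g" "u0 \<in> {1..p - 1}"
  shows "\<exists>t>0. \<exists>s. \<forall>n\<ge>s. exp_seq p g u0 n = exp_seq p g u0 (n + t)"
proof -
  have "range (exp_seq p g u0) \<subseteq> {1..p - 1}"
    using exp_seq_range[OF assms] by blast
  then have "\<not> inj (exp_seq p g u0)"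
    by (meson finite_atLeastAtMost finite_imageD finite_subset infinite_UNIV_nat)
  then obtain s m where sm: "s < m" "exp_seq p g u0 s = exp_seq p g u0 m"
    by (metis injI linorder_neqE_nat)
  have "exp_seq p g u0 n = exp_seq p g u0 (n + (m - s))" if "n \<ge> s" for n
    using that sm by (induction n rule: dec_induct) auto
  then show ?thesis using sm(1) by (metis zero_less_diff)
qed

lemma cycle_length_attained:
  assumes "\<exists>t>0. \<exists>s. \<forall>n\<ge>s. x n = x (n + t)"
  shows "0 < cycle_length x" "\<exists>s. \<forall>n\<ge>s. x n = x (n + cycle_length x)"
  using LeastI_ex[OF assms] by (simp_all add: cycle_length_def)

definition lsb_factor :: "nat \<Rightarrow> nat \<Rightarrow> nat \<Rightarrow> real" where
  "lsb_factor p r k =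
    (let \<rho> = real k / real r in
     if \<rho> \<ge> 17/20 then (2 ^ k / real p) powr (1/3)
     else if \<rho> \<ge> 13/16 then 2 powr (7 * real k / 6) * real p powr (- 25/24)
     else if \<rho> \<ge> 3/5 then (2 ^ k / real p) powr (1/2)
     else if \<rho> \<ge> 3/8 then 2 powr (4 * real k / 3) * real p powr (- 1)
     else if \<rho> \<ge> 1/4 then real p powr (- 1/2)
     else 2 powr (2 * real k) * real p powr (- 1))"

end

theory Submission
  imports Defs "HOL-Analysis.Convex"
begin

text \<open>
  Write \<open>t\<close> and \<open>\<tau>\<close> for the two cycle lengths. The terms of one cycle of \<open>u\<close> at mutual distance \<open>\<tau>\<close>
  agree modulo \<open>2 ^ k\<close>, as do their successors. After division by \<open>2 ^ k\<close> they give \<open>N \<ge> t / \<tau>\<close>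
  solutions of \<open>y + b = c G ^ x\<close> modulo \<open>p\<close> with \<open>x\<close> and \<open>y\<close> in intervals of length \<open>H \<approx> p / 2 ^ k\<close>,
  so \<open>N\<close> has to be bounded from above.

  For \<open>\<nu> \<in> {2, 3}\<close> consider pairs of \<open>\<nu>\<close>-tuples of solutions with the same sum of exponents; there
  are at least \<open>N ^ (2 \<nu>) / (\<nu> H)\<close> of them. Each yields an integer polynomial
  \<open>(T + y\<^sub>1) \<dots> (T + y\<^sub>\<nu>) - (T + y'\<^sub>1) \<dots> (T + y'\<^sub>\<nu>)\<close> of degree less than \<open>\<nu>\<close> with small coefficients that
  vanishes at \<open>b\<close> modulo \<open>p\<close>, and by the divisor bound a polynomial arises at most
  \<open>N p\<^sup>o\<^sup>(\<^sup>1\<^sup>)\<close> times. If all these polynomials have a common root then the products of the values at the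
  \<open>y\<^sub>i\<close> and at the \<open>y'\<^sub>i\<close> of a polynomial with this root coincide, and the divisor bound leaves only
  \<open>N ^ \<nu> p\<^sup>o\<^sup>(\<^sup>1\<^sup>)\<close> pairs. Otherwise the resultant of two of them is a nonzero multiple of \<open>p\<close>; as many
  coefficient vectors in a box span a small area, their number is bounded. For long intervals
  an incidence bound over the field with \<open>p\<close> elements takes over.
\<close>

section \<open>The divisor bound\<close>

text \<open>With h = p / 2^k the six cases say that N is, up to p^o(1), at most h^(1/3), h^(7/6)
  p^(-1/8), h^(1/2), h^(4/3) p^(-1/3), p^(1/2), h^2 / p, and each threshold for k / r is the point
  where two neighbouring bounds agree. A common root accounts for h^(1/3) and h^(1/2), and the area
  bound for pairs gives h^(4/3) p^(-1/3).

  The obstacle is in the triples: their coefficient vectors have three coordinates, whereas the area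
  argument needs a plane. Modulo p all of them are orthogonal to (b^2, b, 1), so each 3 x 3
  determinant is a multiple of p, but it is forced to be 0 only while its size, about the sixth
  power of the interval length, stays below p. Longer intervals are therefore cut into pieces of
  length about p^(1/6), at the price of a factor h / p^(1/6). Proportional quadratics may also share
  two irrational roots instead of a rational one and need their own test function.

  All losses p^o(1) are divisor counts. They are collected in one number \<open>D\<close>, which
  enters the bounds for N with exponent at most 1.\<close>

lemma card_le_fibres:
  assumes "finite A" "\<And>y. y \<in> f ` A \<Longrightarrow> card {x\<in>A. f x = y} \<le> D"
  shows "card A \<le> D * card (f ` A)"
proof -
  have "card A = (\<Sum>y\<in>f ` A. card {x\<in>A. f x = y})"
    using sum.image_gen[OF assms(1), of "\<lambda>_. 1::nat" f] by simp
  also have "\<dots> \<le> (\<Sum>y\<in>f ` A. D)" by (rule sum_mono) (use assms in auto)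
  finally show ?thesis by (simp add: mult.commute)
qed

text \<open>Cauchy-Schwarz over the fibres of \<open>f\<close>: the pairs with equal image number
  the sum of the squared fibre sizes. With sums of exponents as \<open>f\<close> this gives the
  lower bounds for \<open>E2\<close> and \<open>E3\<close>.\<close>

lemma card_squared_le_collisions:
  assumes "finite A" "f ` A \<subseteq> B" "finite B"
  shows "(card A)\<^sup>2 \<le> card B * card {(u, v). u \<in> A \<and> v \<in> A \<and> f u = f v}"
proof -
  let ?n = "\<lambda>y. card {u\<in>A. f u = y}"
  have "card A = (\<Sum>y\<in>B. ?n y)"
    using sum.group[OF assms(1,3,2), of "\<lambda>_. 1::nat"] by simp
  then have "real ((card A)\<^sup>2) = (\<Sum>y\<in>B. real (?n y) * 1)\<^sup>2" by simp
  also have "\<dots> \<le> (\<Sum>y\<in>B. (real (?n y))\<^sup>2) * (\<Sum>y\<in>B. 1\<^sup>2)"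
    by (rule Cauchy_Schwarz_ineq_sum)
  also have "(\<Sum>y\<in>B. (real (?n y))\<^sup>2) = real (\<Sum>y\<in>B. card ({u\<in>A. f u = y} \<times> {u\<in>A. f u = y}))"
    by (simp add: card_cartesian_product power2_eq_square)
  also have "(\<Sum>y\<in>B. card ({u\<in>A. f u = y} \<times> {u\<in>A. f u = y}))
      = card (\<Union>y\<in>B. {u\<in>A. f u = y} \<times> {u\<in>A. f u = y})"
    by (subst card_UN_disjoint) (use assms in auto)
  also have "(\<Union>y\<in>B. {u\<in>A. f u = y} \<times> {u\<in>A. f u = y}) = {(u, v). u \<in> A \<and> v \<in> A \<and> f u = f v}"
    using assms(2) by auto
  finally have "real ((card A)\<^sup>2) \<le> real (card B * card {(u, v). u \<in> A \<and> v \<in> A \<and> f u = f v})"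
    by (simp add: mult.commute)
  then show ?thesis by (simp only: of_nat_le_iff)
qed

lemma card_divisors_mult_le:
  assumes "a > 0" "b > 0"
  shows "card {d::nat. d dvd a * b} \<le> card {d. d dvd a} * card {d. d dvd b}"
proof -
  have "{d::nat. d dvd a * b} \<subseteq> (\<lambda>(x, y). x * y) ` ({d. d dvd a} \<times> {d. d dvd b})"
    by (auto simp: image_iff dest!: division_decomp)
  moreover have fin: "finite ({d. d dvd a} \<times> {d. d dvd b})" using assms by simp
  ultimately have "card {d::nat. d dvd a * b} \<le> card ((\<lambda>(x, y). x * y) ` ({d. d dvd a} \<times> {d. d dvd b}))"
    by (meson card_mono finite_imageI)
  also have "\<dots> \<le> card ({d. d dvd a} \<times> {d. d dvd b})" by (rule card_image_le[OF fin])
  finally show ?thesis by (simp add: card_cartesian_product)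
qed

lemma card_divisors_prod_le:
  assumes "finite A" "\<And>i. i \<in> A \<Longrightarrow> f i > 0"
  shows "card {d::nat. d dvd prod f A} \<le> (\<Prod>i\<in>A. card {d. d dvd f i})"
  using assms
proof (induction A rule: finite_induct)
  case (insert a A)
  have "card {d::nat. d dvd f a * prod f A} \<le> card {d. d dvd f a} * card {d. d dvd prod f A}"
    by (rule card_divisors_mult_le) (use insert in \<open>auto intro!: prod_pos\<close>)
  also have "\<dots> \<le> card {d. d dvd f a} * (\<Prod>i\<in>A. card {d. d dvd f i})"
    using insert by simp
  finally show ?case using insert by simp
qed simp

lemma card_divisors_prime_power:
  assumes "prime q"
  shows "card {d::nat. d dvd q ^ a} = a + 1"
proof -
  have "{d::nat. d dvd q ^ a} = (\<lambda>i. q ^ i) ` {..a}"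
    using divides_primepow_nat[OF assms] by auto
  moreover have "inj_on (\<lambda>i. q ^ i) {..a}"
    using prime_gt_1_nat[OF assms] by (intro inj_onI) simp
  ultimately show ?thesis by (simp add: card_image)
qed

text \<open>The number of divisors divided by n^\<epsilon> is a product of local factors (a + 1) /
  q^(a \<epsilon>) over the prime powers q^a exactly dividing n. Such a factor is at most 1 once q
  is at least 2^(1/\<epsilon>), because then q^(a \<epsilon>) >= 2^a >= a + 1. At most
  \<open>B\<close> primes are smaller, and each of them contributes at most \<open>M\<close>, whence
  the constant \<open>M ^ B\<close>.\<close>

lemma divisor_bound:
  fixes \<epsilon> :: real
  assumes "\<epsilon> > 0"
  obtains C where "C \<ge> 1" "\<And>n::nat. n > 0 \<Longrightarrow> real (card {d. d dvd n}) \<le> C * real n powr \<epsilon>"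
proof -
  \<comment> \<open>Chosen so that \<open>M * \<epsilon> * ln 2\<close> is 1 + \<epsilon> ln 2,
    hence at least 1. Then M (1 + \<epsilon> a ln 2) >= 1 + a, while the bracket is at most
    2^(\<epsilon> a).\<close>
  define M where "M = 1 + 1 / (\<epsilon> * ln 2)"
  define B where "B = nat \<lceil>2 powr (1 / \<epsilon>)\<rceil>"
  have M1: "M \<ge> 1" using assms by (simp add: M_def)
  have local_bound: "real (a + 1) \<le> (if q < B then M else 1) * (real q ^ a) powr \<epsilon>"
    if q: "prime q" for q a :: nat
  proof -
    have q2: "real q \<ge> 2" using prime_ge_2_nat[OF q] by simp
    have eq: "(real q ^ a) powr \<epsilon> = real q powr (\<epsilon> * real a)"
      using q2 by (simp add: powr_realpow[symmetric] powr_powr mult.commute)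
    show ?thesis
    proof (cases "q < B")
      case True
      have "1 + \<epsilon> * real a * ln 2 \<le> exp (\<epsilon> * real a * ln 2)" by (rule exp_ge_add_one_self)
      also have "\<dots> = 2 powr (\<epsilon> * real a)" by (simp add: powr_def)
      also have "\<dots> \<le> real q powr (\<epsilon> * real a)"
        using q2 assms by (intro powr_mono2) auto
      finally have 1: "1 + \<epsilon> * real a * ln 2 \<le> real q powr (\<epsilon> * real a)" .
      have "real (a + 1) \<le> M * (1 + \<epsilon> * real a * ln 2)"
      proof -
        have "M * (1 + \<epsilon> * real a * ln 2) = 1 + \<epsilon> * real a * ln 2 + 1 / (\<epsilon> * ln 2) + real a"
          using assms by (simp add: M_def field_simps)
        moreover have "0 \<le> \<epsilon> * real a * ln 2 + 1 / (\<epsilon> * ln 2)" using assms by simp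
        ultimately show ?thesis by simp
      qed
      also have "\<dots> \<le> M * real q powr (\<epsilon> * real a)" using 1 M1 by simp
      finally show ?thesis using True eq by simp
    next
      case False
      then have "2 powr (1 / \<epsilon>) \<le> real q" unfolding B_def by linarith
      then have "(2 powr (1 / \<epsilon>)) powr (\<epsilon> * real a) \<le> real q powr (\<epsilon> * real a)"
        using assms by (intro powr_mono2) auto
      moreover have "(2 powr (1 / \<epsilon>)) powr (\<epsilon> * real a) = 2 ^ a"
        using assms by (simp add: powr_powr powr_realpow)
      moreover have "a + 1 \<le> 2 ^ a" by (induction a) auto
      then have "real (a + 1) \<le> 2 ^ a" by (metis of_nat_le_iff of_nat_numeral of_nat_power)
      ultimately show ?thesis using False eq by simp
    qed
  qed
  show thesis
  proof
    show "M ^ B \<ge> 1" using M1 by simp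
    fix n :: nat assume n: "n > 0"
    let ?f = "\<lambda>q. q ^ multiplicity q n"
    have pos: "q > 0" if "q \<in> prime_factors n" for q
      using that by (auto simp: in_prime_factors_iff prime_gt_0_nat)
    have decomp: "n = (\<Prod>q\<in>prime_factors n. ?f q)"
      using n by (simp add: prime_factorization_nat)
    have "card {d. d dvd n} \<le> (\<Prod>q\<in>prime_factors n. card {d. d dvd ?f q})"
      by (subst decomp, rule card_divisors_prod_le) (auto dest: pos)
    also have "\<dots> = (\<Prod>q\<in>prime_factors n. multiplicity q n + 1)"
      by (rule prod.cong) (auto simp: card_divisors_prime_power in_prime_factors_iff)
    finally have "real (card {d. d dvd n}) \<le> (\<Prod>q\<in>prime_factors n. real (multiplicity q n + 1))"
      by (metis of_nat_le_iff of_nat_prod)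
    also have "\<dots> \<le> (\<Prod>q\<in>prime_factors n. (if q < B then M else 1) * (real q ^ multiplicity q n) powr \<epsilon>)"
      by (rule prod_mono) (use local_bound in \<open>auto simp: in_prime_factors_iff\<close>)
    also have "\<dots> = (\<Prod>q\<in>prime_factors n. if q < B then M else 1)
        * (\<Prod>q\<in>prime_factors n. (real q ^ multiplicity q n) powr \<epsilon>)"
      by (rule prod.distrib)
    also have "(\<Prod>q\<in>prime_factors n. (real q ^ multiplicity q n) powr \<epsilon>)
        = (\<Prod>q\<in>prime_factors n. real q ^ multiplicity q n) powr \<epsilon>"
      by (rule prod_powr_distrib[symmetric])
    also have "(\<Prod>q\<in>prime_factors n. real q ^ multiplicity q n) = real n"
      using arg_cong[OF decomp, of real] by (simp only: of_nat_prod of_nat_power)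
    also have "(\<Prod>q\<in>prime_factors n. if q < B then M else 1) \<le> M ^ B"
    proof -
      have "(\<Prod>q\<in>prime_factors n. if q < B then M else 1) = M ^ card {q\<in>prime_factors n. q < B}"
        by (simp add: prod.If_cases prod_constant Int_def)
      also have "card {q\<in>prime_factors n. q < B} \<le> card {..<B}" by (rule card_mono) auto
      then have "M ^ card {q\<in>prime_factors n. q < B} \<le> M ^ B"
        using M1 by (intro power_increasing) auto
      finally show ?thesis .
    qed
    finally show "real (card {d. d dvd n}) \<le> M ^ B * real n powr \<epsilon>"
      by (simp add: mult_right_mono)
  qed
qed

lemma card_int_divisors_le:
  assumes "m \<noteq> (0::int)"
  shows "card {d. d dvd m} \<le> 2 * card {d::nat. d dvd nat \<bar>m\<bar>}"
proof -
  let ?A = "{d::nat. d dvd nat \<bar>m\<bar>}"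
  have fin: "finite ?A" by (rule finite_divisors_nat) (use assms in simp)
  have "{d. d dvd m} \<subseteq> int ` ?A \<union> (\<lambda>d. - int d) ` ?A"
  proof
    fix d assume "d \<in> {d. d dvd m}"
    then have "nat \<bar>d\<bar> \<in> ?A" by (simp add: nat_abs_dvd_iff)
    moreover have "d = int (nat \<bar>d\<bar>) \<or> d = - int (nat \<bar>d\<bar>)" by auto
    ultimately show "d \<in> int ` ?A \<union> (\<lambda>d. - int d) ` ?A" by blast
  qed
  then have "card {d. d dvd m} \<le> card (int ` ?A \<union> (\<lambda>d. - int d) ` ?A)"
    using fin by (intro card_mono) auto
  also have "\<dots> \<le> card (int ` ?A) + card ((\<lambda>d. - int d) ` ?A)" by (rule card_Un_le)
  also have "\<dots> \<le> card ?A + card ?A" by (intro add_mono card_image_le fin)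
  finally show ?thesis by simp
qed

section \<open>Small determinants in planar point sets\<close>

lemma card_separated_le:
  fixes f :: "'a \<Rightarrow> real"
  assumes "finite A" "d > 0" "a \<ge> 0" "\<And>s. s \<in> A \<Longrightarrow> \<bar>f s\<bar> \<le> a"
    and "\<And>s s'. s \<in> A \<Longrightarrow> s' \<in> A \<Longrightarrow> s \<noteq> s' \<Longrightarrow> \<bar>f s - f s'\<bar> \<ge> d"
  shows "real (card A) \<le> 2 * a / d + 1"
proof -
  define F where "F s = \<lfloor>(f s + a) / d\<rfloor>" for s
  have "inj_on F A"
  proof (rule inj_onI, rule ccontr)
    fix s s' assume s: "s \<in> A" "s' \<in> A" "F s = F s'" "s \<noteq> s'"
    then have "\<bar>(f s + a) / d - (f s' + a) / d\<bar> < 1" unfolding F_def by linarith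
    moreover have "(f s + a) / d - (f s' + a) / d = (f s - f s') / d"
      by (simp add: diff_divide_distrib[symmetric])
    ultimately have "\<bar>f s - f s'\<bar> < d" using assms(2) by (simp add: abs_divide)
    with assms(5)[OF s(1,2,4)] show False by simp
  qed
  moreover have "F ` A \<subseteq> {0..\<lfloor>2 * a / d\<rfloor>}"
  proof (rule image_subsetI)
    fix s assume "s \<in> A"
    then have "\<bar>f s\<bar> \<le> a" by (rule assms)
    then have "0 \<le> (f s + a) / d" "(f s + a) / d \<le> 2 * a / d"
      using assms(2) by (auto intro!: divide_right_mono)
    then show "F s \<in> {0..\<lfloor>2 * a / d\<rfloor>}" unfolding F_def by (auto intro: floor_mono)
  qed
  ultimately have "card A \<le> card {0..\<lfloor>2 * a / d\<rfloor>}"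
    by (metis card_image card_mono finite_atLeastAtMost_int)
  moreover have "0 \<le> \<lfloor>2 * a / d\<rfloor>" using assms(2,3) by simp
  ultimately show ?thesis by simp linarith
qed

text \<open>Along a direction whose coordinate \<open>w1\<close> dominates, the maximum norm of a
  difference is attained in the coordinate \<open>f\<close>, so the points are
  \<open>\<mu>\<close>-separated already in the values of \<open>f\<close>.\<close>

lemma card_parallel_le:
  fixes f g :: "'a \<Rightarrow> real"
  assumes "finite A" "\<mu> > 0" "\<bar>w2\<bar> \<le> \<bar>w1\<bar>" "w1 \<noteq> 0"
    and "\<And>s. s \<in> A \<Longrightarrow> \<bar>f s\<bar> \<le> 1"
    and "\<And>s s'. s \<in> A \<Longrightarrow> s' \<in> A \<Longrightarrow> w1 * (g s - g s') = w2 * (f s - f s')"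
    and "\<And>s s'. s \<in> A \<Longrightarrow> s' \<in> A \<Longrightarrow> s \<noteq> s' \<Longrightarrow> max \<bar>f s - f s'\<bar> \<bar>g s - g s'\<bar> \<ge> \<mu>"
  shows "real (card A) \<le> 2 / \<mu> + 1"
proof -
  have "real (card A) \<le> 2 * 1 / \<mu> + 1"
  proof (rule card_separated_le[OF assms(1,2) _ assms(5)])
    fix s s' assume s: "s \<in> A" "s' \<in> A" "s \<noteq> s'"
    have "\<bar>w1\<bar> * \<bar>g s - g s'\<bar> = \<bar>w2\<bar> * \<bar>f s - f s'\<bar>"
      using assms(6)[OF s(1,2)] by (metis abs_mult)
    also have "\<dots> \<le> \<bar>w1\<bar> * \<bar>f s - f s'\<bar>" by (rule mult_right_mono) (use assms in auto)
    finally have "\<bar>g s - g s'\<bar> \<le> \<bar>f s - f s'\<bar>" using assms(4) by simp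
    then show "\<mu> \<le> \<bar>f s - f s'\<bar>" using assms(7)[OF s] by simp
  qed auto
  then show ?thesis by simp
qed

text \<open>Take a shortest difference vector \<open>w\<close> of the point set. On a line parallel to \<open>w\<close> the points
  are \<open>\<bar>w\<bar>\<close>-separated, and distinct such lines are separated by the smallest nonzero determinant.\<close>
lemma small_determinant:
  fixes f g :: "'a \<Rightarrow> real"
  defines "dt \<equiv> \<lambda>p q s t. (f q - f p) * (g t - g s) - (g q - g p) * (f t - f s)"
  assumes fin: "finite V" and bf: "\<And>s. s \<in> V \<Longrightarrow> \<bar>f s\<bar> \<le> 1" and bg: "\<And>s. s \<in> V \<Longrightarrow> \<bar>g s\<bar> \<le> 1"
    and inj: "\<And>s t. s \<in> V \<Longrightarrow> t \<in> V \<Longrightarrow> f s = f t \<Longrightarrow> g s = g t \<Longrightarrow> s = t"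
    and ex: "\<exists>p\<in>V. \<exists>q\<in>V. \<exists>s\<in>V. \<exists>t\<in>V. dt p q s t \<noteq> 0"
  shows "\<exists>p\<in>V. \<exists>q\<in>V. \<exists>s\<in>V. \<exists>t\<in>V. dt p q s t \<noteq> 0 \<and> \<bar>dt p q s t\<bar> * real (card V) \<le> 32"
proof -
  define Dets where "Dets = (\<lambda>(p, q, s, t). \<bar>dt p q s t\<bar>) ` {(p, q, s, t). p \<in> V \<and> q \<in> V \<and> s \<in> V \<and> t \<in> V \<and> dt p q s t \<noteq> 0}"
  have "{(p, q, s, t). p \<in> V \<and> q \<in> V \<and> s \<in> V \<and> t \<in> V \<and> dt p q s t \<noteq> 0} \<subseteq> V \<times> V \<times> V \<times> V" by auto
  then have finD: "finite Dets" unfolding Dets_def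
    by (intro finite_imageI) (meson fin finite_SigmaI finite_subset)
  have neD: "Dets \<noteq> {}" unfolding Dets_def using ex by auto
  define \<delta> where "\<delta> = Min Dets"
  have \<delta>_in: "\<delta> \<in> Dets" unfolding \<delta>_def by (rule Min_in[OF finD neD])
  then obtain p0 q0 s0 t0 where p0: "p0 \<in> V" "q0 \<in> V" "s0 \<in> V" "t0 \<in> V" "dt p0 q0 s0 t0 \<noteq> 0" "\<delta> = \<bar>dt p0 q0 s0 t0\<bar>"
    unfolding Dets_def by auto
  have \<delta>0: "\<delta> > 0" using p0 by simp
  have \<delta>_le: "\<delta> \<le> \<bar>dt p q s t\<bar>" if "p \<in> V" "q \<in> V" "s \<in> V" "t \<in> V" "dt p q s t \<noteq> 0" for p q s t
    unfolding \<delta>_def by (rule Min_le[OF finD]) (use that in \<open>force simp: Dets_def\<close>)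
  define nm where "nm p q = max \<bar>f q - f p\<bar> \<bar>g q - g p\<bar>" for p q
  define Nm where "Nm = (\<lambda>(p, q). nm p q) ` {(p, q). p \<in> V \<and> q \<in> V \<and> p \<noteq> q}"
  have "{(p, q). p \<in> V \<and> q \<in> V \<and> p \<noteq> q} \<subseteq> V \<times> V" by auto
  then have finN: "finite Nm" unfolding Nm_def by (intro finite_imageI) (meson fin finite_SigmaI finite_subset)
  have "p0 \<noteq> q0" using p0(5) by (auto simp: dt_def)
  then have neN: "Nm \<noteq> {}" unfolding Nm_def using p0 by auto
  define \<mu> where "\<mu> = Min Nm"
  have "\<mu> \<in> Nm" unfolding \<mu>_def by (rule Min_in[OF finN neN])
  then obtain p q where pq: "p \<in> V" "q \<in> V" "p \<noteq> q" "\<mu> = nm p q" unfolding Nm_def by auto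
  have \<mu>_le: "\<mu> \<le> nm s t" if "s \<in> V" "t \<in> V" "s \<noteq> t" for s t
    unfolding \<mu>_def by (rule Min_le[OF finN]) (use that in \<open>force simp: Nm_def\<close>)
  define w1 where "w1 = f q - f p"
  define w2 where "w2 = g q - g p"
  have w0: "w1 \<noteq> 0 \<or> w2 \<noteq> 0" using inj[OF pq(1,2)] pq(3) unfolding w1_def w2_def by auto
  have \<mu>w: "\<mu> = max \<bar>w1\<bar> \<bar>w2\<bar>" using pq unfolding nm_def w1_def w2_def by simp
  have \<mu>0: "\<mu> > 0" using w0 \<mu>w by auto
  define F where "F s = w1 * g s - w2 * f s" for s
  have F_diff: "F t - F s = dt p q s t" for s t
    unfolding F_def dt_def w1_def w2_def by (simp add: algebra_simps)
  have F_bound: "\<bar>F s\<bar> \<le> 2 * \<mu>" if "s \<in> V" for s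
  proof -
    have "\<bar>w1 * g s\<bar> \<le> \<mu> * 1" unfolding abs_mult using bg[OF that] \<mu>w by (intro mult_mono) auto
    moreover have "\<bar>w2 * f s\<bar> \<le> \<mu> * 1" unfolding abs_mult using bf[OF that] \<mu>w by (intro mult_mono) auto
    ultimately show ?thesis unfolding F_def by linarith
  qed
  have values_le: "real (card (F ` V)) \<le> 2 * (2 * \<mu>) / \<delta> + 1"
  proof (rule card_separated_le[where f="\<lambda>x. x"])
    fix y y' assume "y \<in> F ` V" "y' \<in> F ` V" "y \<noteq> y'"
    then show "\<delta> \<le> \<bar>y - y'\<bar>" using F_diff \<delta>_le[OF pq(1,2)] by (auto, metis eq_iff_diff_eq_0)
  qed (use fin \<delta>0 \<mu>0 F_bound in auto)
  have fibre: "real (card {s\<in>V. F s = y}) \<le> 2 / \<mu> + 1" for y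
  proof (cases "\<bar>w2\<bar> \<le> \<bar>w1\<bar>")
    case True
    show ?thesis
    proof (rule card_parallel_le[OF _ \<mu>0 True, of _ f g])
      fix s s' assume "s \<in> {s\<in>V. F s = y}" "s' \<in> {s\<in>V. F s = y}"
      then show "w1 * (g s - g s') = w2 * (f s - f s')" unfolding F_def by (simp add: algebra_simps)
    next
      fix s s' assume "s \<in> {s\<in>V. F s = y}" "s' \<in> {s\<in>V. F s = y}" "s \<noteq> s'"
      then show "\<mu> \<le> max \<bar>f s - f s'\<bar> \<bar>g s - g s'\<bar>" using \<mu>_le[of s' s] unfolding nm_def by auto
    qed (use fin bf w0 True in auto)
  next
    case False
    then have le: "\<bar>w1\<bar> \<le> \<bar>w2\<bar>" by simp
    show ?thesis
    proof (rule card_parallel_le[OF _ \<mu>0 le, of _ g f])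
      fix s s' assume "s \<in> {s\<in>V. F s = y}" "s' \<in> {s\<in>V. F s = y}"
      then show "w2 * (f s - f s') = w1 * (g s - g s')" unfolding F_def by (simp add: algebra_simps)
    next
      fix s s' assume "s \<in> {s\<in>V. F s = y}" "s' \<in> {s\<in>V. F s = y}" "s \<noteq> s'"
      then show "\<mu> \<le> max \<bar>g s - g s'\<bar> \<bar>f s - f s'\<bar>"
        using \<mu>_le[of s' s] unfolding nm_def by (auto simp: max.commute)
    qed (use fin bg w0 False in auto)
  qed
  have "real (card V) = (\<Sum>y\<in>F ` V. real (card {s\<in>V. F s = y}))"
    using sum.image_gen[OF fin, of "\<lambda>_. 1::real" F] by simp
  also have "\<dots> \<le> (\<Sum>y\<in>F ` V. 2 / \<mu> + 1)" by (rule sum_mono) (rule fibre)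
  also have "\<dots> = real (card (F ` V)) * (2 / \<mu> + 1)" by simp
  also have "\<dots> \<le> (4 * \<mu> / \<delta> + 1) * (2 / \<mu> + 1)" using values_le \<mu>0 by (intro mult_right_mono) auto
  finally have card_le: "real (card V) \<le> (4 * \<mu> / \<delta> + 1) * (2 / \<mu> + 1)" .
  \<comment> \<open>If every difference were parallel to (\<open>w1\<close>, \<open>w2\<close>), all
    determinants would vanish. So the shortest vector takes part in a nonzero determinant, and
    \<open>\<delta>\<close> is at most 4 \<mu>; this absorbs the summand 1 in the number of parallel
    lines.\<close>
  have "\<exists>s\<in>V. \<exists>t\<in>V. dt p q s t \<noteq> 0"
  proof (rule ccontr)
    assume "\<not> ?thesis"
    then have par: "w1 * (g t - g s) = w2 * (f t - f s)" if "s \<in> V" "t \<in> V" for s t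
      using that unfolding dt_def w1_def w2_def by auto
    have 1: "w1 * (g q0 - g p0) = w2 * (f q0 - f p0)" "w1 * (g t0 - g s0) = w2 * (f t0 - f s0)"
      using par p0 by auto
    have "w1 * dt p0 q0 s0 t0 = (f q0 - f p0) * (w1 * (g t0 - g s0)) - (w1 * (g q0 - g p0)) * (f t0 - f s0)"
      unfolding dt_def by (simp add: algebra_simps)
    also have "\<dots> = 0" unfolding 1 by (simp add: algebra_simps)
    finally have "w1 = 0" using p0(5) by simp
    have "w2 * dt p0 q0 s0 t0 = (w2 * (f q0 - f p0)) * (g t0 - g s0) - (g q0 - g p0) * (w2 * (f t0 - f s0))"
      unfolding dt_def by (simp add: algebra_simps)
    also have "\<dots> = 0" unfolding 1[symmetric] by (simp add: algebra_simps)
    finally have "w2 = 0" using p0(5) by simp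
    then show False using \<open>w1 = 0\<close> w0 by simp
  qed
  then obtain s t where st: "s \<in> V" "t \<in> V" "dt p q s t \<noteq> 0" by blast
  have "\<delta> \<le> \<bar>F t - F s\<bar>" using \<delta>_le[OF pq(1,2) st] F_diff by simp
  then have \<delta>4: "\<delta> \<le> 4 * \<mu>" using F_bound[OF st(1)] F_bound[OF st(2)] by linarith
  have \<mu>2: "\<mu> \<le> 2" using \<mu>w bf[OF pq(1)] bf[OF pq(2)] bg[OF pq(1)] bg[OF pq(2)] unfolding w1_def w2_def by linarith
  have "\<delta> * real (card V) \<le> \<delta> * ((4 * \<mu> / \<delta> + 1) * (2 / \<mu> + 1))"
    using card_le \<delta>0 by (intro mult_left_mono) auto
  also have "\<dots> = (4 * \<mu> + \<delta>) * (2 / \<mu> + 1)" using \<delta>0 by (simp add: field_simps)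
  also have "\<dots> \<le> (8 * \<mu>) * (2 / \<mu> + 1)" using \<delta>4 \<mu>0 by (intro mult_right_mono) auto
  also have "\<dots> = 16 + 8 * \<mu>" using \<mu>0 by (simp add: field_simps)
  also have "\<dots> \<le> 32" using \<mu>2 by simp
  finally show ?thesis using p0 by blast
qed

lemma small_int_determinant:
  fixes f g :: "'a \<Rightarrow> int" and F G :: int
  defines "dt \<equiv> \<lambda>p q s t. (f q - f p) * (g t - g s) - (g q - g p) * (f t - f s)"
  assumes fin: "finite V" and pos: "F > 0" "G > 0"
    and bf: "\<And>s. s \<in> V \<Longrightarrow> \<bar>f s\<bar> \<le> F" and bg: "\<And>s. s \<in> V \<Longrightarrow> \<bar>g s\<bar> \<le> G"
    and inj: "\<And>s t. s \<in> V \<Longrightarrow> t \<in> V \<Longrightarrow> f s = f t \<Longrightarrow> g s = g t \<Longrightarrow> s = t"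
    and ex: "\<exists>p\<in>V. \<exists>q\<in>V. \<exists>s\<in>V. \<exists>t\<in>V. dt p q s t \<noteq> 0"
  shows "\<exists>p\<in>V. \<exists>q\<in>V. \<exists>s\<in>V. \<exists>t\<in>V. dt p q s t \<noteq> 0 \<and> \<bar>dt p q s t\<bar> * int (card V) \<le> 32 * F * G"
proof -
  define f' g' where "f' s = of_int (f s) / (of_int F :: real)" and "g' s = of_int (g s) / (of_int G :: real)" for s
  have posr: "(of_int F :: real) > 0" "(of_int G :: real) > 0" using pos by auto
  have dt_eq: "(f' q - f' p) * (g' t - g' s) - (g' q - g' p) * (f' t - f' s) = of_int (dt p q s t) / (of_int F * of_int G)"
    for p q s t
    using posr unfolding f'_def g'_def dt_def by (simp add: field_simps)
  have "\<exists>p\<in>V. \<exists>q\<in>V. \<exists>s\<in>V. \<exists>t\<in>V.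
      (f' q - f' p) * (g' t - g' s) - (g' q - g' p) * (f' t - f' s) \<noteq> 0 \<and>
      \<bar>(f' q - f' p) * (g' t - g' s) - (g' q - g' p) * (f' t - f' s)\<bar> * real (card V) \<le> 32"
  proof (rule small_determinant[OF fin])
    fix s assume "s \<in> V"
    then have "of_int \<bar>f s\<bar> \<le> (of_int F :: real)" "of_int \<bar>g s\<bar> \<le> (of_int G :: real)"
      using bf bg by (auto simp only: of_int_le_iff)
    then show "\<bar>f' s\<bar> \<le> 1" "\<bar>g' s\<bar> \<le> 1" using posr unfolding f'_def g'_def by (auto simp: abs_divide divide_le_eq)
  next
    fix s t assume "s \<in> V" "t \<in> V" "f' s = f' t" "g' s = g' t"
    then show "s = t" using posr inj unfolding f'_def g'_def by simp
  next
    show "\<exists>p\<in>V. \<exists>q\<in>V. \<exists>s\<in>V. \<exists>t\<in>V. (f' q - f' p) * (g' t - g' s) - (g' q - g' p) * (f' t - f' s) \<noteq> 0"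
      using ex posr unfolding dt_eq by auto
  qed
  then obtain p q s t where V: "p \<in> V" "q \<in> V" "s \<in> V" "t \<in> V"
    and nz: "of_int (dt p q s t) / (of_int F * of_int G) \<noteq> (0::real)"
    and le: "\<bar>of_int (dt p q s t) / (of_int F * of_int G)\<bar> * real (card V) \<le> 32"
    unfolding dt_eq by blast
  have "\<bar>of_int (dt p q s t)\<bar> * real (card V) \<le> 32 * of_int F * of_int G"
    using le posr by (simp add: abs_divide abs_mult field_simps)
  then have "real_of_int (\<bar>dt p q s t\<bar> * int (card V)) \<le> real_of_int (32 * F * G)" by simp
  then have "\<bar>dt p q s t\<bar> * int (card V) \<le> 32 * F * G" by (simp only: of_int_le_iff)
  moreover have "dt p q s t \<noteq> 0" using nz by auto
  ultimately show ?thesis using V by blast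
qed

section \<open>Concentration of discrete logarithms: pairs\<close>

text \<open>Three distinct points with one value force first \<open>\<alpha>\<close> and then
  \<open>\<beta>\<close> to vanish. The case \<alpha> = 0 is included so that affine and quadratic
  test functions satisfy one and the same hypothesis in the counting lemmas.\<close>

lemma card_quadratic_fibre_le:
  fixes S :: "int set"
  assumes "\<alpha> \<noteq> 0 \<or> \<beta> \<noteq> 0"
  shows "card {y\<in>S. \<alpha> * y\<^sup>2 + \<beta> * y + \<gamma> = v} \<le> 2"
proof (rule ccontr)
  assume "\<not> ?thesis"
  then have "3 \<le> card {y\<in>S. \<alpha> * y\<^sup>2 + \<beta> * y + \<gamma> = v}" by simp
  then obtain T where T: "T \<subseteq> {y\<in>S. \<alpha> * y\<^sup>2 + \<beta> * y + \<gamma> = v}" "card T = 3"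
    by (meson obtain_subset_with_card_n)
  then obtain y1 y2 y3 where T3: "T = {y1, y2, y3}" "y1 \<noteq> y2" "y2 \<noteq> y3" "y1 \<noteq> y3"
    by (metis card_3_iff)
  then have e: "\<alpha> * y1\<^sup>2 + \<beta> * y1 + \<gamma> = v" "\<alpha> * y2\<^sup>2 + \<beta> * y2 + \<gamma> = v" "\<alpha> * y3\<^sup>2 + \<beta> * y3 + \<gamma> = v"
    using T(1) by auto
  have "(y1 - y2) * (\<alpha> * (y1 + y2) + \<beta>) = (\<alpha> * y1\<^sup>2 + \<beta> * y1 + \<gamma>) - (\<alpha> * y2\<^sup>2 + \<beta> * y2 + \<gamma>)"
    by (simp add: algebra_simps power2_eq_square)
  also have "\<dots> = 0" using e by simp
  finally have "(y1 - y2) * (\<alpha> * (y1 + y2) + \<beta>) = 0" .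
  then have 1: "\<alpha> * (y1 + y2) + \<beta> = 0" using T3 by simp
  have "(y1 - y3) * (\<alpha> * (y1 + y3) + \<beta>) = (\<alpha> * y1\<^sup>2 + \<beta> * y1 + \<gamma>) - (\<alpha> * y3\<^sup>2 + \<beta> * y3 + \<gamma>)"
    by (simp add: algebra_simps power2_eq_square)
  also have "\<dots> = 0" using e by simp
  finally have "(y1 - y3) * (\<alpha> * (y1 + y3) + \<beta>) = 0" .
  then have 2: "\<alpha> * (y1 + y3) + \<beta> = 0" using T3 by simp
  have "\<alpha> * (y2 - y3) = (\<alpha> * (y1 + y2) + \<beta>) - (\<alpha> * (y1 + y3) + \<beta>)" by (simp add: algebra_simps)
  then have "\<alpha> * (y2 - y3) = 0" using 1 2 by simp
  then have "\<alpha> = 0" using T3 by simp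
  then show False using 1 assms by simp
qed

text \<open>\<open>x\<close> is a discrete logarithm to the base \<open>G\<close> on the shifted points \<open>S + b\<close>, and \<open>D\<close> bounds
  the number of divisors of every integer that will occur; the largest of these are products of three
  values of size at most \<open>144 H ^ 4\<close>.\<close>
locale log_points =
  fixes p b c G H :: int and S :: "int set" and x :: "int \<Rightarrow> nat" and K D :: nat
  assumes p_prime: "prime p" and H_pos: "1 \<le> H" and H_le: "H \<le> p"
    and S_sub: "S \<subseteq> {0..<H}" and x_inj: "inj_on x S" and x_less: "y \<in> S \<Longrightarrow> x y < K"
    and log: "y \<in> S \<Longrightarrow> [y + b = c * G ^ x y] (mod p)"
    and divisors: "m \<noteq> 0 \<Longrightarrow> \<bar>m\<bar> \<le> 3000000 * H ^ 12 \<Longrightarrow> card {d. d dvd m} \<le> D"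
begin

lemma p_pos: "p > 0" using p_prime by (simp add: prime_gt_0_int)

lemma finite_S: "finite S" using S_sub finite_subset by blast

lemma S_bounds: "y \<in> S \<Longrightarrow> 0 \<le> y \<and> y < H" using S_sub by auto

lemma D_pos: "D \<ge> 1"
proof -
  have "card {d. d dvd (1::int)} \<le> D"
    by (rule divisors) (use one_le_power[OF H_pos, of 12] in auto)
  moreover have "card {d. d dvd (1::int)} > 0"
    using finite_divisors_int[of 1] by (auto simp: card_gt_0_iff intro: exI[of _ 1])
  ultimately show ?thesis by simp
qed

text \<open>Empty for arguments where \<open>D\<close> is not known to bound the number of divisors,
  so that finiteness and the bound \<open>D\<close> hold for every argument.\<close>

definition Dv :: "int \<Rightarrow> int set" where
  "Dv m = (if m \<noteq> 0 \<and> \<bar>m\<bar> \<le> 3000000 * H ^ 12 then {d. d dvd m} else {})"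

lemma finite_Dv: "finite (Dv m)" by (simp add: Dv_def finite_divisors_int)

lemma card_Dv: "card (Dv m) \<le> D" using divisors by (simp add: Dv_def)

lemma card_value_in_Dv:
  assumes "\<And>v. card {y\<in>S. q y = v} \<le> 2"
  shows "card {y\<in>S. q y \<in> Dv m} \<le> 2 * D"
proof -
  have "card {y\<in>S. q y \<in> Dv m} \<le> 2 * card (q ` {y\<in>S. q y \<in> Dv m})"
  proof (rule card_le_fibres)
    fix v
    have "card {y \<in> {y\<in>S. q y \<in> Dv m}. q y = v} \<le> card {y\<in>S. q y = v}"
      by (rule card_mono) (use finite_S in auto)
    also have "\<dots> \<le> 2" by (rule assms)
    finally show "card {y \<in> {y\<in>S. q y \<in> Dv m}. q y = v} \<le> 2" .
  qed (use finite_S in simp)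
  also have "card (q ` {y\<in>S. q y \<in> Dv m}) \<le> card (Dv m)"
    by (rule card_mono[OF finite_Dv]) auto
  finally show ?thesis using card_Dv[of m] by linarith
qed

section \<open>Quadruples with equal sums of exponents\<close>

definition E2 where
  "E2 = {((a1, a2), (a3, a4)). a1 \<in> S \<and> a2 \<in> S \<and> a3 \<in> S \<and> a4 \<in> S \<and> x a1 + x a2 = x a3 + x a4}"

text \<open>The quadruples off the two diagonals. Only the first entry is compared: equal sums and
  the injectivity of \<open>x\<close> exclude the coincidences of the second entry as well.\<close>

definition Q2 where
  "Q2 = {((a1, a2), (a3, a4)). ((a1, a2), (a3, a4)) \<in> E2 \<and> a1 \<noteq> a3 \<and> a1 \<noteq> a4}"

text \<open>The coefficients of \<open>(T + a1) (T + a2) - (T + a3) (T + a4)\<close>, a polynomial vanishing at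
  \<open>b\<close> modulo \<open>p\<close>; its value at \<open>-a1\<close> is \<open>- (a3 - a1) (a4 - a1)\<close>.\<close>
definition z2 :: "(int \<times> int) \<times> (int \<times> int) \<Rightarrow> int \<times> int" where
  "z2 = (\<lambda>((a1, a2), (a3, a4)). (a1 + a2 - a3 - a4, a1 * a2 - a3 * a4))"

lemma x_eq: "a \<in> S \<Longrightarrow> a' \<in> S \<Longrightarrow> x a = x a' \<Longrightarrow> a = a'"
  using x_inj by (rule inj_onD)

lemma E2_sub: "E2 \<subseteq> (S \<times> S) \<times> (S \<times> S)" unfolding E2_def by auto

lemma finite_E2: "finite E2" by (rule finite_subset[OF E2_sub]) (use finite_S in auto)

lemma finite_Q2: "finite Q2" by (rule finite_subset[OF _ finite_E2]) (auto simp: Q2_def)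

lemma card_E2_ge: "card S ^ 4 \<le> 2 * K * card E2"
proof -
  let ?f = "\<lambda>(a, a'). x a + x a'"
  have "?f ` (S \<times> S) \<subseteq> {..<2 * K}"
  proof (rule image_subsetI)
    fix u assume "u \<in> S \<times> S"
    then have "x (fst u) < K" "x (snd u) < K" by (auto intro: x_less)
    then show "?f u \<in> {..<2 * K}" by (simp add: split_beta)
  qed
  then have "(card (S \<times> S))\<^sup>2 \<le> card {..<2 * K} * card {(u, v). u \<in> S \<times> S \<and> v \<in> S \<times> S \<and> ?f u = ?f v}"
    by (intro card_squared_le_collisions) (use finite_S in auto)
  also have "{(u, v). u \<in> S \<times> S \<and> v \<in> S \<times> S \<and> ?f u = ?f v} = E2" unfolding E2_def by auto
  finally show ?thesis by (simp add: card_cartesian_product power_mult_distrib flip: power_mult)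
qed

lemma card_E2_le: "card E2 \<le> 2 * (card S)\<^sup>2 + card Q2"
proof -
  have "E2 \<subseteq> (\<lambda>(a, a'). ((a, a'), (a, a'))) ` (S \<times> S) \<union> (\<lambda>(a, a'). ((a, a'), (a', a))) ` (S \<times> S) \<union> Q2"
  proof
    fix t assume t: "t \<in> E2"
    obtain a1 a2 a3 a4 where t_eq: "t = ((a1, a2), (a3, a4))" by (metis prod.collapse)
    have S4: "a1 \<in> S" "a2 \<in> S" "a3 \<in> S" "a4 \<in> S" "x a1 + x a2 = x a3 + x a4"
      using t unfolding t_eq E2_def by auto
    have "a1 = a3 \<Longrightarrow> a2 = a4" "a1 = a4 \<Longrightarrow> a2 = a3" using S4 x_eq by auto
    then show "t \<in> (\<lambda>(a, a'). ((a, a'), (a, a'))) ` (S \<times> S) \<union> (\<lambda>(a, a'). ((a, a'), (a', a))) ` (S \<times> S) \<union> Q2"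
      using t S4 unfolding t_eq Q2_def by (auto simp: image_iff)
  qed
  then have "card E2 \<le> card ((\<lambda>(a, a'). ((a, a'), (a, a'))) ` (S \<times> S) \<union> (\<lambda>(a, a'). ((a, a'), (a', a))) ` (S \<times> S) \<union> Q2)"
    by (intro card_mono) (use finite_S finite_Q2 in auto)
  also have "\<dots> \<le> card ((\<lambda>(a, a'). ((a, a'), (a, a'))) ` (S \<times> S)) + card ((\<lambda>(a, a'). ((a, a'), (a', a))) ` (S \<times> S)) + card Q2"
    by (meson add_le_mono1 card_Un_le le_trans)
  also have "\<dots> \<le> card (S \<times> S) + card (S \<times> S) + card Q2"
    by (intro add_mono card_image_le) (use finite_S in auto)
  finally show ?thesis by (simp add: card_cartesian_product power2_eq_square)
qed

lemma Q2_D: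
  assumes "((a1, a2), (a3, a4)) \<in> Q2"
  shows "a1 \<in> S" "a2 \<in> S" "a3 \<in> S" "a4 \<in> S" "x a1 + x a2 = x a3 + x a4"
    and "a1 \<noteq> a3" "a1 \<noteq> a4" "a2 \<noteq> a3" "a2 \<noteq> a4"
proof -
  show 1: "a1 \<in> S" "a2 \<in> S" "a3 \<in> S" "a4 \<in> S" "x a1 + x a2 = x a3 + x a4" "a1 \<noteq> a3" "a1 \<noteq> a4"
    using assms unfolding Q2_def E2_def by auto
  show "a2 \<noteq> a3" "a2 \<noteq> a4" using 1 x_eq[of a1 a4] x_eq[of a1 a3] by auto
qed

lemma z2_dvd:
  assumes "((a1, a2), (a3, a4)) \<in> Q2"
  shows "p dvd (a1 * a2 - a3 * a4) + b * (a1 + a2 - a3 - a4)"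
proof -
  note Q = Q2_D[OF assms]
  have "[(a1 + b) * (a2 + b) = (c * G ^ x a1) * (c * G ^ x a2)] (mod p)"
    by (intro cong_mult log Q)
  also have "(c * G ^ x a1) * (c * G ^ x a2) = c\<^sup>2 * G ^ (x a1 + x a2)"
    by (simp add: power_add power2_eq_square)
  also have "\<dots> = (c * G ^ x a3) * (c * G ^ x a4)"
    unfolding Q(5) by (simp add: power_add power2_eq_square)
  also have "[\<dots> = (a3 + b) * (a4 + b)] (mod p)"
    by (intro cong_mult cong_sym[OF log] Q)
  finally have "p dvd (a1 + b) * (a2 + b) - (a3 + b) * (a4 + b)" by (simp add: cong_iff_dvd_diff)
  then show ?thesis by (simp add: algebra_simps)
qed

lemma abs_mult_le_H2: "a \<in> S \<Longrightarrow> a' \<in> S \<Longrightarrow> 0 \<le> a * a' \<and> a * a' \<le> H\<^sup>2"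
  unfolding power2_eq_square using S_bounds[of a] S_bounds[of a'] by (auto intro!: mult_mono)

lemma z2_bounds:
  assumes "((a1, a2), (a3, a4)) \<in> Q2"
  shows "\<bar>a1 + a2 - a3 - a4\<bar> \<le> 2 * H" "\<bar>a1 * a2 - a3 * a4\<bar> \<le> H\<^sup>2"
proof -
  note Q = Q2_D[OF assms]
  show "\<bar>a1 + a2 - a3 - a4\<bar> \<le> 2 * H" using S_bounds Q(1-4) by (smt (verit))
  show "\<bar>a1 * a2 - a3 * a4\<bar> \<le> H\<^sup>2"
    using abs_mult_le_H2[OF Q(1,2)] abs_mult_le_H2[OF Q(3,4)] by linarith
qed

lemma H_power_mono: "m \<le> n \<Longrightarrow> H ^ m \<le> H ^ n"
  using H_pos by (simp add: power_increasing)

text \<open>Fixing \<open>a1\<close> and the polynomial fixes its nonzero value at -a1, so a3 - a1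
  is one of at most \<open>D\<close> divisors. It determines a4, and the linear coefficient then
  determines a2.\<close>

lemma card_Q2_le: "card Q2 \<le> card S * card (z2 ` Q2) * D"
proof -
  let ?f = "\<lambda>t. (fst (fst t), z2 t)"
  have "card Q2 \<le> D * card (?f ` Q2)"
  proof (rule card_le_fibres[OF finite_Q2])
    fix y assume "y \<in> ?f ` Q2"
    obtain a1 w1 w2 where y: "y = (a1, (w1, w2))" by (metis prod.collapse)
    let ?g = "\<lambda>((a1, a2), (a3, a4)). a3 - a1 :: int"
    let ?m = "w2 - a1 * w1"
    have mem: "\<exists>a2 a3 a4. t = ((a1, a2), (a3, a4)) \<and> ((a1, a2), (a3, a4)) \<in> Q2 \<and> w1 = a1 + a2 - a3 - a4
        \<and> w2 = a1 * a2 - a3 * a4" if "t \<in> {t\<in>Q2. ?f t = y}" for t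
      using that unfolding y z2_def by (cases t) auto
    have prod: "?m = - ((a3 - a1) * (a4 - a1))" if "w1 = a1 + a2 - a3 - a4" "w2 = a1 * a2 - a3 * a4" for a2 a3 a4
      unfolding that by (simp add: algebra_simps)
    have "card {t\<in>Q2. ?f t = y} \<le> card (Dv ?m)"
    proof (rule card_inj_on_le[of ?g])
      show "inj_on ?g {t\<in>Q2. ?f t = y}"
      proof (rule inj_onI)
        fix t t' assume t: "t \<in> {t\<in>Q2. ?f t = y}" "t' \<in> {t\<in>Q2. ?f t = y}" and g: "?g t = ?g t'"
        obtain a2 a3 a4 where a: "t = ((a1, a2), (a3, a4))" "((a1, a2), (a3, a4)) \<in> Q2"
          "w1 = a1 + a2 - a3 - a4" "w2 = a1 * a2 - a3 * a4" using mem[OF t(1)] by blast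
        obtain b2 b3 b4 where b: "t' = ((a1, b2), (b3, b4))" "((a1, b2), (b3, b4)) \<in> Q2"
          "w1 = a1 + b2 - b3 - b4" "w2 = a1 * b2 - b3 * b4" using mem[OF t(2)] by blast
        have 3: "a3 = b3" using g a(1) b(1) by simp
        have "(a3 - a1) * (a4 - a1) = (b3 - a1) * (b4 - a1)"
          using prod[OF a(3,4)] prod[OF b(3,4)] by simp
        moreover have "b3 - a1 \<noteq> 0" using Q2_D(6)[OF b(2)] by simp
        ultimately have 4: "a4 = b4" unfolding 3 by simp
        then show "t = t'" using 3 a b by simp
      qed
      show "?g ` {t\<in>Q2. ?f t = y} \<subseteq> Dv ?m"
      proof (rule image_subsetI)
        fix t assume t: "t \<in> {t\<in>Q2. ?f t = y}"
        obtain a2 a3 a4 where a: "t = ((a1, a2), (a3, a4))" "((a1, a2), (a3, a4)) \<in> Q2"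
          "w1 = a1 + a2 - a3 - a4" "w2 = a1 * a2 - a3 * a4" using mem[OF t] by blast
        note Q = Q2_D[OF a(2)]
        have m: "?m = - ((a3 - a1) * (a4 - a1))" by (rule prod[OF a(3,4)])
        have "\<bar>a3 - a1\<bar> \<le> H" "\<bar>a4 - a1\<bar> \<le> H" using S_bounds[OF Q(1)] S_bounds[OF Q(3)] S_bounds[OF Q(4)] by auto
        then have "\<bar>?m\<bar> \<le> H * H" unfolding m abs_minus_cancel abs_mult using H_pos by (intro mult_mono) auto
        also have "\<dots> \<le> 3000000 * H ^ 12"
          using H_power_mono[of 2 12] zero_le_power[of H 12] H_pos unfolding power2_eq_square by linarith
        finally have "\<bar>?m\<bar> \<le> 3000000 * H ^ 12" .
        moreover have "?m \<noteq> 0" unfolding m using Q by simp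
        moreover have "a3 - a1 dvd ?m" unfolding m by simp
        ultimately show "?g t \<in> Dv ?m" unfolding Dv_def a(1) by simp
      qed
    qed (rule finite_Dv)
    then show "card {t\<in>Q2. ?f t = y} \<le> D" using card_Dv[of ?m] by linarith
  qed
  also have "card (?f ` Q2) \<le> card (S \<times> z2 ` Q2)"
  proof (rule card_mono)
    show "?f ` Q2 \<subseteq> S \<times> z2 ` Q2" unfolding Q2_def E2_def by auto
  qed (use finite_S finite_Q2 in auto)
  finally show ?thesis by (simp add: card_cartesian_product mult.commute)
qed

text \<open>If \<open>q\<close> has equal nonzero products over the two pairs, then a3 and a4 have
  values dividing a number fixed by the first pair. Each value is taken at most twice, which leaves
  2 D choices for either of them. The bound 1000 H^6 keeps the product of two values within the
  range covered by \<open>divisors\<close>.\<close>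

lemma card_Q2_le_rigid:
  assumes "\<And>v. card {y\<in>S. q y = v} \<le> 2" "\<And>y. y \<in> S \<Longrightarrow> \<bar>q y\<bar> \<le> 1000 * H ^ 6"
    and "\<And>a1 a2 a3 a4. ((a1, a2), (a3, a4)) \<in> Q2 \<Longrightarrow> q a1 * q a2 = q a3 * q a4 \<and> q a1 * q a2 \<noteq> 0"
  shows "card Q2 \<le> 4 * D\<^sup>2 * (card S)\<^sup>2"
proof -
  let ?A = "\<lambda>m. {y\<in>S. q y \<in> Dv m}"
  have "card Q2 \<le> (2 * D * (2 * D)) * card (fst ` Q2)"
  proof (rule card_le_fibres[OF finite_Q2])
    fix u :: "int \<times> int"
    obtain a1 a2 where u: "u = (a1, a2)" by (cases u)
    let ?m = "q a1 * q a2"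
    have "{t\<in>Q2. fst t = u} \<subseteq> {u} \<times> (?A ?m \<times> ?A ?m)"
    proof
      fix t assume t: "t \<in> {t\<in>Q2. fst t = u}"
      then obtain a3 a4 where a: "t = ((a1, a2), (a3, a4))" "((a1, a2), (a3, a4)) \<in> Q2"
        unfolding u by (cases t) auto
      note Q = Q2_D[OF a(2)]
      have m: "?m = q a3 * q a4" "?m \<noteq> 0" using assms(3)[OF a(2)] by auto
      have "\<bar>?m\<bar> \<le> (1000 * H ^ 6) * (1000 * H ^ 6)"
        unfolding abs_mult using assms(2) Q H_pos by (intro mult_mono) auto
      also have "\<dots> = 1000000 * H ^ 12" by (simp flip: power_add)
      also have "\<dots> \<le> 3000000 * H ^ 12" using H_pos by simp
      finally show "t \<in> {u} \<times> (?A ?m \<times> ?A ?m)" using m Q unfolding a u Dv_def by auto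
    qed
    then have "card {t\<in>Q2. fst t = u} \<le> card ({u} \<times> (?A ?m \<times> ?A ?m))"
      by (intro card_mono) (use finite_S in auto)
    also have "\<dots> = card (?A ?m) * card (?A ?m)" by (simp add: card_cartesian_product)
    also have "\<dots> \<le> 2 * D * (2 * D)" by (intro mult_mono card_value_in_Dv assms) auto
    finally show "card {t\<in>Q2. fst t = u} \<le> 2 * D * (2 * D)" .
  qed
  also have "card (fst ` Q2) \<le> card (S \<times> S)"
    by (rule card_mono) (use finite_S in \<open>auto simp: Q2_def E2_def\<close>)
  finally show ?thesis by (simp add: card_cartesian_product power2_eq_square mult.assoc)
qed

text \<open>All polynomials are multiples of v1 T + v2 and share the root -v2 / v1. The test
  function v1 y - v2 is v1 times y plus this root, so evaluating both products of a quadruple at the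
  root shows that its products agree. It does not vanish at a1 or a2, because the value of the
  polynomial there is nonzero.\<close>

lemma card_E2_le_collinear:
  assumes "\<And>v w. v \<in> z2 ` Q2 \<Longrightarrow> w \<in> z2 ` Q2 \<Longrightarrow> fst v * snd w = snd v * fst w"
  shows "card E2 \<le> 6 * D\<^sup>2 * (card S)\<^sup>2"
proof -
  have "card Q2 \<le> 4 * D\<^sup>2 * (card S)\<^sup>2"
  proof (cases "Q2 = {}")
    case False
    then obtain t where t: "t \<in> Q2" by blast
    obtain b1 b2 b3 b4 where tb: "t = ((b1, b2), (b3, b4))" by (metis prod.collapse)
    define v1 where "v1 = b1 + b2 - b3 - b4"
    define v2 where "v2 = b1 * b2 - b3 * b4"
    note B = Q2_D[OF t[unfolded tb]]
    have v_in: "(v1, v2) \<in> z2 ` Q2" using t unfolding tb v1_def v2_def by (force simp: z2_def)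
    \<comment> \<open>A constant polynomial vanishing at \<open>b\<close> modulo p would make p
      divide one of the nonzero differences b1 - b3, b1 - b4, whose size is less than H.\<close>
    have v1: "v1 \<noteq> 0"
    proof
      assume 0: "v1 = 0"
      have "p dvd v2 + b * v1" using z2_dvd[OF t[unfolded tb]] unfolding v1_def v2_def .
      moreover have "v2 - b1 * v1 = - ((b1 - b3) * (b1 - b4))" unfolding v1_def v2_def by (simp add: algebra_simps)
      ultimately have "p dvd (b1 - b3) * (b1 - b4)" using 0 by simp
      then have "p dvd b1 - b3 \<or> p dvd b1 - b4" using p_prime prime_dvd_mult_iff by blast
      moreover have "\<not> p dvd b1 - b" if "b \<in> S" "b1 \<noteq> b" for b
        using that(2) dvd_imp_le_int[of "b1 - b" p] S_bounds[OF B(1)] S_bounds[OF that(1)] H_le by linarith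
      ultimately show False using B by blast
    qed
    have v_bounds: "\<bar>v1\<bar> \<le> 2 * H" "\<bar>v2\<bar> \<le> H\<^sup>2" using z2_bounds[OF t[unfolded tb]] unfolding v1_def v2_def by auto
    let ?q = "\<lambda>y. v1 * y - v2"
    show ?thesis
    proof (rule card_Q2_le_rigid[of ?q])
      fix v
      have "{y\<in>S. ?q y = v} = {y\<in>S. 0 * y\<^sup>2 + v1 * y + (- v2) = v}" by auto
      then show "card {y\<in>S. ?q y = v} \<le> 2" using card_quadratic_fibre_le[of 0 v1 S "- v2" v] v1 by simp
    next
      fix y assume "y \<in> S"
      then have y: "\<bar>y\<bar> \<le> H" using S_bounds[of y] by auto
      have "\<bar>v1 * y\<bar> \<le> 2 * H * H" unfolding abs_mult using v_bounds y H_pos by (intro mult_mono) auto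
      then have "\<bar>?q y\<bar> \<le> 3 * H ^ 2" using v_bounds(2) unfolding power2_eq_square by linarith
      also have "\<dots> \<le> 1000 * H ^ 6" using H_power_mono[of 2 6] zero_le_power[of H 6] H_pos by linarith
      finally show "\<bar>?q y\<bar> \<le> 1000 * H ^ 6" .
    next
      fix a1 a2 a3 a4 assume a: "((a1, a2), (a3, a4)) \<in> Q2"
      note Q = Q2_D[OF a]
      define w1 where "w1 = a1 + a2 - a3 - a4"
      define w2 where "w2 = a1 * a2 - a3 * a4"
      have "(w1, w2) \<in> z2 ` Q2" using a unfolding w1_def w2_def by (force simp: z2_def)
      from assms[OF v_in this] have par: "v1 * w2 = v2 * w1" by simp
      have eq: "?q a1 * ?q a2 - ?q a3 * ?q a4 = v1 * (v1 * w2 - v2 * w1)"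
        unfolding w1_def w2_def by (simp add: algebra_simps)
      have nz: "?q a \<noteq> 0" if "a = a1 \<or> a = a2" for a
      proof
        assume "?q a = 0"
        then have "v1 * (w2 - a * w1) = v1 * w2 - v2 * w1" by (simp add: algebra_simps)
        then have "w2 - a * w1 = 0" using par v1 by simp
        moreover have "w2 - a * w1 = - ((a3 - a) * (a4 - a))"
          using that unfolding w1_def w2_def by (auto simp: algebra_simps)
        ultimately show False using that Q by auto
      qed
      have "?q a1 * ?q a2 = ?q a3 * ?q a4" using eq par by simp
      moreover have "?q a1 * ?q a2 \<noteq> 0" using nz by simp
      ultimately show "?q a1 * ?q a2 = ?q a3 * ?q a4 \<and> ?q a1 * ?q a2 \<noteq> 0" ..
    qed
  qed simp
  moreover have "2 * (card S)\<^sup>2 \<le> 2 * D\<^sup>2 * (card S)\<^sup>2" using D_pos by simp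
  ultimately show ?thesis using card_E2_le by linarith
qed


text \<open>Modulo p all coefficient vectors are multiples of (1, -b), hence determinants of their
  differences are divisible by p. If two vectors are independent, some nonzero determinant is both
  at least p and at most 64 H^3 divided by the number of vectors, so there are at most 64 H^3 / p of
  them; 256 is 4 times 64.\<close>

lemma card_S_bound2:
  "(card S)\<^sup>2 \<le> 12 * K * D\<^sup>2 \<or> real (card S) ^ 3 * of_int p \<le> 256 * real K * real D * of_int H ^ 3"
proof (cases "S = {}")
  case False
  then have N: "card S > 0" using finite_S by (simp add: card_gt_0_iff)
  show ?thesis
  proof (cases "\<forall>v\<in>z2 ` Q2. \<forall>w\<in>z2 ` Q2. fst v * snd w = snd v * fst w")
    case True
    then have "card E2 \<le> 6 * D\<^sup>2 * (card S)\<^sup>2" by (intro card_E2_le_collinear) blast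
    then have "card S ^ 4 \<le> 2 * K * (6 * D\<^sup>2 * (card S)\<^sup>2)"
      using card_E2_ge by (meson le_trans mult_le_mono2)
    then have "(card S)\<^sup>2 * (card S)\<^sup>2 \<le> (12 * K * D\<^sup>2) * (card S)\<^sup>2"
      by (simp add: power4_eq_xxxx power2_eq_square mult.assoc mult.left_commute)
    then have "(card S)\<^sup>2 \<le> 12 * K * D\<^sup>2" using N by (subst (asm) mult_le_cancel2) auto
    then show ?thesis ..
  next
    case nc: False
    \<comment> \<open>The origin turns the vectors themselves into differences of points, so that
      two independent vectors give a nonzero determinant.\<close>
    let ?V = "insert (0, 0) (z2 ` Q2)"
    have V_dvd: "p dvd snd v + b * fst v" if "v \<in> ?V" for v
      using that z2_dvd by (auto simp: z2_def)
    have V_bd: "\<bar>fst v\<bar> \<le> 2 * H \<and> \<bar>snd v\<bar> \<le> H\<^sup>2" if "v \<in> ?V" for v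
      using that z2_bounds H_pos by (auto simp: z2_def)
    have "\<exists>v\<in>?V. \<exists>q\<in>?V. \<exists>s\<in>?V. \<exists>t\<in>?V.
      (fst q - fst v) * (snd t - snd s) - (snd q - snd v) * (fst t - fst s) \<noteq> 0 \<and>
      \<bar>(fst q - fst v) * (snd t - snd s) - (snd q - snd v) * (fst t - fst s)\<bar> * int (card ?V) \<le> 32 * (2 * H) * H\<^sup>2"
    proof (rule small_int_determinant)
      show "finite ?V" using finite_Q2 by simp
      obtain v w where vw: "v \<in> z2 ` Q2" "w \<in> z2 ` Q2" "fst v * snd w \<noteq> snd v * fst w" using nc by blast
      have "(fst v - fst (0, 0)) * (snd w - snd (0, 0)) - (snd v - snd (0, 0)) * (fst w - fst (0, 0)) \<noteq> (0::int)"
        using vw by simp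
      then show "\<exists>v\<in>?V. \<exists>q\<in>?V. \<exists>s\<in>?V. \<exists>t\<in>?V. (fst q - fst v) * (snd t - snd s) - (snd q - snd v) * (fst t - fst s) \<noteq> 0"
        using vw by blast
    qed (use V_bd H_pos in \<open>auto simp: prod_eq_iff\<close>)
    then obtain v q s t where V: "v \<in> ?V" "q \<in> ?V" "s \<in> ?V" "t \<in> ?V"
      and nz: "(fst q - fst v) * (snd t - snd s) - (snd q - snd v) * (fst t - fst s) \<noteq> 0"
      and le: "\<bar>(fst q - fst v) * (snd t - snd s) - (snd q - snd v) * (fst t - fst s)\<bar> * int (card ?V) \<le> 32 * (2 * H) * H\<^sup>2"
      by blast
    define d where "d = (fst q - fst v) * (snd t - snd s) - (snd q - snd v) * (fst t - fst s)"
    have "d = (fst q - fst v) * ((snd t + b * fst t) - (snd s + b * fst s))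
        - ((snd q + b * fst q) - (snd v + b * fst v)) * (fst t - fst s)"
      unfolding d_def by (simp add: algebra_simps)
    then have "p dvd d" using V_dvd V by (metis dvd_diff dvd_mult dvd_mult2)
    then have "p \<le> \<bar>d\<bar>" using nz p_pos dvd_imp_le_int[of d p] unfolding d_def by simp
    then have "p * int (card ?V) \<le> \<bar>d\<bar> * int (card ?V)" by (rule mult_right_mono) simp
    also have "\<dots> \<le> 64 * H ^ 3" using le unfolding d_def by (simp add: power2_eq_square power3_eq_cube)
    finally have "p * int (card ?V) \<le> 64 * H ^ 3" .
    moreover have "p * int (card (z2 ` Q2)) \<le> p * int (card ?V)"
      by (rule mult_left_mono) (use p_pos in \<open>simp_all add: card_insert_if finite_Q2\<close>)
    ultimately have "real_of_int (p * int (card (z2 ` Q2))) \<le> real_of_int (64 * H ^ 3)"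
      by (subst of_int_le_iff) linarith
    then have Vp: "of_int p * real (card (z2 ` Q2)) \<le> 64 * of_int H ^ 3" by simp
    have "card S ^ 4 \<le> 2 * K * (2 * (card S)\<^sup>2 + card S * card (z2 ` Q2) * D)"
      using card_E2_ge card_E2_le card_Q2_le by (meson add_left_mono le_trans mult_le_mono2)
    then have E: "card S ^ 4 \<le> 4 * K * (card S)\<^sup>2 + 2 * K * (card S * card (z2 ` Q2) * D)"
      by (simp add: algebra_simps)
    \<comment> \<open>Above the threshold the diagonal contribution 4 K N^2 is at most half of N^4
      and is absorbed; below it the first alternative holds.\<close>
    show ?thesis
    proof (cases "(card S)\<^sup>2 \<le> 8 * K")
      case True
      have "12 * K * 1 \<le> 12 * K * D\<^sup>2" by (rule mult_le_mono2) (use D_pos in simp)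
      then show ?thesis using True by linarith
    next
      case False
      then have "8 * K * (card S)\<^sup>2 \<le> (card S)\<^sup>2 * (card S)\<^sup>2" by (intro mult_le_mono1) simp
      also have "\<dots> = card S ^ 4" by (simp flip: power_add)
      finally have "8 * K * (card S)\<^sup>2 \<le> card S ^ 4" .
      then have "card S ^ 4 \<le> 4 * K * (card S * card (z2 ` Q2) * D)" using E by linarith
      then have "card S * card S ^ 3 \<le> card S * (4 * K * D * card (z2 ` Q2))"
        by (simp add: power4_eq_xxxx power3_eq_cube mult_ac)
      then have "card S ^ 3 \<le> 4 * K * D * card (z2 ` Q2)" using N by simp
      then have "real (card S ^ 3) \<le> real (4 * K * D * card (z2 ` Q2))" by (simp only: of_nat_le_iff)
      then have "real (card S) ^ 3 * of_int p \<le> (4 * real K * real D * real (card (z2 ` Q2))) * of_int p"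
        using p_pos by (intro mult_right_mono) auto
      also have "\<dots> = 4 * real K * real D * (of_int p * real (card (z2 ` Q2)))" by simp
      also have "\<dots> \<le> 4 * real K * real D * (64 * of_int H ^ 3)" by (intro mult_left_mono Vp) auto
      finally show ?thesis by simp
    qed
  qed
qed simp

text \<open>On such a short interval the determinant of two coefficient vectors, a multiple of p,
  has size at most 4 H^3 < p and is 0. The bound serves the sextuples whose two triples share an
  entry.\<close>

lemma card_E2_le_small:
  assumes "2000 * H ^ 6 < p"
  shows "card E2 \<le> 6 * D\<^sup>2 * (card S)\<^sup>2"
proof (rule card_E2_le_collinear)
  fix v w assume vw: "v \<in> z2 ` Q2" "w \<in> z2 ` Q2"
  have V_dvd: "p dvd snd v + b * fst v" if "v \<in> z2 ` Q2" for v
    using that z2_dvd by (auto simp: z2_def)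
  have V_bd: "\<bar>fst v\<bar> \<le> 2 * H \<and> \<bar>snd v\<bar> \<le> H\<^sup>2" if "v \<in> z2 ` Q2" for v
    using that z2_bounds H_pos by (auto simp: z2_def)
  let ?d = "fst v * snd w - snd v * fst w"
  have "?d = fst v * (snd w + b * fst w) - (snd v + b * fst v) * fst w" by (simp add: algebra_simps)
  then have "p dvd ?d" using V_dvd vw by (metis dvd_diff dvd_mult dvd_mult2)
  moreover have "\<bar>?d\<bar> < p"
  proof -
    have "\<bar>fst v * snd w\<bar> \<le> 2 * H * H\<^sup>2" "\<bar>snd v * fst w\<bar> \<le> H\<^sup>2 * (2 * H)"
      unfolding abs_mult using V_bd[OF vw(1)] V_bd[OF vw(2)] H_pos by (intro mult_mono; simp)+
    then have "\<bar>?d\<bar> \<le> 4 * H ^ 3" by (simp add: power2_eq_square power3_eq_cube)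
    also have "\<dots> \<le> 2000 * H ^ 6" using H_power_mono[of 3 6] zero_le_power[of H 6] H_pos by linarith
    finally show ?thesis using assms by simp
  qed
  ultimately have "?d = 0" using dvd_imp_le_int[of ?d p] by (cases "?d = 0") auto
  then show "fst v * snd w = snd v * fst w" by simp
qed

end

section \<open>Concentration of discrete logarithms: triples\<close>

text \<open>\<open>c1\<close>, \<open>c2\<close>, \<open>c3\<close> are the coordinates of the cross
  product of two differences, parallel to the normal (A, B, C) of the plane containing
  \<open>V\<close>. Dropping the coordinate in which the normal is largest, relative to the sizes H,
  H^2, H^3 of the coordinates, is injective on \<open>V\<close>, and
  \<open>small_int_determinant\<close> bounds one coordinate of the cross product. Proportionality
  to the normal bounds the other two; 288 is 32 * 3 * 3.\<close>

lemma small_cross_product: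
  fixes V :: "'a set" and f1 f2 f3 :: "'a \<Rightarrow> int" and A B C H :: int
  defines "c1 \<equiv> \<lambda>p q s t. (f2 q - f2 p) * (f1 t - f1 s) - (f1 q - f1 p) * (f2 t - f2 s)"
    and "c2 \<equiv> \<lambda>p q s t. (f1 q - f1 p) * (f3 t - f3 s) - (f3 q - f3 p) * (f1 t - f1 s)"
    and "c3 \<equiv> \<lambda>p q s t. (f3 q - f3 p) * (f2 t - f2 s) - (f2 q - f2 p) * (f3 t - f3 s)"
  assumes fin: "finite V" and H: "H \<ge> 1"
    and bd: "\<And>s. s \<in> V \<Longrightarrow> \<bar>f1 s\<bar> \<le> 3 * H \<and> \<bar>f2 s\<bar> \<le> 3 * H ^ 2 \<and> \<bar>f3 s\<bar> \<le> 3 * H ^ 3"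
    and inj: "\<And>s t. s \<in> V \<Longrightarrow> t \<in> V \<Longrightarrow> f1 s = f1 t \<Longrightarrow> f2 s = f2 t \<Longrightarrow> f3 s = f3 t \<Longrightarrow> s = t"
    and plane: "\<And>s. s \<in> V \<Longrightarrow> A * f3 s + B * f2 s + C * f1 s = 0" "A \<noteq> 0 \<or> B \<noteq> 0 \<or> C \<noteq> 0"
    and ex: "\<exists>p\<in>V. \<exists>q\<in>V. \<exists>s\<in>V. \<exists>t\<in>V. c1 p q s t \<noteq> 0 \<or> c2 p q s t \<noteq> 0 \<or> c3 p q s t \<noteq> 0"
  shows "\<exists>p\<in>V. \<exists>q\<in>V. \<exists>s\<in>V. \<exists>t\<in>V. (c1 p q s t \<noteq> 0 \<or> c2 p q s t \<noteq> 0 \<or> c3 p q s t \<noteq> 0)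
    \<and> \<bar>c1 p q s t\<bar> * int (card V) \<le> 288 * H ^ 3 \<and> \<bar>c2 p q s t\<bar> * int (card V) \<le> 288 * H ^ 4
    \<and> \<bar>c3 p q s t\<bar> * int (card V) \<le> 288 * H ^ 5"
proof -
  have par: "A * c2 p q s t = B * c1 p q s t" "B * c3 p q s t = C * c2 p q s t" "A * c3 p q s t = C * c1 p q s t"
    if "p \<in> V" "q \<in> V" "s \<in> V" "t \<in> V" for p q s t
  proof -
    define u1 u2 u3 v1 v2 v3 where "u1 = f1 q - f1 p" and "u2 = f2 q - f2 p" and "u3 = f3 q - f3 p"
      and "v1 = f1 t - f1 s" and "v2 = f2 t - f2 s" and "v3 = f3 t - f3 s"
    note uv = u1_def[symmetric] u2_def[symmetric] u3_def[symmetric] v1_def[symmetric] v2_def[symmetric] v3_def[symmetric]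
    have u: "A * u3 + B * u2 + C * u1 = 0"
      using plane(1)[OF that(1)] plane(1)[OF that(2)] unfolding u1_def u2_def u3_def by (simp add: algebra_simps)
    have v: "A * v3 + B * v2 + C * v1 = 0"
      using plane(1)[OF that(3)] plane(1)[OF that(4)] unfolding v1_def v2_def v3_def by (simp add: algebra_simps)
    show "A * c2 p q s t = B * c1 p q s t" using u v unfolding c1_def c2_def uv by algebra
    show "B * c3 p q s t = C * c2 p q s t" using u v unfolding c3_def c2_def uv by algebra
    show "A * c3 p q s t = C * c1 p q s t" using u v unfolding c1_def c3_def uv by algebra
  qed
  have Hp: "H ^ 2 = H * H" "H ^ 3 = H * H * H" "H ^ 4 = H * H * H * H" "H ^ 5 = H * H * H * H * H"
    by (simp_all add: eval_nat_numeral)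
  have Hpos: "3 * H > 0" "3 * H ^ 2 > 0" "3 * H ^ 3 > 0" using H by auto
  obtain p0 q0 s0 t0 where V0: "p0 \<in> V" "q0 \<in> V" "s0 \<in> V" "t0 \<in> V"
    and nz0: "c1 p0 q0 s0 t0 \<noteq> 0 \<or> c2 p0 q0 s0 t0 \<noteq> 0 \<or> c3 p0 q0 s0 t0 \<noteq> 0" using ex by blast
  note par0 = par[OF V0]
  \<comment> \<open>The three cases state which of |A| H^2, |B| H, |C| is the largest.\<close>
  consider (1) "\<bar>B\<bar> \<le> \<bar>A\<bar> * H" "\<bar>C\<bar> \<le> \<bar>A\<bar> * H ^ 2" "A \<noteq> 0"
    | (2) "\<bar>A\<bar> * H \<le> \<bar>B\<bar>" "\<bar>C\<bar> \<le> \<bar>B\<bar> * H" "B \<noteq> 0"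
    | (3) "\<bar>A\<bar> * H ^ 2 \<le> \<bar>C\<bar>" "\<bar>B\<bar> * H \<le> \<bar>C\<bar>" "C \<noteq> 0"
  proof -
    have mono: "a \<le> b \<Longrightarrow> a * H \<le> b * H" "a * H \<le> b * H \<Longrightarrow> a \<le> b" for a b :: int
      using H by auto
    have sq: "\<bar>A\<bar> * H ^ 2 = \<bar>A\<bar> * H * H" by (simp add: power2_eq_square)
    show ?thesis
    proof (cases "\<bar>C\<bar> \<le> \<bar>A\<bar> * H ^ 2")
      case True
      show ?thesis
      proof (cases "\<bar>B\<bar> \<le> \<bar>A\<bar> * H")
        case True
        then show ?thesis using \<open>\<bar>C\<bar> \<le> \<bar>A\<bar> * H ^ 2\<close> that(1) plane(2) by (cases "A = 0") auto
      next
        case False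
        then have "\<bar>A\<bar> * H \<le> \<bar>B\<bar>" "B \<noteq> 0" using H zero_le_mult_iff[of "\<bar>A\<bar>" H] by auto
        moreover have "\<bar>A\<bar> * H * H \<le> \<bar>B\<bar> * H" using mono(1) calculation by blast
        ultimately show ?thesis using \<open>\<bar>C\<bar> \<le> \<bar>A\<bar> * H ^ 2\<close> that(2) unfolding sq by linarith
      qed
    next
      case False
      then have C: "\<bar>A\<bar> * H ^ 2 \<le> \<bar>C\<bar>" "C \<noteq> 0" using H zero_le_mult_iff[of "\<bar>A\<bar>" "H ^ 2"] by auto
      show ?thesis
      proof (cases "\<bar>B\<bar> * H \<le> \<bar>C\<bar>")
        case True
        then show ?thesis using C that(3) by blast
      next
        case False
        then have "\<bar>A\<bar> * H * H \<le> \<bar>B\<bar> * H" using C unfolding sq by linarith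
        then have "\<bar>A\<bar> * H \<le> \<bar>B\<bar>" by (rule mono(2))
        then show ?thesis using False that(2) by (cases "B = 0") auto
      qed
    qed
  qed
  then show ?thesis
  proof cases
    case 1
    have "\<exists>p\<in>V. \<exists>q\<in>V. \<exists>s\<in>V. \<exists>t\<in>V. c1 p q s t \<noteq> 0 \<and> \<bar>c1 p q s t\<bar> * int (card V) \<le> 32 * (3 * H ^ 2) * (3 * H)"
      unfolding c1_def
    proof (rule small_int_determinant[OF fin Hpos(2,1)])
      show "s = t" if "s \<in> V" "t \<in> V" "f2 s = f2 t" "f1 s = f1 t" for s t
      proof -
        have "A * f3 s = A * f3 t" using plane(1)[OF that(1)] plane(1)[OF that(2)] unfolding that(3,4) by linarith
        then have "f3 s = f3 t" using 1(3) by simp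
        then show "s = t" using inj that by blast
      qed
      have "c1 p0 q0 s0 t0 \<noteq> 0" using par0 1(3) nz0 by auto
      then show "\<exists>p\<in>V. \<exists>q\<in>V. \<exists>s\<in>V. \<exists>t\<in>V. (f2 q - f2 p) * (f1 t - f1 s) - (f1 q - f1 p) * (f2 t - f2 s) \<noteq> 0"
        using V0 unfolding c1_def by blast
    qed (use bd in auto)
    then obtain p q s t where V: "p \<in> V" "q \<in> V" "s \<in> V" "t \<in> V" "c1 p q s t \<noteq> 0"
      and le: "\<bar>c1 p q s t\<bar> * int (card V) \<le> 288 * H ^ 3" unfolding Hp by auto
    note P = par[OF V(1-4)]
    have "\<bar>A\<bar> * \<bar>c2 p q s t\<bar> = \<bar>B\<bar> * \<bar>c1 p q s t\<bar>" using P(1) by (metis abs_mult)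
    also have "\<dots> \<le> \<bar>A\<bar> * H * \<bar>c1 p q s t\<bar>" using 1 by (intro mult_right_mono) auto
    finally have "\<bar>c2 p q s t\<bar> \<le> H * \<bar>c1 p q s t\<bar>" using 1 by (simp add: mult.assoc)
    then have "\<bar>c2 p q s t\<bar> * int (card V) \<le> H * (\<bar>c1 p q s t\<bar> * int (card V))"
      using mult_right_mono[of _ _ "int (card V)"] by (simp flip: mult.assoc)
    also have "\<dots> \<le> H * (288 * H ^ 3)" using le H by (intro mult_left_mono) auto
    finally have l2: "\<bar>c2 p q s t\<bar> * int (card V) \<le> 288 * H ^ 4" unfolding Hp by (simp add: mult_ac)
    have "\<bar>A\<bar> * \<bar>c3 p q s t\<bar> = \<bar>C\<bar> * \<bar>c1 p q s t\<bar>" using P(3) by (metis abs_mult)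
    also have "\<dots> \<le> \<bar>A\<bar> * H ^ 2 * \<bar>c1 p q s t\<bar>" using 1 by (intro mult_right_mono) auto
    finally have "\<bar>c3 p q s t\<bar> \<le> H ^ 2 * \<bar>c1 p q s t\<bar>" using 1 by (simp add: mult.assoc)
    then have "\<bar>c3 p q s t\<bar> * int (card V) \<le> H ^ 2 * (\<bar>c1 p q s t\<bar> * int (card V))"
      using mult_right_mono[of _ _ "int (card V)"] by (simp flip: mult.assoc)
    also have "\<dots> \<le> H ^ 2 * (288 * H ^ 3)" using le H by (intro mult_left_mono) auto
    finally have l3: "\<bar>c3 p q s t\<bar> * int (card V) \<le> 288 * H ^ 5" unfolding Hp by (simp add: mult_ac)
    show ?thesis using V le l2 l3 by blast
  next
    case 2
    have "\<exists>p\<in>V. \<exists>q\<in>V. \<exists>s\<in>V. \<exists>t\<in>V. c2 p q s t \<noteq> 0 \<and> \<bar>c2 p q s t\<bar> * int (card V) \<le> 32 * (3 * H) * (3 * H ^ 3)"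
      unfolding c2_def
    proof (rule small_int_determinant[OF fin Hpos(1,3)])
      show "s = t" if "s \<in> V" "t \<in> V" "f1 s = f1 t" "f3 s = f3 t" for s t
      proof -
        have "B * f2 s = B * f2 t" using plane(1)[OF that(1)] plane(1)[OF that(2)] unfolding that(3,4) by linarith
        then have "f2 s = f2 t" using 2(3) by simp
        then show "s = t" using inj that by blast
      qed
      have "c2 p0 q0 s0 t0 \<noteq> 0" using par0 2(3) nz0 by auto
      then show "\<exists>p\<in>V. \<exists>q\<in>V. \<exists>s\<in>V. \<exists>t\<in>V. (f1 q - f1 p) * (f3 t - f3 s) - (f3 q - f3 p) * (f1 t - f1 s) \<noteq> 0"
        using V0 unfolding c2_def by blast
    qed (use bd in auto)
    then obtain p q s t where V: "p \<in> V" "q \<in> V" "s \<in> V" "t \<in> V" "c2 p q s t \<noteq> 0"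
      and le: "\<bar>c2 p q s t\<bar> * int (card V) \<le> 288 * H ^ 4" unfolding Hp by (auto simp: mult_ac)
    note P = par[OF V(1-4)]
    have "\<bar>B\<bar> * \<bar>c3 p q s t\<bar> = \<bar>C\<bar> * \<bar>c2 p q s t\<bar>" using P(2) by (metis abs_mult)
    also have "\<dots> \<le> \<bar>B\<bar> * H * \<bar>c2 p q s t\<bar>" using 2 by (intro mult_right_mono) auto
    finally have "\<bar>c3 p q s t\<bar> \<le> H * \<bar>c2 p q s t\<bar>" using 2 by (simp add: mult.assoc)
    then have "\<bar>c3 p q s t\<bar> * int (card V) \<le> H * (\<bar>c2 p q s t\<bar> * int (card V))"
      using mult_right_mono[of _ _ "int (card V)"] by (simp flip: mult.assoc)
    also have "\<dots> \<le> H * (288 * H ^ 4)" using le H by (intro mult_left_mono) auto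
    finally have l3: "\<bar>c3 p q s t\<bar> * int (card V) \<le> 288 * H ^ 5" unfolding Hp by (simp add: mult_ac)
    have "\<bar>B\<bar> * (H * \<bar>c1 p q s t\<bar>) = \<bar>A\<bar> * H * \<bar>c2 p q s t\<bar>"
      using P(1) by (metis abs_mult mult.assoc mult.commute)
    also have "\<dots> \<le> \<bar>B\<bar> * \<bar>c2 p q s t\<bar>" using 2 by (intro mult_right_mono) auto
    finally have "H * \<bar>c1 p q s t\<bar> \<le> \<bar>c2 p q s t\<bar>" using 2 by simp
    then have "H * (\<bar>c1 p q s t\<bar> * int (card V)) \<le> \<bar>c2 p q s t\<bar> * int (card V)"
      using mult_right_mono[of _ _ "int (card V)"] by (simp flip: mult.assoc)
    also have "\<dots> \<le> H * (288 * H ^ 3)" using le unfolding Hp by (simp add: mult_ac)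
    finally have l1: "\<bar>c1 p q s t\<bar> * int (card V) \<le> 288 * H ^ 3" using H by simp
    show ?thesis using V le l1 l3 by blast
  next
    case 3
    have "\<exists>p\<in>V. \<exists>q\<in>V. \<exists>s\<in>V. \<exists>t\<in>V. c3 p q s t \<noteq> 0 \<and> \<bar>c3 p q s t\<bar> * int (card V) \<le> 32 * (3 * H ^ 3) * (3 * H ^ 2)"
      unfolding c3_def
    proof (rule small_int_determinant[OF fin Hpos(3,2)])
      show "s = t" if "s \<in> V" "t \<in> V" "f3 s = f3 t" "f2 s = f2 t" for s t
      proof -
        have "C * f1 s = C * f1 t" using plane(1)[OF that(1)] plane(1)[OF that(2)] unfolding that(3,4) by linarith
        then have "f1 s = f1 t" using 3(3) by simp
        then show "s = t" using inj that by blast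
      qed
      have "c3 p0 q0 s0 t0 \<noteq> 0" using par0 3(3) nz0 by auto
      then show "\<exists>p\<in>V. \<exists>q\<in>V. \<exists>s\<in>V. \<exists>t\<in>V. (f3 q - f3 p) * (f2 t - f2 s) - (f2 q - f2 p) * (f3 t - f3 s) \<noteq> 0"
        using V0 unfolding c3_def by blast
    qed (use bd in auto)
    then obtain p q s t where V: "p \<in> V" "q \<in> V" "s \<in> V" "t \<in> V" "c3 p q s t \<noteq> 0"
      and le: "\<bar>c3 p q s t\<bar> * int (card V) \<le> 288 * H ^ 5" unfolding Hp by (auto simp: mult_ac)
    note P = par[OF V(1-4)]
    have "\<bar>C\<bar> * (H * \<bar>c2 p q s t\<bar>) = \<bar>B\<bar> * H * \<bar>c3 p q s t\<bar>"
      using P(2) by (metis abs_mult mult.assoc mult.commute)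
    also have "\<dots> \<le> \<bar>C\<bar> * \<bar>c3 p q s t\<bar>" using 3 by (intro mult_right_mono) auto
    finally have "H * \<bar>c2 p q s t\<bar> \<le> \<bar>c3 p q s t\<bar>" using 3 by simp
    then have "H * (\<bar>c2 p q s t\<bar> * int (card V)) \<le> \<bar>c3 p q s t\<bar> * int (card V)"
      using mult_right_mono[of _ _ "int (card V)"] by (simp flip: mult.assoc)
    also have "\<dots> \<le> H * (288 * H ^ 4)" using le unfolding Hp by (simp add: mult_ac)
    finally have l2: "\<bar>c2 p q s t\<bar> * int (card V) \<le> 288 * H ^ 4" using H by simp
    have "\<bar>C\<bar> * (H ^ 2 * \<bar>c1 p q s t\<bar>) = \<bar>A\<bar> * H ^ 2 * \<bar>c3 p q s t\<bar>"
      using P(3) by (metis abs_mult mult.assoc mult.commute)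
    also have "\<dots> \<le> \<bar>C\<bar> * \<bar>c3 p q s t\<bar>" using 3 by (intro mult_right_mono) auto
    finally have "H ^ 2 * \<bar>c1 p q s t\<bar> \<le> \<bar>c3 p q s t\<bar>" using 3 by simp
    then have "H ^ 2 * (\<bar>c1 p q s t\<bar> * int (card V)) \<le> \<bar>c3 p q s t\<bar> * int (card V)"
      using mult_right_mono[of _ _ "int (card V)"] by (simp flip: mult.assoc)
    also have "\<dots> \<le> H ^ 2 * (288 * H ^ 3)" using le unfolding Hp by (simp add: mult_ac)
    finally have l1: "\<bar>c1 p q s t\<bar> * int (card V) \<le> 288 * H ^ 3" using H by simp
    show ?thesis using V le l1 l2 by blast
  qed
qed

context log_points begin

section \<open>Sextuples with equal sums of exponents\<close>

definition E3 where
  "E3 = {((a1, a2, a3), (a4, a5, a6)). a1 \<in> S \<and> a2 \<in> S \<and> a3 \<in> S \<and> a4 \<in> S \<and> a5 \<in> S \<and> a6 \<in> S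
     \<and> x a1 + x a2 + x a3 = x a4 + x a5 + x a6}"

text \<open>Unlike for pairs, a single common entry does not force the triples to agree up to order,
  so full disjointness is demanded; sextuples with a common entry are reduced to quadruples.\<close>

definition Q3 where
  "Q3 = {((a1, a2, a3), (a4, a5, a6)). ((a1, a2, a3), (a4, a5, a6)) \<in> E3
     \<and> {a1, a2, a3} \<inter> {a4, a5, a6} = {}}"

text \<open>The coefficients of \<open>(T + a1) (T + a2) (T + a3) - (T + a4) (T + a5) (T + a6)\<close>, leading one first.\<close>
definition z3 :: "(int \<times> int \<times> int) \<times> (int \<times> int \<times> int) \<Rightarrow> int \<times> int \<times> int" where
  "z3 = (\<lambda>((a1, a2, a3), (a4, a5, a6)). (a1 + a2 + a3 - a4 - a5 - a6,
     a1 * a2 + a1 * a3 + a2 * a3 - (a4 * a5 + a4 * a6 + a5 * a6), a1 * a2 * a3 - a4 * a5 * a6))"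

lemma E3_sub: "E3 \<subseteq> (S \<times> S \<times> S) \<times> (S \<times> S \<times> S)" unfolding E3_def by auto

lemma finite_E3: "finite E3" by (rule finite_subset[OF E3_sub]) (use finite_S in auto)

lemma finite_Q3: "finite Q3" by (rule finite_subset[OF _ finite_E3]) (auto simp: Q3_def)

lemma card_E3_ge: "card S ^ 6 \<le> 3 * K * card E3"
proof -
  let ?f = "\<lambda>(a, a', a''). x a + x a' + x a''"
  have "?f ` (S \<times> S \<times> S) \<subseteq> {..<3 * K}"
  proof (rule image_subsetI)
    fix u assume "u \<in> S \<times> S \<times> S"
    then have "x (fst u) < K" "x (fst (snd u)) < K" "x (snd (snd u)) < K" by (auto intro: x_less)
    then show "?f u \<in> {..<3 * K}" by (simp add: split_beta)
  qed
  then have "(card (S \<times> S \<times> S))\<^sup>2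
      \<le> card {..<3 * K} * card {(u, v). u \<in> S \<times> S \<times> S \<and> v \<in> S \<times> S \<times> S \<and> ?f u = ?f v}"
    by (intro card_squared_le_collisions) (use finite_S in auto)
  also have "{(u, v). u \<in> S \<times> S \<times> S \<and> v \<in> S \<times> S \<times> S \<and> ?f u = ?f v} = E3" unfolding E3_def by auto
  also have "(card (S \<times> S \<times> S))\<^sup>2 = card S ^ 6"
    by (simp add: card_cartesian_product eval_nat_numeral mult_ac)
  finally show ?thesis by simp
qed

text \<open>Cancelling an entry common to both triples leaves an element of \<open>E2\<close>. There
  are nine pairs of positions for such an entry and N values for it.\<close>

lemma card_E3_le: "card E3 \<le> 9 * card S * card E2 + card Q3"
proof -
  define pick :: "nat \<Rightarrow> int \<times> int \<times> int \<Rightarrow> int" where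
    "pick i = (\<lambda>(a, a', a''). if i = 0 then a else if i = 1 then a' else a'')" for i
  define drop :: "nat \<Rightarrow> int \<times> int \<times> int \<Rightarrow> int \<times> int" where
    "drop i = (\<lambda>(a, a', a''). if i = 0 then (a', a'') else if i = 1 then (a, a'') else (a, a'))" for i
  define T where "T i j = {t\<in>E3. pick i (fst t) = pick j (snd t)}" for i j
  have pick_drop: "u = v" if "pick i u = pick i v" "drop i u = drop i v" for i u v
    using that by (cases u; cases v) (auto simp: pick_def drop_def split: if_splits)
  have T_le: "card (T i j) \<le> card S * card E2" for i j
  proof -
    let ?g = "\<lambda>t. (pick i (fst t), (drop i (fst t), drop j (snd t)))"
    have "card (T i j) \<le> card (S \<times> E2)"
    proof (rule card_inj_on_le[of ?g])
      show "inj_on ?g (T i j)"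
      proof (rule inj_onI)
        fix t t' assume t: "t \<in> T i j" "t' \<in> T i j" and g: "?g t = ?g t'"
        have "fst t = fst t'" by (rule pick_drop[of i]) (use g in auto)
        moreover have "pick j (snd t) = pick j (snd t')" using t g unfolding T_def by auto
        then have "snd t = snd t'" by (rule pick_drop) (use g in auto)
        ultimately show "t = t'" by (rule prod_eqI)
      qed
      show "?g ` T i j \<subseteq> S \<times> E2"
        by (auto simp: T_def E3_def E2_def pick_def drop_def split: if_splits)
      show "finite (S \<times> E2)" using finite_S finite_E2 by simp
    qed
    then show ?thesis by (simp add: card_cartesian_product)
  qed
  have "E3 \<subseteq> (\<Union>(i, j)\<in>{..<3} \<times> {..<3}. T i j) \<union> Q3"
  proof
    fix t assume t: "t \<in> E3"
    obtain a1 a2 a3 a4 a5 a6 where t_eq: "t = ((a1, a2, a3), (a4, a5, a6))" by (metis prod.collapse)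
    have "(\<exists>i\<in>{0, 1, 2}. \<exists>j\<in>{0, 1, 2}. pick i (fst t) = pick j (snd t)) \<or> {a1, a2, a3} \<inter> {a4, a5, a6} = {}"
      unfolding t_eq pick_def by auto
    moreover have "{0, 1, 2} = {..<3::nat}" by auto
    ultimately show "t \<in> (\<Union>(i, j)\<in>{..<3} \<times> {..<3}. T i j) \<union> Q3"
      using t unfolding T_def Q3_def t_eq by auto
  qed
  then have "card E3 \<le> card ((\<Union>(i, j)\<in>{..<3} \<times> {..<3}. T i j) \<union> Q3)"
    by (intro card_mono) (use finite_E3 finite_Q3 in \<open>auto simp: T_def\<close>)
  also have "\<dots> \<le> card (\<Union>(i, j)\<in>{..<3} \<times> {..<3}. T i j) + card Q3" by (rule card_Un_le)
  also have "card (\<Union>(i, j)\<in>{..<3} \<times> {..<3}. T i j) \<le> (\<Sum>u\<in>{..<3::nat} \<times> {..<3::nat}. card (case u of (i, j) \<Rightarrow> T i j))"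
    by (rule card_UN_le) simp
  also have "\<dots> \<le> (\<Sum>u\<in>{..<3::nat} \<times> {..<3::nat}. card S * card E2)"
    by (rule sum_mono) (use T_le in \<open>auto split: prod.splits\<close>)
  finally show ?thesis by simp
qed

lemma Q3_D:
  assumes "((a1, a2, a3), (a4, a5, a6)) \<in> Q3"
  shows "a1 \<in> S" "a2 \<in> S" "a3 \<in> S" "a4 \<in> S" "a5 \<in> S" "a6 \<in> S" "x a1 + x a2 + x a3 = x a4 + x a5 + x a6"
    and "a4 \<notin> {a1, a2, a3}" "a5 \<notin> {a1, a2, a3}" "a6 \<notin> {a1, a2, a3}"
  using assms unfolding Q3_def E3_def by auto

lemma z3_dvd:
  assumes "w \<in> z3 ` Q3"
  shows "p dvd snd (snd w) + b * fst (snd w) + b\<^sup>2 * fst w"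
proof -
  obtain a1 a2 a3 a4 a5 a6 where a: "w = z3 ((a1, a2, a3), (a4, a5, a6))" "((a1, a2, a3), (a4, a5, a6)) \<in> Q3"
    using assms by auto
  note Q = Q3_D[OF a(2)]
  have "[(a1 + b) * (a2 + b) * (a3 + b) = (c * G ^ x a1) * (c * G ^ x a2) * (c * G ^ x a3)] (mod p)"
    by (intro cong_mult log Q)
  also have "(c * G ^ x a1) * (c * G ^ x a2) * (c * G ^ x a3) = c ^ 3 * G ^ (x a1 + x a2 + x a3)"
    by (simp add: power_add power3_eq_cube)
  also have "\<dots> = (c * G ^ x a4) * (c * G ^ x a5) * (c * G ^ x a6)"
    unfolding Q(7) by (simp add: power_add power3_eq_cube)
  also have "[\<dots> = (a4 + b) * (a5 + b) * (a6 + b)] (mod p)"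
    by (intro cong_mult cong_sym[OF log] Q)
  finally have "p dvd (a1 + b) * (a2 + b) * (a3 + b) - (a4 + b) * (a5 + b) * (a6 + b)"
    by (simp add: cong_iff_dvd_diff)
  also have "(a1 + b) * (a2 + b) * (a3 + b) - (a4 + b) * (a5 + b) * (a6 + b)
      = snd (snd w) + b * fst (snd w) + b\<^sup>2 * fst w"
    unfolding a z3_def by (simp add: algebra_simps power2_eq_square)
  finally show ?thesis .
qed

lemma z3_bounds:
  assumes "w \<in> z3 ` Q3"
  shows "\<bar>fst w\<bar> \<le> 3 * H \<and> \<bar>fst (snd w)\<bar> \<le> 3 * H ^ 2 \<and> \<bar>snd (snd w)\<bar> \<le> 3 * H ^ 3"
proof -
  obtain a1 a2 a3 a4 a5 a6 where a: "w = z3 ((a1, a2, a3), (a4, a5, a6))" "((a1, a2, a3), (a4, a5, a6)) \<in> Q3"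
    using assms by auto
  note Q = Q3_D[OF a(2)]
  have 3: "0 \<le> a * a' * a'' \<and> a * a' * a'' \<le> H ^ 3" if "a \<in> S" "a' \<in> S" "a'' \<in> S" for a a' a''
  proof -
    have "a * a' * a'' \<le> H\<^sup>2 * H"
      using abs_mult_le_H2[OF that(1,2)] S_bounds[OF that(3)] by (intro mult_mono) auto
    then show ?thesis using abs_mult_le_H2[OF that(1,2)] S_bounds[OF that(3)]
      by (simp add: power2_eq_square power3_eq_cube)
  qed
  show ?thesis
    using S_bounds[OF Q(1)] S_bounds[OF Q(2)] S_bounds[OF Q(3)] S_bounds[OF Q(4)] S_bounds[OF Q(5)] S_bounds[OF Q(6)]
      abs_mult_le_H2[OF Q(1,2)] abs_mult_le_H2[OF Q(1,3)] abs_mult_le_H2[OF Q(2,3)]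
      abs_mult_le_H2[OF Q(4,5)] abs_mult_le_H2[OF Q(4,6)] abs_mult_le_H2[OF Q(5,6)]
      3[OF Q(1,2,3)] 3[OF Q(4,5,6)] H_power_mono[of 0 3]
    unfolding a z3_def split fst_conv snd_conv by (intro conjI) linarith+
qed

text \<open>The value at -a of the quadratic with coefficient vector \<open>w\<close>; with this
  sign the cubics of a sextuple become products of differences.\<close>

definition ev :: "int \<times> int \<times> int \<Rightarrow> int \<Rightarrow> int" where
  "ev w a = fst w * a\<^sup>2 - fst (snd w) * a + snd (snd w)"

lemma ev_z3: "ev (z3 ((a1, a2, a3), (a4, a5, a6))) a
    = (a1 - a) * (a2 - a) * (a3 - a) - (a4 - a) * (a5 - a) * (a6 - a)"
  unfolding ev_def z3_def by (simp add: algebra_simps power2_eq_square)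

lemma ev_nonzero:
  assumes "((a1, a2, a3), (a4, a5, a6)) \<in> Q3" "a \<in> {a1, a2, a3, a4, a5, a6}"
  shows "ev (z3 ((a1, a2, a3), (a4, a5, a6))) a \<noteq> 0"
  using Q3_D(8-10)[OF assms(1)] assms(2) unfolding ev_z3 by auto

lemma in_Dv3:
  assumes "{a1, a2, a3, a} \<subseteq> S" "m = (a1 - a) * (a2 - a) * (a3 - a) \<or> m = - ((a1 - a) * (a2 - a) * (a3 - a))" "m \<noteq> 0"
    and "d dvd (a1 - a) * (a2 - a) * (a3 - a)"
  shows "d \<in> Dv m"
proof -
  have d: "\<bar>a' - a\<bar> \<le> H" if "a' \<in> S" for a' using S_bounds[OF that] S_bounds[of a] assms(1) by auto
  have "\<bar>m\<bar> = \<bar>a1 - a\<bar> * \<bar>a2 - a\<bar> * \<bar>a3 - a\<bar>" using assms(2) by (auto simp: abs_mult)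
  also have "\<dots> \<le> H * H * H" using d assms(1) H_pos by (intro mult_mono) auto
  also have "\<dots> = H ^ 3" by (simp add: power3_eq_cube)
  also have "\<dots> \<le> 3000000 * H ^ 12" using H_power_mono[of 3 12] zero_le_power[of H 12] H_pos by linarith
  finally show ?thesis using assms(2-4) unfolding Dv_def by auto
qed

text \<open>Fix \<open>a1\<close> and the polynomial. Its nonzero value at -a1 has the divisors a4 -
  a1 and a5 - a1, which determine a6. Its nonzero value at -a4 then has the divisor a2 - a4, and the
  coefficient of T^2 yields a3. Three choices of a divisor give \<open>D ^ 3\<close>.\<close>

lemma card_Q3_le: "card Q3 \<le> card S * card (z3 ` Q3) * D ^ 3"
proof -
  let ?f = "\<lambda>t. (fst (fst t), z3 t)"
  have "card Q3 \<le> D ^ 3 * card (?f ` Q3)"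
  proof (rule card_le_fibres[OF finite_Q3])
    fix y assume "y \<in> ?f ` Q3"
    obtain a1 w where y: "y = (a1, w)" by (cases y)
    let ?g = "\<lambda>((a1, a2, a3), (a4, a5, a6 :: int)). ((a4 - a1 :: int, a5 - a1), a2 - a4)"
    \<comment> \<open>A dependent sum, since the last divisor belongs to the value at -a4 and a4 is
      known only from the first divisor.\<close>
    let ?B = "SIGMA u : Dv (ev w a1) \<times> Dv (ev w a1). Dv (ev w (a1 + fst u))"
    have mem: "\<exists>a2 a3 a4 a5 a6. t = ((a1, a2, a3), (a4, a5, a6)) \<and> ((a1, a2, a3), (a4, a5, a6)) \<in> Q3
        \<and> w = z3 ((a1, a2, a3), (a4, a5, a6))" if "t \<in> {t\<in>Q3. ?f t = y}" for t
      using that unfolding y by (cases t) auto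
    have "card {t\<in>Q3. ?f t = y} \<le> card ?B"
    proof (rule card_inj_on_le[of ?g])
      show "inj_on ?g {t\<in>Q3. ?f t = y}"
      proof (rule inj_onI)
        fix t t' assume t: "t \<in> {t\<in>Q3. ?f t = y}" "t' \<in> {t\<in>Q3. ?f t = y}" and g: "?g t = ?g t'"
        obtain a2 a3 a4 a5 a6 where a: "t = ((a1, a2, a3), (a4, a5, a6))" "((a1, a2, a3), (a4, a5, a6)) \<in> Q3"
          "w = z3 ((a1, a2, a3), (a4, a5, a6))" using mem[OF t(1)] by blast
        obtain b2 b3 b4 b5 b6 where b: "t' = ((a1, b2, b3), (b4, b5, b6))" "((a1, b2, b3), (b4, b5, b6)) \<in> Q3"
          "w = z3 ((a1, b2, b3), (b4, b5, b6))" using mem[OF t(2)] by blast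
        have e: "a4 = b4" "a5 = b5" "a2 = b2" using g a(1) b(1) by auto
        have "(a4 - a1) * (a5 - a1) * (a6 - a1) = (b4 - a1) * (b5 - a1) * (b6 - a1)"
          using ev_z3[of a1 a2 a3 a4 a5 a6 a1] ev_z3[of a1 b2 b3 b4 b5 b6 a1] a(3) b(3) by simp
        moreover have "b4 - a1 \<noteq> 0" "b5 - a1 \<noteq> 0" using Q3_D(8,9)[OF b(2)] by auto
        ultimately have 6: "a6 = b6" unfolding e by simp
        have "fst w = a1 + a2 + a3 - a4 - a5 - a6" "fst w = a1 + b2 + b3 - b4 - b5 - b6"
          using arg_cong[OF a(3), of fst] arg_cong[OF b(3), of fst] unfolding z3_def by auto
        then show "t = t'" using e 6 a(1) b(1) by simp
      qed
      show "?g ` {t\<in>Q3. ?f t = y} \<subseteq> ?B"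
      proof (rule image_subsetI)
        fix t assume t: "t \<in> {t\<in>Q3. ?f t = y}"
        obtain a2 a3 a4 a5 a6 where a: "t = ((a1, a2, a3), (a4, a5, a6))" "((a1, a2, a3), (a4, a5, a6)) \<in> Q3"
          "w = z3 ((a1, a2, a3), (a4, a5, a6))" using mem[OF t] by blast
        note Q = Q3_D[OF a(2)]
        have m1: "ev w a1 = - ((a4 - a1) * (a5 - a1) * (a6 - a1))" unfolding a(3) ev_z3 by simp
        have m4: "ev w a4 = (a1 - a4) * (a2 - a4) * (a3 - a4)" unfolding a(3) ev_z3 by simp
        have nz: "ev w a1 \<noteq> 0" "ev w a4 \<noteq> 0" unfolding a(3) using ev_nonzero[OF a(2)] by auto
        have "a4 - a1 \<in> Dv (ev w a1)" "a5 - a1 \<in> Dv (ev w a1)"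
          by (rule in_Dv3[of a4 a5 a6 a1]; use Q m1 nz in simp)+
        moreover have "a2 - a4 \<in> Dv (ev w a4)"
          by (rule in_Dv3[of a1 a2 a3 a4]) (use Q m4 nz in simp_all)
        ultimately show "?g t \<in> ?B" unfolding a(1) by simp
      qed
    qed (use finite_Dv in simp)
    also have "card ?B = (\<Sum>u\<in>Dv (ev w a1) \<times> Dv (ev w a1). card (Dv (ev w (a1 + fst u))))"
      by (rule card_SigmaI) (use finite_Dv in auto)
    also have "\<dots> \<le> (\<Sum>u\<in>Dv (ev w a1) \<times> Dv (ev w a1). D)" by (rule sum_mono) (rule card_Dv)
    also have "\<dots> = card (Dv (ev w a1)) * card (Dv (ev w a1)) * D" by (simp add: card_cartesian_product)
    also have "\<dots> \<le> D * D * D" by (intro mult_mono card_Dv) auto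
    finally show "card {t\<in>Q3. ?f t = y} \<le> D ^ 3" by (simp add: power3_eq_cube)
  qed
  also have "card (?f ` Q3) \<le> card (S \<times> z3 ` Q3)"
  proof (rule card_mono)
    show "?f ` Q3 \<subseteq> S \<times> z3 ` Q3" unfolding Q3_def E3_def by auto
  qed (use finite_S finite_Q3 in auto)
  finally show ?thesis by (simp add: card_cartesian_product mult.commute)
qed

text \<open>As for pairs: the values at a4, a5, a6 divide the product over the first triple, which
  leaves 2 D choices for each. The cube of 144 H^4 is 2985984 H^12, just within the range of
  \<open>divisors\<close>.\<close>

lemma card_Q3_le_rigid:
  assumes "\<And>v. card {y\<in>S. q y = v} \<le> 2" "\<And>y. y \<in> S \<Longrightarrow> \<bar>q y\<bar> \<le> 144 * H ^ 4"
    and "\<And>a1 a2 a3 a4 a5 a6. ((a1, a2, a3), (a4, a5, a6)) \<in> Q3 \<Longrightarrow>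
      q a1 * q a2 * q a3 = q a4 * q a5 * q a6 \<and> q a1 \<noteq> 0 \<and> q a2 \<noteq> 0 \<and> q a3 \<noteq> 0"
  shows "card Q3 \<le> 8 * D ^ 3 * card S ^ 3"
proof -
  let ?A = "\<lambda>m. {y\<in>S. q y \<in> Dv m}"
  have "card Q3 \<le> (2 * D * (2 * D * (2 * D))) * card (fst ` Q3)"
  proof (rule card_le_fibres[OF finite_Q3])
    fix u :: "int \<times> int \<times> int"
    obtain a1 a2 a3 where u: "u = (a1, a2, a3)" by (cases u)
    let ?m = "q a1 * q a2 * q a3"
    have "{t\<in>Q3. fst t = u} \<subseteq> {u} \<times> (?A ?m \<times> ?A ?m \<times> ?A ?m)"
    proof
      fix t assume t: "t \<in> {t\<in>Q3. fst t = u}"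
      then obtain a4 a5 a6 where a: "t = ((a1, a2, a3), (a4, a5, a6))" "((a1, a2, a3), (a4, a5, a6)) \<in> Q3"
        unfolding u by (cases t) auto
      note Q = Q3_D[OF a(2)]
      have m: "?m = q a4 * q a5 * q a6" "?m \<noteq> 0" using assms(3)[OF a(2)] by auto
      have "\<bar>?m\<bar> \<le> (144 * H ^ 4) * (144 * H ^ 4) * (144 * H ^ 4)"
        unfolding abs_mult using assms(2) Q H_pos by (intro mult_mono) auto
      also have "\<dots> = 2985984 * H ^ 12" by (simp flip: power_add)
      also have "\<dots> \<le> 3000000 * H ^ 12" using H_pos by simp
      finally have "d \<in> Dv ?m" if "d dvd ?m" for d using m that unfolding Dv_def by auto
      moreover have "q a4 dvd ?m" "q a5 dvd ?m" "q a6 dvd ?m" unfolding m(1) by auto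
      ultimately show "t \<in> {u} \<times> (?A ?m \<times> ?A ?m \<times> ?A ?m)" using Q unfolding a u by auto
    qed
    then have "card {t\<in>Q3. fst t = u} \<le> card ({u} \<times> (?A ?m \<times> ?A ?m \<times> ?A ?m))"
      by (intro card_mono) (use finite_S in auto)
    also have "\<dots> = card (?A ?m) * (card (?A ?m) * card (?A ?m))" by (simp add: card_cartesian_product)
    also have "\<dots> \<le> 2 * D * (2 * D * (2 * D))" by (intro mult_mono card_value_in_Dv assms) auto
    finally show "card {t\<in>Q3. fst t = u} \<le> 2 * D * (2 * D * (2 * D))" .
  qed
  also have "card (fst ` Q3) \<le> card (S \<times> S \<times> S)"
    by (rule card_mono) (use finite_S in \<open>auto simp: Q3_def E3_def\<close>)
  finally show ?thesis by (simp add: card_cartesian_product power3_eq_cube mult.assoc)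
qed

text \<open>The hypothesis says, cleared of denominators, that every quadratic vanishes at \<beta> /
  \<alpha>. Hence the products of \<alpha> y + \<beta> over both triples agree.\<close>

lemma card_Q3_le_common_root:
  assumes "\<alpha> \<noteq> 0" "\<And>w. w \<in> z3 ` Q3 \<Longrightarrow> \<alpha>\<^sup>2 * snd (snd w) + \<alpha> * \<beta> * fst (snd w) + \<beta>\<^sup>2 * fst w = 0"
    and "\<bar>\<alpha>\<bar> \<le> 72 * H ^ 3" "\<bar>\<beta>\<bar> \<le> 72 * H ^ 4"
  shows "card Q3 \<le> 8 * D ^ 3 * card S ^ 3"
proof -
  let ?q = "\<lambda>y. \<alpha> * y + \<beta>"
  show ?thesis
  proof (rule card_Q3_le_rigid[of ?q])
    fix v
    have "{y\<in>S. ?q y = v} = {y\<in>S. 0 * y\<^sup>2 + \<alpha> * y + \<beta> = v}" by auto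
    then show "card {y\<in>S. ?q y = v} \<le> 2" using card_quadratic_fibre_le[of 0 \<alpha> S \<beta> v] assms(1) by simp
  next
    fix y assume "y \<in> S"
    then have y: "\<bar>y\<bar> \<le> H" using S_bounds[of y] by auto
    have "\<bar>\<alpha> * y\<bar> \<le> 72 * H ^ 3 * H" unfolding abs_mult using assms(3) y H_pos by (intro mult_mono) auto
    moreover have "H ^ 3 * H = H ^ 4" by (simp add: eval_nat_numeral)
    ultimately show "\<bar>?q y\<bar> \<le> 144 * H ^ 4" using assms(4) by linarith
  next
    fix a1 a2 a3 a4 a5 a6 assume a: "((a1, a2, a3), (a4, a5, a6)) \<in> Q3"
    obtain w1 w2 w3 where w: "z3 ((a1, a2, a3), (a4, a5, a6)) = (w1, w2, w3)" by (metis prod.collapse)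
    then have root: "\<alpha>\<^sup>2 * w3 + \<alpha> * \<beta> * w2 + \<beta>\<^sup>2 * w1 = 0" using assms(2) a by (force simp: image_iff)
    have w_eq: "w1 = a1 + a2 + a3 - a4 - a5 - a6" "w2 = a1 * a2 + a1 * a3 + a2 * a3 - (a4 * a5 + a4 * a6 + a5 * a6)"
      "w3 = a1 * a2 * a3 - a4 * a5 * a6" using w unfolding z3_def by auto
    have "?q a1 * ?q a2 * ?q a3 - ?q a4 * ?q a5 * ?q a6 = \<alpha> * (\<alpha>\<^sup>2 * w3 + \<alpha> * \<beta> * w2 + \<beta>\<^sup>2 * w1)"
      unfolding w_eq by (simp add: algebra_simps power2_eq_square)
    then have "?q a1 * ?q a2 * ?q a3 = ?q a4 * ?q a5 * ?q a6" unfolding root by simp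
    moreover have "?q a \<noteq> 0" if "a \<in> {a1, a2, a3}" for a
    proof
      assume "?q a = 0"
      then have "\<beta> = - \<alpha> * a" by simp
      then have "\<alpha>\<^sup>2 * ev (w1, w2, w3) a = \<alpha>\<^sup>2 * w3 + \<alpha> * \<beta> * w2 + \<beta>\<^sup>2 * w1"
        unfolding ev_def by (simp add: algebra_simps power2_eq_square)
      then have "ev (w1, w2, w3) a = 0" using root assms(1) by simp
      then show False using ev_nonzero[OF a] that unfolding w by blast
    qed
    ultimately show "?q a1 * ?q a2 * ?q a3 = ?q a4 * ?q a5 * ?q a6 \<and> ?q a1 \<noteq> 0 \<and> ?q a2 \<noteq> 0 \<and> ?q a3 \<noteq> 0"
      by blast
  qed
qed

text \<open>All the quadratics are proportional to one quadratic \<open>v\<close>; comparing the cubics at its two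
  complex roots shows that the product of \<open>ev v\<close> is the same over both triples.\<close>
lemma card_Q3_le_proportional:
  assumes v: "v \<in> z3 ` Q3" "fst v \<noteq> 0"
    and par: "\<And>w. w \<in> z3 ` Q3 \<Longrightarrow> fst v * fst (snd w) = fst (snd v) * fst w \<and> fst v * snd (snd w) = snd (snd v) * fst w"
  shows "card Q3 \<le> 8 * D ^ 3 * card S ^ 3"
proof (rule card_Q3_le_rigid[of "ev v"])
  obtain v1 v2 v3 where v_eq: "v = (v1, v2, v3)" by (metis prod.collapse)
  have v1: "v1 \<noteq> 0" using v v_eq by simp
  fix y
  have "{y'\<in>S. ev v y' = y} = {y'\<in>S. v1 * y'\<^sup>2 + (- v2) * y' + v3 = y}" unfolding ev_def v_eq by auto
  then show "card {y'\<in>S. ev v y' = y} \<le> 2" using card_quadratic_fibre_le[of v1 "- v2" S v3 y] v1 by simp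
next
  obtain v1 v2 v3 where v_eq: "v = (v1, v2, v3)" by (metis prod.collapse)
  fix y assume "y \<in> S"
  then have y: "\<bar>y\<bar> \<le> H" using S_bounds[of y] by auto
  have vb: "\<bar>v1\<bar> \<le> 3 * H" "\<bar>v2\<bar> \<le> 3 * H ^ 2" "\<bar>v3\<bar> \<le> 3 * H ^ 3" using z3_bounds[OF v(1)] v_eq by auto
  have "\<bar>v1 * y\<^sup>2\<bar> \<le> 3 * H * H\<^sup>2" unfolding abs_mult power_abs using vb y H_pos
    by (intro mult_mono power_mono) auto
  moreover have "\<bar>v2 * y\<bar> \<le> 3 * H\<^sup>2 * H" unfolding abs_mult using vb y H_pos by (intro mult_mono) auto
  moreover have "H * H\<^sup>2 = H ^ 3" "H\<^sup>2 * H = H ^ 3" by (simp_all add: eval_nat_numeral)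
  ultimately have "\<bar>ev v y\<bar> \<le> 9 * H ^ 3" using vb unfolding ev_def v_eq by simp
  also have "\<dots> \<le> 144 * H ^ 4" using H_power_mono[of 3 4] zero_le_power[of H 4] H_pos by linarith
  finally show "\<bar>ev v y\<bar> \<le> 144 * H ^ 4" .
next
  obtain v1 v2 v3 where v_eq: "v = (v1, v2, v3)" by (metis prod.collapse)
  have v1: "v1 \<noteq> 0" using v v_eq by simp
  \<comment> \<open>\<open>csqrt\<close> supplies both roots whatever the sign of the discriminant;
    only expressions symmetric in them lead back to integers.\<close>
  define r1 where "r1 = (- of_int v2 + csqrt ((of_int v2)\<^sup>2 - 4 * of_int v1 * of_int v3)) / (2 * of_int v1)"
  define r2 where "r2 = (- of_int v2 - csqrt ((of_int v2)\<^sup>2 - 4 * of_int v1 * of_int v3)) / (2 * of_int v1)"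
  have v1c: "(of_int v1 :: complex) \<noteq> 0" using v1 by simp
  have sum: "of_int v1 * (r1 + r2) = - of_int v2" unfolding r1_def r2_def using v1c by (simp add: field_simps)
  have "(- of_int v2 + csqrt ((of_int v2)\<^sup>2 - 4 * of_int v1 * of_int v3)) * (- of_int v2 - csqrt ((of_int v2)\<^sup>2 - 4 * of_int v1 * of_int v3))
      = (of_int v2)\<^sup>2 - (csqrt ((of_int v2)\<^sup>2 - 4 * of_int v1 * of_int v3))\<^sup>2"
    by (simp add: algebra_simps power2_eq_square)
  also have "\<dots> = 4 * of_int v1 * of_int v3" by simp
  finally have prod: "of_int v1 * (r1 * r2) = of_int v3"
    unfolding r1_def r2_def using v1c by (simp add: field_simps)
  have factor: "of_int (ev v y) = of_int v1 * (of_int y + r1) * (of_int y + r2)" for y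
  proof -
    have "of_int v1 * (of_int y + r1) * (of_int y + r2)
        = of_int v1 * (of_int y)\<^sup>2 + of_int v1 * (r1 + r2) * of_int y + of_int v1 * (r1 * r2)"
      by (simp add: algebra_simps power2_eq_square)
    then show ?thesis unfolding sum prod by (simp add: ev_def v_eq)
  qed
  have root: "of_int v1 * r\<^sup>2 + of_int v2 * r + of_int v3 = 0" if "r = r1 \<or> r = r2" for r
  proof -
    have "of_int v1 * r\<^sup>2 + of_int v2 * r + of_int v3 = of_int v1 * r\<^sup>2 - of_int v1 * (r1 + r2) * r + of_int v1 * (r1 * r2)"
      unfolding sum prod by simp
    also have "\<dots> = 0" using that by (auto simp: algebra_simps power2_eq_square)
    finally show ?thesis .
  qed
  fix a1 a2 a3 a4 a5 a6 assume a: "((a1, a2, a3), (a4, a5, a6)) \<in> Q3"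
  obtain w1 w2 w3 where w: "z3 ((a1, a2, a3), (a4, a5, a6)) = (w1, w2, w3)" by (metis prod.collapse)
  have w_in: "(w1, w2, w3) \<in> z3 ` Q3" using a w by (force simp: image_iff)
  have w_eq: "w1 = a1 + a2 + a3 - a4 - a5 - a6" "w2 = a1 * a2 + a1 * a3 + a2 * a3 - (a4 * a5 + a4 * a6 + a5 * a6)"
      "w3 = a1 * a2 * a3 - a4 * a5 * a6" using w unfolding z3_def by auto
  have p1: "v1 * w2 = v2 * w1" and p2: "v1 * w3 = v3 * w1" using par[OF w_in] v_eq by auto
  have p1c: "of_int v1 * of_int w2 = (of_int v2 * of_int w1 :: complex)" using p1 by (metis of_int_mult)
  have p2c: "of_int v1 * of_int w3 = (of_int v3 * of_int w1 :: complex)" using p2 by (metis of_int_mult)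
  have same: "(of_int a1 + r) * (of_int a2 + r) * (of_int a3 + r) = (of_int a4 + r) * (of_int a5 + r) * (of_int a6 + r)"
    if "r = r1 \<or> r = r2" for r :: complex
  proof -
    have "of_int v1 * (of_int w1 * r\<^sup>2 + of_int w2 * r + of_int w3)
        = of_int w1 * (of_int v1 * r\<^sup>2) + (of_int v1 * of_int w2) * r + of_int v1 * of_int w3"
      by (simp add: algebra_simps)
    also have "\<dots> = of_int w1 * (of_int v1 * r\<^sup>2 + of_int v2 * r + of_int v3)"
      unfolding p1c p2c by (simp add: algebra_simps)
    also have "\<dots> = 0" using root[OF that] by simp
    finally have "of_int w1 * r\<^sup>2 + of_int w2 * r + of_int w3 = 0" using v1c by simp
    moreover have "(of_int a1 + r) * (of_int a2 + r) * (of_int a3 + r) - (of_int a4 + r) * (of_int a5 + r) * (of_int a6 + r)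
        = of_int w1 * r\<^sup>2 + of_int w2 * r + of_int w3"
      unfolding w_eq by (simp add: algebra_simps power2_eq_square)
    ultimately show ?thesis by simp
  qed
  have "(of_int (ev v a1 * ev v a2 * ev v a3) :: complex) = of_int v1 ^ 3
      * ((of_int a1 + r1) * (of_int a2 + r1) * (of_int a3 + r1)) * ((of_int a1 + r2) * (of_int a2 + r2) * (of_int a3 + r2))"
    by (simp add: factor power3_eq_cube)
  also have "\<dots> = of_int v1 ^ 3
      * ((of_int a4 + r1) * (of_int a5 + r1) * (of_int a6 + r1)) * ((of_int a4 + r2) * (of_int a5 + r2) * (of_int a6 + r2))"
    using same[of r1] same[of r2] by simp
  also have "\<dots> = of_int (ev v a4 * ev v a5 * ev v a6)"
    by (simp add: factor power3_eq_cube)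
  finally have "ev v a1 * ev v a2 * ev v a3 = ev v a4 * ev v a5 * ev v a6" by (simp only: of_int_eq_iff)
  moreover have "ev v a \<noteq> 0" if "a \<in> {a1, a2, a3}" for a
  proof
    assume 0: "ev v a = 0"
    have "v1 * ev (w1, w2, w3) a = v1 * w1 * a\<^sup>2 - (v1 * w2) * a + v1 * w3"
      unfolding ev_def by (simp add: algebra_simps)
    also have "\<dots> = w1 * ev v a" unfolding p1 p2 ev_def v_eq by (simp add: algebra_simps)
    finally have "ev (w1, w2, w3) a = 0" using 0 v1 by simp
    then show False using ev_nonzero[OF a] that unfolding w by blast
  qed
  ultimately show "ev v a1 * ev v a2 * ev v a3 = ev v a4 * ev v a5 * ev v a6 \<and> ev v a1 \<noteq> 0 \<and> ev v a2 \<noteq> 0 \<and> ev v a3 \<noteq> 0"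
    by blast
qed


definition rel :: "int \<times> int \<times> int \<Rightarrow> bool" where
  "rel u \<longleftrightarrow> p dvd snd (snd u) + b * fst (snd u) + b\<^sup>2 * fst u
     \<and> \<bar>fst u\<bar> \<le> 6 * H \<and> \<bar>fst (snd u)\<bar> \<le> 6 * H ^ 2 \<and> \<bar>snd (snd u)\<bar> \<le> 6 * H ^ 3"

lemma abs_diff_le: "\<bar>a\<bar> \<le> e \<Longrightarrow> \<bar>a'\<bar> \<le> e \<Longrightarrow> \<bar>a - a'\<bar> \<le> 2 * e" for a a' e :: int by linarith

lemma rel_cross_bounds:
  assumes "rel (u1, u2, u3)" "rel (v1, v2, v3)"
  shows "\<bar>u2 * v1 - u1 * v2\<bar> \<le> 72 * H ^ 3" "\<bar>u1 * v3 - u3 * v1\<bar> \<le> 72 * H ^ 4" "\<bar>u3 * v2 - u2 * v3\<bar> \<le> 72 * H ^ 5"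
proof -
  have u: "\<bar>u1\<bar> \<le> 6 * H" "\<bar>u2\<bar> \<le> 6 * H ^ 2" "\<bar>u3\<bar> \<le> 6 * H ^ 3" using assms(1) unfolding rel_def by auto
  have v: "\<bar>v1\<bar> \<le> 6 * H" "\<bar>v2\<bar> \<le> 6 * H ^ 2" "\<bar>v3\<bar> \<le> 6 * H ^ 3" using assms(2) unfolding rel_def by auto
  have mul: "\<bar>a * a'\<bar> \<le> e * e'" if "\<bar>a\<bar> \<le> e" "\<bar>a'\<bar> \<le> e'" for a a' e e' :: int
    unfolding abs_mult using that by (intro mult_mono) auto
  have "H ^ 2 * H = H ^ 3" "H * H ^ 2 = H ^ 3" "H * H ^ 3 = H ^ 4" "H ^ 3 * H = H ^ 4" "H ^ 3 * H ^ 2 = H ^ 5" "H ^ 2 * H ^ 3 = H ^ 5"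
    by (simp_all add: eval_nat_numeral)
  then show "\<bar>u2 * v1 - u1 * v2\<bar> \<le> 72 * H ^ 3" "\<bar>u1 * v3 - u3 * v1\<bar> \<le> 72 * H ^ 4" "\<bar>u3 * v2 - u2 * v3\<bar> \<le> 72 * H ^ 5"
    using abs_diff_le[OF mul[OF u(2) v(1)], of "u1 * v2"] mul[OF u(1) v(2)]
      abs_diff_le[OF mul[OF u(1) v(3)], of "u3 * v1"] mul[OF u(3) v(1)]
      abs_diff_le[OF mul[OF u(3) v(2)], of "u2 * v3"] mul[OF u(2) v(3)] by (simp_all add: mult_ac)
qed

text \<open>Modulo p the three vectors are orthogonal to (b^2, b, 1), so their determinant is a
  multiple of p. It consists of three terms of size at most 72 * 6 * H^6, in total 1296 H^6 < p, and
  is therefore 0: all these quadratics lie in a plane.\<close>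

lemma rel_det_zero:
  assumes small: "2000 * H ^ 6 < p" and r: "rel (u1, u2, u3)" "rel (v1, v2, v3)" "rel (w1, w2, w3)"
  shows "(u2 * v1 - u1 * v2) * w3 + (u1 * v3 - u3 * v1) * w2 + (u3 * v2 - u2 * v3) * w1 = 0" (is "?d = 0")
proof -
  have w: "\<bar>w1\<bar> \<le> 6 * H" "\<bar>w2\<bar> \<le> 6 * H ^ 2" "\<bar>w3\<bar> \<le> 6 * H ^ 3" using r(3) unfolding rel_def by auto
  note c = rel_cross_bounds[OF r(1,2)]
  have mul: "\<bar>a * a'\<bar> \<le> e * e'" if "\<bar>a\<bar> \<le> e" "\<bar>a'\<bar> \<le> e'" for a a' e e' :: int
    unfolding abs_mult using that by (intro mult_mono) auto
  have "\<bar>?d\<bar> \<le> 72 * H ^ 3 * (6 * H ^ 3) + 72 * H ^ 4 * (6 * H ^ 2) + 72 * H ^ 5 * (6 * H)"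
    using mul[OF c(1) w(3)] mul[OF c(2) w(2)] mul[OF c(3) w(1)] by linarith
  also have "\<dots> = 1296 * H ^ 6" by (simp add: eval_nat_numeral)
  also have "\<dots> \<le> 2000 * H ^ 6" using H_pos by simp
  finally have "\<bar>?d\<bar> < p" using small by simp
  moreover have "?d = (u3 + b * u2 + b\<^sup>2 * u1) * (v2 * w1 - v1 * w2) + (v3 + b * v2 + b\<^sup>2 * v1) * (w2 * u1 - w1 * u2)
      + (w3 + b * w2 + b\<^sup>2 * w1) * (u2 * v1 - u1 * v2)"
    by (simp add: algebra_simps)
  moreover have "p dvd u3 + b * u2 + b\<^sup>2 * u1" "p dvd v3 + b * v2 + b\<^sup>2 * v1" "p dvd w3 + b * w2 + b\<^sup>2 * w1"
    using r unfolding rel_def by auto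
  ultimately show "?d = 0" using dvd_imp_le_int[of ?d p] by (cases "?d = 0") (auto intro!: dvd_add dvd_mult2)
qed

text \<open>Both vectors are orthogonal to (b^2, b, 1) modulo p, so combining their two relations
  makes the cross product a multiple of that vector. Its coordinates, in the order used here, are in
  the ratio 1 : b : b^2 modulo p.\<close>

lemma rel_cross_cong:
  assumes r: "rel (u1, u2, u3)" "rel (v1, v2, v3)"
  shows "p dvd (u1 * v3 - u3 * v1) - b * (u2 * v1 - u1 * v2)" "p dvd (u3 * v2 - u2 * v3) - b\<^sup>2 * (u2 * v1 - u1 * v2)"
proof -
  let ?U = "u3 + b * u2 + b\<^sup>2 * u1" and ?V = "v3 + b * v2 + b\<^sup>2 * v1"
  have d: "p dvd ?U" "p dvd ?V" using r unfolding rel_def by auto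
  have "(u1 * v3 - u3 * v1) - b * (u2 * v1 - u1 * v2) = ?V * u1 - ?U * v1" by (simp add: algebra_simps)
  also have "p dvd \<dots>" using d by (intro dvd_diff dvd_mult2)
  finally show "p dvd (u1 * v3 - u3 * v1) - b * (u2 * v1 - u1 * v2)" .
  have "(u3 * v2 - u2 * v3) - b\<^sup>2 * (u2 * v1 - u1 * v2) = ?U * v2 - ?V * u2" by (simp add: algebra_simps)
  also have "p dvd \<dots>" using d by (intro dvd_diff dvd_mult2)
  finally show "p dvd (u3 * v2 - u2 * v3) - b\<^sup>2 * (u2 * v1 - u1 * v2)" .
qed

text \<open>All vectors are multiples of one of them, \<open>v\<close>. In degree two
  \<open>card_Q3_le_proportional\<close> applies and in degree one the root -v3 / v2 is common.
  Degree zero cannot occur, since then p divides v3, which is nonzero and smaller than p.\<close>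

lemma card_Q3_le_rank1:
  assumes small: "2000 * H ^ 6 < p"
    and par: "\<And>v w. v \<in> z3 ` Q3 \<Longrightarrow> w \<in> z3 ` Q3 \<Longrightarrow> fst v * fst (snd w) = fst (snd v) * fst w
      \<and> fst v * snd (snd w) = snd (snd v) * fst w \<and> fst (snd v) * snd (snd w) = snd (snd v) * fst (snd w)"
  shows "card Q3 \<le> 8 * D ^ 3 * card S ^ 3"
proof (cases "Q3 = {}")
  case False
  then obtain a1 a2 a3 a4 a5 a6 where a: "((a1, a2, a3), (a4, a5, a6)) \<in> Q3" by (metis ex_in_conv prod.collapse)
  obtain v1 v2 v3 where v: "z3 ((a1, a2, a3), (a4, a5, a6)) = (v1, v2, v3)" by (metis prod.collapse)
  have v_in: "(v1, v2, v3) \<in> z3 ` Q3" using a v by (force simp: image_iff)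
  note vb = z3_bounds[OF v_in]
  show ?thesis
  proof (cases "v1 = 0")
    case False
    show ?thesis by (rule card_Q3_le_proportional[OF v_in]) (use False par[OF v_in] in auto)
  next
    case 0: True
    have "v2 \<noteq> 0"
    proof
      assume "v2 = 0"
      then have "p dvd v3" using z3_dvd[OF v_in] 0 by simp
      moreover have "\<bar>v3\<bar> \<le> 3 * H ^ 3" using vb by simp
      then have "\<bar>v3\<bar> < p" using small H_power_mono[of 3 6] zero_le_power[of H 6] H_pos by linarith
      ultimately have "v3 = 0" using dvd_imp_le_int[of v3 p] by (cases "v3 = 0") auto
      then have "ev (z3 ((a1, a2, a3), (a4, a5, a6))) a1 = 0" using 0 \<open>v2 = 0\<close> v by (simp add: ev_def)
      then show False using ev_nonzero[OF a, of a1] by simp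
    qed
    show ?thesis
    proof (rule card_Q3_le_common_root[OF \<open>v2 \<noteq> 0\<close>, of "- v3"])
      fix w assume "w \<in> z3 ` Q3"
      from par[OF v_in this] have e: "fst w = 0" "v2 * snd (snd w) = v3 * fst (snd w)"
        using 0 \<open>v2 \<noteq> 0\<close> by auto
      have "v2\<^sup>2 * snd (snd w) + v2 * - v3 * fst (snd w) = v2 * (v2 * snd (snd w) - v3 * fst (snd w))"
        by (simp add: algebra_simps power2_eq_square)
      then show "v2\<^sup>2 * snd (snd w) + v2 * - v3 * fst (snd w) + (- v3)\<^sup>2 * fst w = 0" using e by simp
    next
      have "\<bar>v2\<bar> \<le> 3 * H ^ 2" "\<bar>v3\<bar> \<le> 3 * H ^ 3" using vb by auto
      then show "\<bar>v2\<bar> \<le> 72 * H ^ 3" "\<bar>- v3\<bar> \<le> 72 * H ^ 4"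
        using H_power_mono[of 2 3] H_power_mono[of 3 4] zero_le_power[of H 2] zero_le_power[of H 3] H_pos
        unfolding abs_minus_cancel by linarith+
    qed
  qed
qed simp

text \<open>Vectors that are not all proportional span a plane, in which
  \<open>small_cross_product\<close> finds two differences with a small nonzero cross product
  (\<open>al\<close>, \<open>be\<close>, \<open>ga\<close>). This is a normal of the plane, and be^2
  - al ga is the resultant of the two quadratics. If it is 0, the equation of the plane says that be
  / al is a root of every quadratic; otherwise it is a nonzero multiple of p.\<close>

lemma card_Q3_le_or:
  assumes small: "2000 * H ^ 6 < p"
  shows "card Q3 \<le> 8 * D ^ 3 * card S ^ 3 \<or> (int (card (z3 ` Q3)))\<^sup>2 * p \<le> 165888 * H ^ 8"
proof (cases "\<forall>v\<in>z3 ` Q3. \<forall>w\<in>z3 ` Q3. fst v * fst (snd w) = fst (snd v) * fst w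
      \<and> fst v * snd (snd w) = snd (snd v) * fst w \<and> fst (snd v) * snd (snd w) = snd (snd v) * fst (snd w)")
  case True
  then show ?thesis using card_Q3_le_rank1[OF small] by blast
next
  case False
  then obtain v0 w0 where vw0: "v0 \<in> z3 ` Q3" "w0 \<in> z3 ` Q3" and
    ne0: "fst v0 * fst (snd w0) \<noteq> fst (snd v0) * fst w0
      \<or> fst v0 * snd (snd w0) \<noteq> snd (snd v0) * fst w0 \<or> fst (snd v0) * snd (snd w0) \<noteq> snd (snd v0) * fst (snd w0)"
    by blast
  let ?V = "insert (0, 0, 0) (z3 ` Q3)"
  let ?f1 = "\<lambda>v :: int \<times> int \<times> int. fst v" and ?f2 = "\<lambda>v :: int \<times> int \<times> int. fst (snd v)"
    and ?f3 = "\<lambda>v :: int \<times> int \<times> int. snd (snd v)"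
  have V_bd: "\<bar>?f1 s\<bar> \<le> 3 * H \<and> \<bar>?f2 s\<bar> \<le> 3 * H ^ 2 \<and> \<bar>?f3 s\<bar> \<le> 3 * H ^ 3" if "s \<in> ?V" for s
    using that z3_bounds[of s] H_pos by auto
  have V_dvd: "p dvd ?f3 s + b * ?f2 s + b\<^sup>2 * ?f1 s" if "s \<in> ?V" for s
    using that z3_dvd[of s] by auto
  have rel_V: "rel s" if "s \<in> ?V" for s
    unfolding rel_def using V_bd[OF that] V_dvd[OF that] H_pos by auto
  have rel_diff: "rel (?f1 s - ?f1 t, ?f2 s - ?f2 t, ?f3 s - ?f3 t)" if "s \<in> ?V" "t \<in> ?V" for s t
  proof -
    have "p dvd (?f3 s + b * ?f2 s + b\<^sup>2 * ?f1 s) - (?f3 t + b * ?f2 t + b\<^sup>2 * ?f1 t)"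
      by (intro dvd_diff V_dvd that)
    moreover have "(?f3 s + b * ?f2 s + b\<^sup>2 * ?f1 s) - (?f3 t + b * ?f2 t + b\<^sup>2 * ?f1 t)
        = (?f3 s - ?f3 t) + b * (?f2 s - ?f2 t) + b\<^sup>2 * (?f1 s - ?f1 t)" by (simp add: algebra_simps)
    ultimately show ?thesis using V_bd[OF that(1)] V_bd[OF that(2)] unfolding rel_def by auto
  qed
  define A where "A = ?f2 v0 * ?f1 w0 - ?f1 v0 * ?f2 w0"
  define B where "B = ?f1 v0 * ?f3 w0 - ?f3 v0 * ?f1 w0"
  define C where "C = ?f3 v0 * ?f2 w0 - ?f2 v0 * ?f3 w0"
  have ABC: "A \<noteq> 0 \<or> B \<noteq> 0 \<or> C \<noteq> 0" using ne0 unfolding A_def B_def C_def by auto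
  have plane: "A * ?f3 s + B * ?f2 s + C * ?f1 s = 0" if "s \<in> ?V" for s
    unfolding A_def B_def C_def
    by (rule rel_det_zero[OF small]) (use rel_V[of v0] rel_V[of w0] rel_V[OF that] vw0 in simp_all)
  have "\<exists>v\<in>?V. \<exists>q\<in>?V. \<exists>s\<in>?V. \<exists>t\<in>?V.
     ((?f2 q - ?f2 v) * (?f1 t - ?f1 s) - (?f1 q - ?f1 v) * (?f2 t - ?f2 s) \<noteq> 0
      \<or> (?f1 q - ?f1 v) * (?f3 t - ?f3 s) - (?f3 q - ?f3 v) * (?f1 t - ?f1 s) \<noteq> 0
      \<or> (?f3 q - ?f3 v) * (?f2 t - ?f2 s) - (?f2 q - ?f2 v) * (?f3 t - ?f3 s) \<noteq> 0)
    \<and> \<bar>(?f2 q - ?f2 v) * (?f1 t - ?f1 s) - (?f1 q - ?f1 v) * (?f2 t - ?f2 s)\<bar> * int (card ?V) \<le> 288 * H ^ 3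
    \<and> \<bar>(?f1 q - ?f1 v) * (?f3 t - ?f3 s) - (?f3 q - ?f3 v) * (?f1 t - ?f1 s)\<bar> * int (card ?V) \<le> 288 * H ^ 4
    \<and> \<bar>(?f3 q - ?f3 v) * (?f2 t - ?f2 s) - (?f2 q - ?f2 v) * (?f3 t - ?f3 s)\<bar> * int (card ?V) \<le> 288 * H ^ 5"
  proof (rule small_cross_product[OF _ H_pos V_bd _ plane ABC])
    have "(0, 0, 0) \<in> ?V" "v0 \<in> ?V" "w0 \<in> ?V" using vw0 by auto
    moreover have "(?f2 v0 - ?f2 (0, 0, 0)) * (?f1 w0 - ?f1 (0, 0, 0)) - (?f1 v0 - ?f1 (0, 0, 0)) * (?f2 w0 - ?f2 (0, 0, 0)) = A"
      "(?f1 v0 - ?f1 (0, 0, 0)) * (?f3 w0 - ?f3 (0, 0, 0)) - (?f3 v0 - ?f3 (0, 0, 0)) * (?f1 w0 - ?f1 (0, 0, 0)) = B"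
      "(?f3 v0 - ?f3 (0, 0, 0)) * (?f2 w0 - ?f2 (0, 0, 0)) - (?f2 v0 - ?f2 (0, 0, 0)) * (?f3 w0 - ?f3 (0, 0, 0)) = C"
      unfolding A_def B_def C_def by simp_all
    ultimately show "\<exists>v\<in>?V. \<exists>q\<in>?V. \<exists>s\<in>?V. \<exists>t\<in>?V.
     (?f2 q - ?f2 v) * (?f1 t - ?f1 s) - (?f1 q - ?f1 v) * (?f2 t - ?f2 s) \<noteq> 0
      \<or> (?f1 q - ?f1 v) * (?f3 t - ?f3 s) - (?f3 q - ?f3 v) * (?f1 t - ?f1 s) \<noteq> 0
      \<or> (?f3 q - ?f3 v) * (?f2 t - ?f2 s) - (?f2 q - ?f2 v) * (?f3 t - ?f3 s) \<noteq> 0"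
      using ABC by metis
  qed (use finite_Q3 in \<open>auto simp: prod_eq_iff\<close>)
  then obtain v q s t where V: "v \<in> ?V" "q \<in> ?V" "s \<in> ?V" "t \<in> ?V" and
    ne: "(?f2 q - ?f2 v) * (?f1 t - ?f1 s) - (?f1 q - ?f1 v) * (?f2 t - ?f2 s) \<noteq> 0
      \<or> (?f1 q - ?f1 v) * (?f3 t - ?f3 s) - (?f3 q - ?f3 v) * (?f1 t - ?f1 s) \<noteq> 0
      \<or> (?f3 q - ?f3 v) * (?f2 t - ?f2 s) - (?f2 q - ?f2 v) * (?f3 t - ?f3 s) \<noteq> 0" and
    le: "\<bar>(?f2 q - ?f2 v) * (?f1 t - ?f1 s) - (?f1 q - ?f1 v) * (?f2 t - ?f2 s)\<bar> * int (card ?V) \<le> 288 * H ^ 3"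
      "\<bar>(?f1 q - ?f1 v) * (?f3 t - ?f3 s) - (?f3 q - ?f3 v) * (?f1 t - ?f1 s)\<bar> * int (card ?V) \<le> 288 * H ^ 4"
      "\<bar>(?f3 q - ?f3 v) * (?f2 t - ?f2 s) - (?f2 q - ?f2 v) * (?f3 t - ?f3 s)\<bar> * int (card ?V) \<le> 288 * H ^ 5"
    by blast
  note ru = rel_diff[OF V(2,1)] and rv = rel_diff[OF V(4,3)]
  define al where "al = (?f2 q - ?f2 v) * (?f1 t - ?f1 s) - (?f1 q - ?f1 v) * (?f2 t - ?f2 s)"
  define be where "be = (?f1 q - ?f1 v) * (?f3 t - ?f3 s) - (?f3 q - ?f3 v) * (?f1 t - ?f1 s)"
  define ga where "ga = (?f3 q - ?f3 v) * (?f2 t - ?f2 s) - (?f2 q - ?f2 v) * (?f3 t - ?f3 s)"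
  note abc = al_def[symmetric] be_def[symmetric] ga_def[symmetric]
  note bounds = rel_cross_bounds[OF ru rv, unfolded abc]
  note cong = rel_cross_cong[OF ru rv, unfolded abc]
  note ne' = ne[unfolded abc] and le' = le[unfolded abc]
  show ?thesis
  proof (cases "be\<^sup>2 = al * ga")
    case True
    \<comment> \<open>Otherwise \<open>be\<close> is 0 and p divides \<open>ga\<close>, which is
      nonzero and at most 72 H^5 < p in size.\<close>
    have "al \<noteq> 0"
    proof
      assume "al = 0"
      then have "be = 0" "ga \<noteq> 0" using True ne' by auto
      moreover have "p dvd ga" using cong(2) \<open>al = 0\<close> by simp
      moreover have "\<bar>ga\<bar> < p"
        using bounds(3) small H_power_mono[of 5 6] zero_le_power[of H 6] H_pos by linarith
      ultimately show False using dvd_imp_le_int[of ga p] by auto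
    qed
    have "card Q3 \<le> 8 * D ^ 3 * card S ^ 3"
    proof (rule card_Q3_le_common_root[OF \<open>al \<noteq> 0\<close> _ bounds(1,2)])
      fix w assume "w \<in> z3 ` Q3"
      then have "rel (?f1 w, ?f2 w, ?f3 w)" using rel_V[of w] by simp
      from rel_det_zero[OF small ru rv this, unfolded abc] have 0: "al * ?f3 w + be * ?f2 w + ga * ?f1 w = 0" .
      have "al\<^sup>2 * ?f3 w + al * be * ?f2 w + be\<^sup>2 * ?f1 w = al * (al * ?f3 w + be * ?f2 w + ga * ?f1 w)"
        unfolding True by (simp add: algebra_simps power2_eq_square)
      then show "al\<^sup>2 * ?f3 w + al * be * ?f2 w + be\<^sup>2 * ?f1 w = 0" unfolding 0 by simp
    qed
    then show ?thesis ..
  next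
    case False
    let ?M = "int (card ?V)"
    \<comment> \<open>Since be is congruent to b al and ga to b^2 al, the resultant is divisible by
      p. The constant 165888 is 2 * 288^2.\<close>
    have "be\<^sup>2 - al * ga = (be - b * al) * (be + b * al) - al * (ga - b\<^sup>2 * al)"
      by (simp add: algebra_simps power2_eq_square)
    also have "p dvd \<dots>" by (rule dvd_diff[OF dvd_mult2[OF cong(1)] dvd_mult[OF cong(2)]])
    finally have "p \<le> \<bar>be\<^sup>2 - al * ga\<bar>" using False dvd_imp_le_int[of "be\<^sup>2 - al * ga" p] p_pos by simp
    also have "\<dots> \<le> \<bar>be\<bar> * \<bar>be\<bar> + \<bar>al\<bar> * \<bar>ga\<bar>"
      by (metis abs_mult abs_triangle_ineq4 power2_eq_square)
    finally have "?M\<^sup>2 * p \<le> ?M\<^sup>2 * (\<bar>be\<bar> * \<bar>be\<bar> + \<bar>al\<bar> * \<bar>ga\<bar>)" by (rule mult_left_mono) simp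
    also have "\<dots> = (\<bar>be\<bar> * ?M) * (\<bar>be\<bar> * ?M) + (\<bar>al\<bar> * ?M) * (\<bar>ga\<bar> * ?M)"
      by (simp add: algebra_simps power2_eq_square)
    also have "\<dots> \<le> (288 * H ^ 4) * (288 * H ^ 4) + (288 * H ^ 3) * (288 * H ^ 5)"
      by (intro add_mono mult_mono[OF le'(2) le'(2)] mult_mono[OF le'(1) le'(3)]) (use H_pos in simp_all)
    also have "\<dots> = 165888 * H ^ 8" by (simp flip: power_add)
    finally have "?M\<^sup>2 * p \<le> 165888 * H ^ 8" .
    moreover have "(int (card (z3 ` Q3)))\<^sup>2 * p \<le> ?M\<^sup>2 * p"
      using p_pos finite_Q3 by (intro mult_right_mono power_mono) (auto simp: card_insert_if)
    ultimately show ?thesis by linarith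
  qed
qed

text \<open>The estimate for the polynomials concerns the square of their number, so N^5 <= 6 K D^3
  times this number is squared; hence the exponent 10 and the constant 36 * 165888 < 6000000. The
  constant 400 covers the common root (186) and the range where shared entries dominate
  (324).\<close>

lemma card_S_bound3:
  assumes small: "2000 * H ^ 6 < p"
  shows "card S ^ 3 \<le> 400 * K * D ^ 3
    \<or> real (card S) ^ 10 * of_int p \<le> 6000000 * real K ^ 2 * real D ^ 6 * of_int H ^ 8"
proof (cases "S = {}")
  case False
  let ?N = "card S"
  have N: "?N > 0" using finite_S False by (simp add: card_gt_0_iff)
  have "9 * ?N * card E2 \<le> 9 * ?N * (6 * D\<^sup>2 * ?N\<^sup>2)" using card_E2_le_small[OF small] by simp
  also have "\<dots> = 54 * D\<^sup>2 * ?N ^ 3" by (simp add: power2_eq_square power3_eq_cube)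
  finally have E3: "card E3 \<le> 54 * D\<^sup>2 * ?N ^ 3 + card Q3" using card_E3_le by linarith
  have DD: "D\<^sup>2 \<le> D ^ 3" using D_pos by (intro power_increasing) auto
  have N6: "?N ^ 6 = ?N ^ 3 * ?N ^ 3" by (simp flip: power_add)
  show ?thesis
  proof (cases "card Q3 \<le> 8 * D ^ 3 * ?N ^ 3")
    case True
    have "54 * D\<^sup>2 * ?N ^ 3 \<le> 54 * D ^ 3 * ?N ^ 3" using DD by simp
    then have "card E3 \<le> 62 * D ^ 3 * ?N ^ 3" using E3 True by linarith
    then have "3 * K * card E3 \<le> 3 * K * (62 * D ^ 3 * ?N ^ 3)" by (rule mult_le_mono2)
    then have "?N ^ 3 * ?N ^ 3 \<le> 3 * K * (62 * D ^ 3 * ?N ^ 3)" using card_E3_ge unfolding N6 by (rule le_trans[rotated])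
    also have "\<dots> = (186 * K * D ^ 3) * ?N ^ 3" by simp
    finally have "?N ^ 3 \<le> 186 * K * D ^ 3" using N by (subst (asm) mult_le_cancel2) auto
    also have "\<dots> \<le> 400 * K * D ^ 3" by simp
    finally show ?thesis ..
  next
    case False
    then have V: "(int (card (z3 ` Q3)))\<^sup>2 * p \<le> 165888 * H ^ 8" using card_Q3_le_or[OF small] by blast
    have "3 * K * card E3 \<le> 3 * K * (54 * D\<^sup>2 * ?N ^ 3 + ?N * card (z3 ` Q3) * D ^ 3)"
      using E3 card_Q3_le by (intro mult_le_mono2) linarith
    then have E: "?N ^ 6 \<le> 162 * K * D\<^sup>2 * ?N ^ 3 + 3 * K * ?N * card (z3 ` Q3) * D ^ 3"
      using card_E3_ge by (simp add: algebra_simps)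
    show ?thesis
    proof (cases "?N ^ 3 \<le> 324 * K * D\<^sup>2")
      case True
      note True
      also have "324 * K * D\<^sup>2 \<le> 400 * K * D ^ 3" using DD by (intro mult_mono) auto
      finally show ?thesis ..
    next
      case False
      then have "324 * K * D\<^sup>2 * ?N ^ 3 \<le> ?N ^ 3 * ?N ^ 3" by (intro mult_le_mono1) simp
      then have "?N ^ 6 \<le> 6 * K * ?N * card (z3 ` Q3) * D ^ 3" using E unfolding N6 by linarith
      then have "?N ^ 5 * ?N \<le> (6 * K * card (z3 ` Q3) * D ^ 3) * ?N" by (simp add: eval_nat_numeral mult_ac)
      then have "?N ^ 5 \<le> 6 * K * card (z3 ` Q3) * D ^ 3" using N by (subst (asm) mult_le_cancel2) auto
      then have "(?N ^ 5)\<^sup>2 \<le> (6 * K * card (z3 ` Q3) * D ^ 3)\<^sup>2" by (rule power_mono) simp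
      then have "?N ^ 10 \<le> 36 * K\<^sup>2 * D ^ 6 * (card (z3 ` Q3))\<^sup>2"
        by (simp add: power_mult_distrib mult_ac flip: power_mult)
      then have "int (?N ^ 10) \<le> int (36 * K\<^sup>2 * D ^ 6 * (card (z3 ` Q3))\<^sup>2)" by (simp only: of_nat_le_iff)
      then have "int (?N ^ 10) * p \<le> int (36 * K\<^sup>2 * D ^ 6 * (card (z3 ` Q3))\<^sup>2) * p"
        using p_pos by (intro mult_right_mono) auto
      also have "\<dots> = 36 * int K ^ 2 * int D ^ 6 * ((int (card (z3 ` Q3)))\<^sup>2 * p)" by simp
      also have "\<dots> \<le> 36 * int K ^ 2 * int D ^ 6 * (165888 * H ^ 8)" by (intro mult_left_mono V) auto
      also have "\<dots> = 5971968 * (int K ^ 2 * int D ^ 6 * H ^ 8)" by simp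
      also have "\<dots> \<le> 6000000 * (int K ^ 2 * int D ^ 6 * H ^ 8)" using H_pos by (intro mult_right_mono) auto
      finally have "real_of_int (int (?N ^ 10) * p) \<le> real_of_int (6000000 * (int K ^ 2 * int D ^ 6 * H ^ 8))"
        by (simp only: of_int_le_iff)
      then show ?thesis by (simp add: mult_ac)
    qed
  qed
qed simp

end

section \<open>Point-line incidences modulo a prime\<close>

text \<open>A variance estimate for the number of lines through a point. Over the plane
  \<open>U\<close> its mean is |L| / p, as each line has p of the p^2 points. Two lines meet at most
  once, so the squared deviations sum to at most p |L|; Cauchy-Schwarz restricts this to
  \<open>P\<close>.\<close>

lemma incidence_bound:
  fixes U :: "'a set" and L :: "'b set" and inc :: "'a \<Rightarrow> 'b \<Rightarrow> bool" and p :: nat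
  assumes fin: "finite U" "finite L" and p: "p > 0" and U: "card U = p\<^sup>2"
    and line: "\<And>l. l \<in> L \<Longrightarrow> card {u\<in>U. inc u l} = p"
    and meet: "\<And>l l'. l \<in> L \<Longrightarrow> l' \<in> L \<Longrightarrow> l \<noteq> l' \<Longrightarrow> card {u\<in>U. inc u l \<and> inc u l'} \<le> 1"
    and P: "P \<subseteq> U"
  shows "(real (card {(u, l). u \<in> P \<and> l \<in> L \<and> inc u l}) - real (card P) * real (card L) / real p)\<^sup>2
    \<le> real p * real (card L) * real (card P)"
proof -
  define n where "n u = (\<Sum>l\<in>L. of_bool (inc u l) :: real)" for u
  define \<mu> where "\<mu> = real (card L) / real p"
  have finP: "finite P" using P fin finite_subset by blast
  have ind: "(\<Sum>u\<in>A. of_bool (Q u) :: real) = real (card {u\<in>A. Q u})" if "finite A" for A :: "'c set" and Q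
    using that by (simp add: of_bool_def sum.If_cases Int_def)
  have S1: "(\<Sum>u\<in>U. n u) = real (card L) * real p"
  proof -
    have "(\<Sum>u\<in>U. n u) = (\<Sum>l\<in>L. \<Sum>u\<in>U. of_bool (inc u l))" unfolding n_def by (rule sum.swap)
    also have "\<dots> = (\<Sum>l\<in>L. real p)" by (rule sum.cong) (use line ind[OF fin(1)] in auto)
    finally show ?thesis by simp
  qed
  have S2: "(\<Sum>u\<in>U. (n u)\<^sup>2) \<le> real (card L) * real p + (real (card L))\<^sup>2"
  proof -
    have "(\<Sum>u\<in>U. (n u)\<^sup>2) = (\<Sum>u\<in>U. \<Sum>l\<in>L. \<Sum>l'\<in>L. of_bool (inc u l \<and> inc u l'))"
      unfolding n_def power2_eq_square sum_product by (simp only: of_bool_conj)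
    also have "\<dots> = (\<Sum>l\<in>L. \<Sum>u\<in>U. \<Sum>l'\<in>L. of_bool (inc u l \<and> inc u l'))" by (rule sum.swap)
    also have "\<dots> = (\<Sum>l\<in>L. \<Sum>l'\<in>L. \<Sum>u\<in>U. of_bool (inc u l \<and> inc u l'))"
      by (intro sum.cong refl sum.swap)
    also have "\<dots> = (\<Sum>l\<in>L. \<Sum>l'\<in>L. real (card {u\<in>U. inc u l \<and> inc u l'}))"
      by (simp only: ind[OF fin(1)])
    also have "\<dots> \<le> (\<Sum>l\<in>L. \<Sum>l'\<in>L. (if l' = l then real p else 0) + 1)"
    proof (intro sum_mono)
      fix l l' assume "l \<in> L" "l' \<in> L"
      then show "real (card {u\<in>U. inc u l \<and> inc u l'}) \<le> (if l' = l then real p else 0) + 1"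
        using line[of l] meet[of l l'] by (cases "l' = l") auto
    qed
    also have "\<dots> = (\<Sum>l\<in>L. real p + real (card L))"
      by (intro sum.cong refl) (simp add: sum.distrib fin)
    also have "\<dots> = real (card L) * real p + (real (card L))\<^sup>2" by (simp add: algebra_simps power2_eq_square)
    finally show ?thesis .
  qed
  have "{(u, l). u \<in> P \<and> l \<in> L \<and> inc u l} = (SIGMA u:P. {l\<in>L. inc u l})" by auto
  then have "real (card {(u, l). u \<in> P \<and> l \<in> L \<and> inc u l}) = (\<Sum>u\<in>P. real (card {l\<in>L. inc u l}))"
    using finP fin by (simp add: card_SigmaI)
  also have "\<dots> = (\<Sum>u\<in>P. n u)" unfolding n_def by (simp only: ind[OF fin(2)])
  finally have I: "real (card {(u, l). u \<in> P \<and> l \<in> L \<and> inc u l}) = (\<Sum>u\<in>P. n u)" .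
  have "(\<Sum>u\<in>P. n u) - real (card P) * real (card L) / real p = (\<Sum>u\<in>P. (n u - \<mu>) * 1)"
    unfolding \<mu>_def by (simp add: sum_subtractf)
  then have "((\<Sum>u\<in>P. n u) - real (card P) * real (card L) / real p)\<^sup>2 = (\<Sum>u\<in>P. (n u - \<mu>) * 1)\<^sup>2" by simp
  also have "\<dots> \<le> (\<Sum>u\<in>P. (n u - \<mu>)\<^sup>2) * (\<Sum>u\<in>P. 1\<^sup>2)" by (rule Cauchy_Schwarz_ineq_sum)
  also have "\<dots> \<le> (\<Sum>u\<in>U. (n u - \<mu>)\<^sup>2) * real (card P)"
    using P fin by (intro mult_mono sum_mono2 sum_nonneg) auto
  also have "(\<Sum>u\<in>U. (n u - \<mu>)\<^sup>2) = (\<Sum>u\<in>U. (n u)\<^sup>2) - 2 * \<mu> * (\<Sum>u\<in>U. n u) + (real p)\<^sup>2 * \<mu>\<^sup>2"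
  proof -
    have "(\<Sum>u\<in>U. (n u - \<mu>)\<^sup>2) = (\<Sum>u\<in>U. (n u)\<^sup>2 - 2 * \<mu> * n u + \<mu>\<^sup>2)"
      by (intro sum.cong refl) (simp add: power2_diff)
    also have "\<dots> = (\<Sum>u\<in>U. (n u)\<^sup>2) - (\<Sum>u\<in>U. 2 * \<mu> * n u) + (real p)\<^sup>2 * \<mu>\<^sup>2"
      using U by (simp only: sum.distrib sum_subtractf sum_constant) simp
    finally show ?thesis by (simp only: sum_distrib_left)
  qed
  \<comment> \<open>The terms |L|^2 cancel: 1 from pairs of lines, -2 from the mixed term, 1 from
    the squared mean.\<close>
  also have "\<dots> \<le> real p * real (card L)"
    using S2 p unfolding S1 \<mu>_def by (simp add: field_simps power2_eq_square)
  then have "((\<Sum>u\<in>U. (n u)\<^sup>2) - 2 * \<mu> * (\<Sum>u\<in>U. n u) + (real p)\<^sup>2 * \<mu>\<^sup>2) * real (card P)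
      \<le> real p * real (card L) * real (card P)" by (rule mult_right_mono) simp
  finally show ?thesis unfolding I .
qed

context log_points begin

text \<open>With \<open>g = G ^ j\<close>, the relation \<open>c G^(x y + j) = g ((y + l + b) - l)\<close> is an incidence of the
  point \<open>(l, c G^(x y + j))\<close> with the line \<open>v = g (w - l)\<close>, \<open>w = y + l + b\<close>; every \<open>y\<close> gives one
  for each choice of \<open>g\<close> and \<open>l\<close>.\<close>
lemma card_S_bound_large:
  assumes KH: "int K \<le> H" and G: "\<not> p dvd G"
  shows "real (card S) \<le> 4 * of_int H ^ 2 / of_int p + 2 * sqrt (of_int p)"
proof -
  define n where "n = nat H"
  have n: "int n = H" "n > 0" using H_pos unfolding n_def by auto
  define q where "q = nat p"
  have q: "int q = p" "q > 0" using p_pos unfolding q_def by auto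
  \<comment> \<open>\<open>B\<close> holds the slopes, \<open>A\<close> the second coordinates of
    the points and \<open>W\<close> the residues of y + l + b. The doubled ranges contain all sums x
    y + j and y + l.\<close>
  define B where "B = (\<lambda>j. G ^ j mod p) ` {..<n}"
  define A where "A = (\<lambda>m. c * G ^ m mod p) ` {..<2 * n}"
  define W where "W = (\<lambda>y. (y + b) mod p) ` {0..<2 * H}"
  define U where "U = {0..<p} \<times> {0..<p}"
  define P where "P = {0..<H} \<times> A"
  define inc where "inc u l = (snd u = fst l * (snd l - fst u) mod p)" for u l :: "int \<times> int"
  have Bnz: "\<not> p dvd g" if g: "g \<in> B" for g
  proof -
    obtain j where "g = G ^ j mod p" using g unfolding B_def by blast
    moreover have "\<not> p dvd G ^ j" using G p_prime prime_dvd_power by blast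
    ultimately show ?thesis by (simp add: dvd_mod_iff)
  qed
  have Brange: "B \<subseteq> {0..<p}" "W \<subseteq> {0..<p}" "A \<subseteq> {0..<p}" unfolding B_def W_def A_def using p_pos by auto
  have cancel: "u = v" if "p dvd u - v" "u \<in> {0..<p}" "v \<in> {0..<p}" for u v
    using that dvd_imp_le_int[of "u - v" p] by (cases "u = v") auto
  have finBW: "finite (B \<times> W)" unfolding B_def W_def by simp
  have finA: "finite A" unfolding A_def by simp
  have "(real (card {(u, l). u \<in> P \<and> l \<in> B \<times> W \<and> inc u l}) - real (card P) * real (card (B \<times> W)) / real q)\<^sup>2
      \<le> real q * real (card (B \<times> W)) * real (card P)"
  proof (rule incidence_bound[of U])
    show "finite U" "finite (B \<times> W)" "q > 0" using finBW q unfolding U_def by auto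
    show "card U = q\<^sup>2" unfolding U_def q_def by (simp add: card_cartesian_product power2_eq_square)
    show "P \<subseteq> U" unfolding P_def U_def using Brange H_le by auto
  next
    fix l assume l: "l \<in> B \<times> W"
    have "{u\<in>U. inc u l} = (\<lambda>a. (a, fst l * (snd l - a) mod p)) ` {0..<p}"
      unfolding U_def inc_def using p_pos by (auto simp: image_iff)
    moreover have "inj_on (\<lambda>a. (a, fst l * (snd l - a) mod p)) {0..<p}" by (rule inj_onI) simp
    ultimately show "card {u\<in>U. inc u l} = q" unfolding q_def by (simp add: card_image)
  next
    fix l l' assume l: "l \<in> B \<times> W" "l' \<in> B \<times> W" "l \<noteq> l'"
    have "u = u'" if u: "u \<in> {u\<in>U. inc u l \<and> inc u l'}" "u' \<in> {u\<in>U. inc u l \<and> inc u l'}" for u u'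
    proof -
      obtain g w g' w' where gw: "l = (g, w)" "l' = (g', w')" by (cases l; cases l') auto
      have rng: "g \<in> {0..<p}" "g' \<in> {0..<p}" "w \<in> {0..<p}" "w' \<in> {0..<p}"
        using l(1,2) Brange unfolding gw mem_Times_iff fst_conv snd_conv by blast+
      have "g * (w - fst u) mod p = g' * (w' - fst u) mod p" "g * (w - fst u') mod p = g' * (w' - fst u') mod p"
        using u unfolding inc_def gw by auto
      then have d: "p dvd g * (w - fst u) - g' * (w' - fst u)" "p dvd g * (w - fst u') - g' * (w' - fst u')"
        by (simp_all add: mod_eq_dvd_iff)
      have "p dvd (g * (w - fst u) - g' * (w' - fst u)) - (g * (w - fst u') - g' * (w' - fst u'))"
        using d by (rule dvd_diff)
      then have "p dvd (g' - g) * (fst u - fst u')" by (simp add: algebra_simps)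
      then consider "p dvd g' - g" | "p dvd fst u - fst u'" using p_prime prime_dvd_mult_iff by blast
      then show "u = u'"
      proof cases
        case 1
        then have gg: "g' = g" by (rule cancel) (rule rng)+
        have "p dvd g * (w - w')" using d(1) unfolding gg by (simp add: algebra_simps)
        then have "p dvd w - w'" using Bnz[of g] l p_prime prime_dvd_mult_iff unfolding gw by blast
        then have "w = w'" by (rule cancel) (rule rng)+
        then show ?thesis using gg l(3) unfolding gw by simp
      next
        case 2
        then have "fst u = fst u'" using cancel[of "fst u" "fst u'"] u unfolding U_def by auto
        then show ?thesis using u unfolding inc_def by (auto simp: prod_eq_iff)
      qed
    qed
    then show "card {u\<in>U. inc u l \<and> inc u l'} \<le> 1"
      using card_le_Suc0_iff_eq[of "{u\<in>U. inc u l \<and> inc u l'}"] unfolding U_def by auto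
  qed
  then have "\<bar>real (card {(u, l). u \<in> P \<and> l \<in> B \<times> W \<and> inc u l}) - real (card P) * real (card (B \<times> W)) / real q\<bar>
      \<le> sqrt (real q * real (card (B \<times> W)) * real (card P))"
    by (subst real_sqrt_abs[symmetric]) (rule real_sqrt_le_mono)
  then have inc_le: "real (card {(u, l). u \<in> P \<and> l \<in> B \<times> W \<and> inc u l})
      \<le> real (card P) * real (card (B \<times> W)) / real q + sqrt (real q * real (card (B \<times> W)) * real (card P))"
    by linarith
  \<comment> \<open>Powers of \<open>G\<close> may repeat modulo p, so \<open>e\<close> can be far
    smaller than \<open>n\<close>. Because \<open>A\<close> is covered by two dilates of
    \<open>B\<close>, points and lines both number at most 2 n e; one factor \<open>e\<close>
    cancels against the count of incidences, and a remaining one is bounded by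
    \<open>n\<close>.\<close>
  define e where "e = card B"
  have cardP: "card P \<le> 2 * n * e"
  proof -
    have "A \<subseteq> (\<lambda>g. c * g mod p) ` B \<union> (\<lambda>g. c * G ^ n * g mod p) ` B"
    proof
      fix a assume "a \<in> A"
      then obtain m where m: "m < 2 * n" "a = c * G ^ m mod p" unfolding A_def by auto
      show "a \<in> (\<lambda>g. c * g mod p) ` B \<union> (\<lambda>g. c * G ^ n * g mod p) ` B"
      proof (cases "m < n")
        case True
        then have "a = c * (G ^ m mod p) mod p" "G ^ m mod p \<in> B" using m unfolding B_def by (auto simp: mod_mult_right_eq)
        then show ?thesis by blast
      next
        case False
        then have "a = c * G ^ n * (G ^ (m - n) mod p) mod p"
          unfolding mod_mult_right_eq using m False by (simp add: mult.assoc flip: power_add)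
        moreover have "G ^ (m - n) mod p \<in> B" using m False unfolding B_def by auto
        ultimately show ?thesis by blast
      qed
    qed
    then have "card A \<le> card ((\<lambda>g. c * g mod p) ` B \<union> (\<lambda>g. c * G ^ n * g mod p) ` B)"
      by (rule card_mono[rotated]) (simp add: B_def)
    also have "\<dots> \<le> card ((\<lambda>g. c * g mod p) ` B) + card ((\<lambda>g. c * G ^ n * g mod p) ` B)" by (rule card_Un_le)
    also have "\<dots> \<le> e + e" unfolding e_def by (intro add_mono card_image_le) (simp_all add: B_def)
    finally show ?thesis unfolding P_def n_def by (simp add: card_cartesian_product)
  qed
  have "card W \<le> card {0..<2 * H}" unfolding W_def by (rule card_image_le) simp
  then have cardL: "card (B \<times> W) \<le> 2 * n * e" unfolding e_def n_def by (simp add: card_cartesian_product nat_mult_distrib)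
  have "card (S \<times> B \<times> {0..<H}) \<le> card {(u, l). u \<in> P \<and> l \<in> B \<times> W \<and> inc u l}"
  proof (rule card_inj_on_le[of "\<lambda>(y, g, l). ((l, c * G ^ x y * g mod p), (g, (y + l + b) mod p))"])
    show "inj_on (\<lambda>(y, g, l). ((l, c * G ^ x y * g mod p), (g, (y + l + b) mod p))) (S \<times> B \<times> {0..<H})"
    proof (rule inj_onI)
      fix t t' assume "t \<in> S \<times> B \<times> {0..<H}" "t' \<in> S \<times> B \<times> {0..<H}"
        and eq: "(case t of (y, g, l) \<Rightarrow> ((l, c * G ^ x y * g mod p), (g, (y + l + b) mod p)))
          = (case t' of (y, g, l) \<Rightarrow> ((l, c * G ^ x y * g mod p), (g, (y + l + b) mod p)))"
      then obtain y g l y' g' l' where t: "t = (y, g, l)" "t' = (y', g', l')" and y: "y \<in> S" "y' \<in> S" by auto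
      have e: "(y + l + b) mod p = (y' + l + b) mod p" "g = g'" "l = l'" using eq unfolding t by auto
      have "p dvd (y + l + b) - (y' + l + b)" using e(1) by (simp add: mod_eq_dvd_iff)
      then have "p dvd y - y'" by simp
      then have "y = y'" using cancel S_bounds[OF y(1)] S_bounds[OF y(2)] H_le by auto
      then show "t = t'" using e t by simp
    qed
    show "(\<lambda>(y, g, l). ((l, c * G ^ x y * g mod p), (g, (y + l + b) mod p))) ` (S \<times> B \<times> {0..<H})
        \<subseteq> {(u, l). u \<in> P \<and> l \<in> B \<times> W \<and> inc u l}"
    proof (rule image_subsetI)
      fix t assume "t \<in> S \<times> B \<times> {0..<H}"
      then obtain y g l where t: "t = (y, g, l)" and y: "y \<in> S" and g: "g \<in> B" and l: "0 \<le> l" "l < H" by auto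
      obtain j where j: "j < n" "g = G ^ j mod p" using g unfolding B_def by auto
      have "c * G ^ x y * g mod p = c * G ^ (x y + j) mod p"
        unfolding j(2) mod_mult_right_eq by (simp add: power_add mult.assoc)
      moreover have "x y + j < 2 * n" using x_less[OF y] KH j(1) n by linarith
      ultimately have 1: "c * G ^ x y * g mod p \<in> A" unfolding A_def by auto
      have 2: "(y + l + b) mod p \<in> W" unfolding W_def using S_bounds[OF y] l by auto
      have "[g * ((y + l + b) mod p - l) = g * (y + l + b - l)] (mod p)"
        by (intro cong_mult cong_diff cong_refl) (simp add: cong_def)
      also have "g * (y + l + b - l) = g * (y + b)" by simp
      also have "[\<dots> = g * (c * G ^ x y)] (mod p)" by (intro cong_mult cong_refl log y)
      finally have "c * G ^ x y * g mod p = g * ((y + l + b) mod p - l) mod p"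
        unfolding cong_def by (simp add: mult_ac)
      then show "(case t of (y, g, l) \<Rightarrow> ((l, c * G ^ x y * g mod p), (g, (y + l + b) mod p)))
          \<in> {(u, l). u \<in> P \<and> l \<in> B \<times> W \<and> inc u l}"
        using 1 2 g l unfolding t P_def inc_def by simp
    qed
    have "finite (P \<times> (B \<times> W))" using finA finBW unfolding P_def by blast
    then show "finite {(u, l). u \<in> P \<and> l \<in> B \<times> W \<and> inc u l}" by (rule rev_finite_subset) auto
  qed
  then have "real (card S * (e * n)) \<le> real (card {(u, l). u \<in> P \<and> l \<in> B \<times> W \<and> inc u l})"
    by (simp only: of_nat_le_iff card_cartesian_product e_def[symmetric]) (simp add: n_def)
  also have "\<dots> \<le> real (2 * n * e) * real (2 * n * e) / real q + sqrt (real q * real (2 * n * e) * real (2 * n * e))"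
  proof -
    have cr: "real (card P) \<le> real (2 * n * e)" "real (card (B \<times> W)) \<le> real (2 * n * e)"
      using cardP cardL by (simp_all only: of_nat_le_iff)
    have "real (card P) * real (card (B \<times> W)) / real q \<le> real (2 * n * e) * real (2 * n * e) / real q"
      by (intro divide_right_mono mult_mono cr) simp_all
    moreover have "sqrt (real q * real (card (B \<times> W)) * real (card P)) \<le> sqrt (real q * real (2 * n * e) * real (2 * n * e))"
      by (intro real_sqrt_le_mono mult_mono cr) simp_all
    ultimately show ?thesis using inc_le by linarith
  qed
  also have "sqrt (real q * real (2 * n * e) * real (2 * n * e)) = sqrt (real q) * real (2 * n * e)"
    by (simp only: real_sqrt_mult mult.assoc real_sqrt_mult_self abs_of_nat)
  also have "real (2 * n * e) * real (2 * n * e) / real q + sqrt (real q) * real (2 * n * e)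
      = real (e * n) * (4 * (real n * real e) / real q + 2 * sqrt (real q))"
    by (simp add: algebra_simps)
  finally have le: "real (e * n) * real (card S) \<le> real (e * n) * (4 * (real n * real e) / real q + 2 * sqrt (real q))"
    by (simp only: of_nat_mult mult_ac)
  have "{..<n} \<noteq> {}" using n(2) by blast
  then have "e > 0" unfolding e_def B_def by (simp add: card_gt_0_iff)
  then have "real (card S) \<le> 4 * (real n * real e) / real q + 2 * sqrt (real q)"
    using le n mult_le_cancel_left_pos[of "real (e * n)"] by simp
  moreover have "e \<le> n" unfolding e_def B_def using card_image_le[of "{..<n}"] by auto
  then have "4 * (real n * real e) / real q \<le> 4 * (real n * real n) / real q"
    by (intro divide_right_mono mult_left_mono) auto
  moreover have "of_int H = real n" "of_int p = real q" using n q by (metis of_int_of_nat_eq)+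
  ultimately show ?thesis by (simp add: power2_eq_square)
qed

end

section \<open>Points from one cycle\<close>

lemma exp_seq_shift:
  "exp_seq p g u0 m = exp_seq p g u0 n \<Longrightarrow> exp_seq p g u0 (m + l) = exp_seq p g u0 (n + l)"
  by (induction l) auto

lemma eventual_period_mult:
  fixes n T :: nat
  assumes "\<And>n. n \<ge> s \<Longrightarrow> f n = f (n + T)" "n \<ge> s"
  shows "f (n + j * T) = f n"
proof (induction j)
  case (Suc j)
  have "f (n + j * T) = f (n + j * T + T)" by (rule assms(1)) (use assms(2) in simp)
  then show ?case using Suc by (simp add: add.assoc add.commute[of T])
qed simp

text \<open>Each term determines the next, so a repetition inside the window would be an eventual
  period shorter than the least one. The window may start anywhere.\<close>

lemma exp_seq_inj_on_cycle:
  assumes "prime p" "\<not> int p dvd g" "u0 \<in> {1..p - 1}"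
  shows "inj_on (exp_seq p g u0) {s..<s + cycle_length (exp_seq p g u0)}"
proof -
  let ?u = "exp_seq p g u0" and ?t = "cycle_length (exp_seq p g u0)"
  have "?u m \<noteq> ?u n" if mn: "s \<le> m" "m < n" "n < s + ?t" for m n
  proof
    assume eq: "?u m = ?u n"
    have "?u l = ?u (l + (n - m))" if "l \<ge> m" for l
      using exp_seq_shift[OF eq, of "l - m"] that mn by (simp add: add.commute)
    then have "0 < n - m \<and> (\<exists>s. \<forall>l\<ge>s. ?u l = ?u (l + (n - m)))" using mn by auto
    then have "?t \<le> n - m" unfolding cycle_length_def by (rule Least_le)
    then show False using mn by linarith
  qed
  then show ?thesis
    by (intro inj_onI) (metis atLeastLessThan_iff linorder_neqE_nat)
qed

text \<open>The \<open>t / \<tau>\<close> terms of one cycle of \<open>u\<close> at distance \<open>\<tau>\<close> agree modulo \<open>2 ^ k\<close>, and so do their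
  successors; dividing by \<open>2 ^ k\<close> puts them and their discrete logarithms in intervals of length \<open>p / 2 ^ k\<close>.\<close>
lemma cycle_points:
  assumes p: "prime p" "odd p" and g: "\<not> int p dvd g" and u0: "u0 \<in> {1..p - 1}"
  obtains b c G S x where "S \<subseteq> {0..<int (p div 2 ^ k + 1)}" "inj_on x S"
    "\<And>y. y \<in> S \<Longrightarrow> x y < p div 2 ^ k + 1"
    "\<And>y. y \<in> S \<Longrightarrow> [y + b = c * G ^ x y] (mod int p)" "\<not> int p dvd G"
    "cycle_length (exp_seq p g u0) \<le> card S * cycle_length (low_bits k (exp_seq p g u0))"
proof -
  define u where "u = exp_seq p g u0"
  define t where "t = cycle_length u"
  define \<tau> where "\<tau> = cycle_length (low_bits k u)"
  have ex: "\<exists>t>0. \<exists>s. \<forall>n\<ge>s. u n = u (n + t)" unfolding u_def by (rule exp_seq_eventually_periodic[OF p(1) g u0])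
  then have "\<exists>t>0. \<exists>s. \<forall>n\<ge>s. low_bits k u n = low_bits k u (n + t)"
    unfolding low_bits_def by metis
  note \<tau> = cycle_length_attained[OF this, folded \<tau>_def] and t = cycle_length_attained[OF ex, folded t_def]
  obtain s where s: "\<And>n. n \<ge> s \<Longrightarrow> low_bits k u n = low_bits k u (n + \<tau>)" using \<tau>(2) by blast
  \<comment> \<open>The quotient t / \<tau> rounded up: the number of multiples of \<tau>, 0
    included, below \<open>t\<close>.\<close>
  define J where "J = (t + \<tau> - 1) div \<tau>"
  have J_ge: "t \<le> J * \<tau>"
  proof -
    have "t + \<tau> - 1 = J * \<tau> + (t + \<tau> - 1) mod \<tau>" unfolding J_def by simp
    moreover have "(t + \<tau> - 1) mod \<tau> < \<tau>" using \<tau>(1) by simp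
    ultimately show ?thesis using \<tau>(1) by linarith
  qed
  have J_less: "j * \<tau> < t" if "j < J" for j
  proof -
    have "Suc j * \<tau> \<le> J * \<tau>" using that by (intro mult_le_mono1) simp
    also have "\<dots> \<le> t + \<tau> - 1" unfolding J_def by simp
    finally show ?thesis using \<tau>(1) t(1) by simp
  qed
  have inj_cycle: "inj_on u {s..<s + t}" for s
    unfolding t_def u_def by (rule exp_seq_inj_on_cycle[OF p(1) g u0])
  define X where "X j = u (s + j * \<tau>)" for j
  define Y where "Y j = u (Suc (s + j * \<tau>))" for j
  define X' where "X' j = X j div 2 ^ k" for j
  define Y' where "Y' j = int (Y j div 2 ^ k)" for j
  have per: "u (n + j * \<tau>) mod 2 ^ k = u n mod 2 ^ k" if "n \<ge> s" for n j
    using eventual_period_mult[of s "low_bits k u" \<tau> n j, OF s that] unfolding low_bits_def by simp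
  have X_mod: "X j mod 2 ^ k = X 0 mod 2 ^ k" for j unfolding X_def using per[of s j] by simp
  have Y_mod: "Y j mod 2 ^ k = Y 0 mod 2 ^ k" for j
    unfolding Y_def using per[of "Suc s" j] by simp
  have X_eq: "X j = 2 ^ k * X' j + X 0 mod 2 ^ k" for j
    unfolding X'_def using X_mod[of j] mult_div_mod_eq[of "2 ^ k" "X j"] by linarith
  have Y_eq: "Y j = 2 ^ k * nat (Y' j) + Y 0 mod 2 ^ k" for j
    unfolding Y'_def nat_int using Y_mod[of j] mult_div_mod_eq[of "2 ^ k" "Y j"] by linarith
  have X_inj: "inj_on X {..<J}"
  proof (rule inj_onI)
    fix i j assume ij: "i \<in> {..<J}" "j \<in> {..<J}" "X i = X j"
    have "s + i * \<tau> \<in> {s..<s + t}" "s + j * \<tau> \<in> {s..<s + t}" using J_less[of i] J_less[of j] ij(1,2) by simp_all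
    then have "s + i * \<tau> = s + j * \<tau>" by (rule inj_onD[OF inj_cycle[of s] ij(3)[unfolded X_def]])
    then show "i = j" using \<tau>(1) by simp
  qed
  \<comment> \<open>The successors lie in the window of length \<open>t\<close> that starts one step
    later, where \<open>u\<close> is injective as well.\<close>
  have Y_inj: "inj_on Y {..<J}"
  proof (rule inj_onI)
    fix i j assume ij: "i \<in> {..<J}" "j \<in> {..<J}" "Y i = Y j"
    have "Suc (s + i * \<tau>) \<in> {Suc s..<Suc s + t}" "Suc (s + j * \<tau>) \<in> {Suc s..<Suc s + t}"
      using J_less[of i] J_less[of j] ij(1,2) by simp_all
    then have "Suc (s + i * \<tau>) = Suc (s + j * \<tau>)" by (rule inj_onD[OF inj_cycle[of "Suc s"] ij(3)[unfolded Y_def]])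
    then show "i = j" using \<tau>(1) by simp
  qed
  have X'_inj: "inj_on X' {..<J}"
  proof (rule inj_onI)
    fix i j assume ij: "i \<in> {..<J}" "j \<in> {..<J}" "X' i = X' j"
    have "X i = X j" using X_eq[of i] X_eq[of j] unfolding ij(3) by linarith
    then show "i = j" using X_inj ij(1,2) by (simp add: inj_on_eq_iff)
  qed
  have Y'_inj: "inj_on Y' {..<J}"
  proof (rule inj_onI)
    fix i j assume ij: "i \<in> {..<J}" "j \<in> {..<J}" "Y' i = Y' j"
    have "Y i = Y j" using Y_eq[of i] Y_eq[of j] unfolding ij(3) by linarith
    then show "i = j" using Y_inj ij(1,2) by (simp add: inj_on_eq_iff)
  qed
  have less: "u n < p" for n using exp_seq_range[OF p(1) g u0, of n] unfolding u_def by auto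
  have X'_less: "X' j < p div 2 ^ k + 1" for j
    unfolding X'_def X_def using div_le_mono[OF less_imp_le[OF less]] by (simp add: less_Suc_eq_le)
  have Y'_less: "Y' j < int (p div 2 ^ k + 1)" for j
    unfolding Y'_def Y_def of_nat_less_iff using div_le_mono[OF less_imp_le[OF less]] by (simp add: less_Suc_eq_le)
  have pz: "prime (int p)" using p(1) by simp
  \<comment> \<open>As p is odd, 2^k has an inverse \<open>i\<close> modulo p. Multiplying 2^k y + Y
    = g^X (g^(2^k))^x by \<open>i\<close>, where X and Y are the fixed low bits, yields the
    constants \<open>b\<close>, \<open>c\<close>, \<open>G\<close> below.\<close>
  have "coprime (2 ^ k) (int p)" using p by (simp add: prime_imp_coprime_int coprime_power_left_iff odd_iff_mod_2_eq_one)
  then obtain i where i: "[2 ^ k * i = 1] (mod int p)" using cong_solve_coprime_int by blast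
  define S where "S = Y' ` {..<J}"
  define x where "x y = X' (the_inv_into {..<J} Y' y)" for y
  have x_Y': "x (Y' j) = X' j" if "j < J" for j
    unfolding x_def using the_inv_into_f_f[OF Y'_inj] that by simp
  show thesis
  proof (rule that[of S x "i * int (Y 0 mod 2 ^ k)" "i * g ^ (X 0 mod 2 ^ k)" "g ^ (2 ^ k)"])
    show "S \<subseteq> {0..<int (p div 2 ^ k + 1)}" unfolding S_def using Y'_less by (auto simp: Y'_def)
    show "inj_on x S"
    proof (rule inj_onI)
      fix y y' assume "y \<in> S" "y' \<in> S" "x y = x y'"
      then obtain j j' where "y = Y' j" "y' = Y' j'" "j < J" "j' < J" "X' j = X' j'"
        unfolding S_def using x_Y' by auto
      then show "y = y'" using inj_onD[OF X'_inj] by auto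
    qed
    show "x y < p div 2 ^ k + 1" if "y \<in> S" for y using that X'_less x_Y' unfolding S_def by auto
    show "\<not> int p dvd g ^ (2 ^ k)" using g pz prime_dvd_power by blast
    show "cycle_length (exp_seq p g u0) \<le> card S * cycle_length (low_bits k (exp_seq p g u0))"
      using J_ge card_image[OF Y'_inj] unfolding S_def t_def \<tau>_def u_def by simp
    fix y assume "y \<in> S"
    then obtain j where j: "y = Y' j" "j < J" unfolding S_def by auto
    have Yj: "int (Y j) = 2 ^ k * y + int (Y 0 mod 2 ^ k)"
      using arg_cong[OF Y_eq[of j], of int] j(1) by (simp add: Y'_def)
    have "[2 ^ k * y + int (Y 0 mod 2 ^ k) = g ^ X j] (mod int p)"
      unfolding Yj[symmetric] using exp_seq_cong[OF p(1), of g u0 "s + j * \<tau>"] unfolding X_def Y_def u_def .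
    also have "g ^ X j = g ^ (X 0 mod 2 ^ k) * (g ^ (2 ^ k)) ^ x y"
      unfolding j(1) x_Y'[OF j(2)] by (subst X_eq) (simp only: power_add power_mult mult.commute[of "g ^ (X 0 mod 2 ^ k)"])
    finally have 1: "[i * (2 ^ k * y + int (Y 0 mod 2 ^ k)) = i * (g ^ (X 0 mod 2 ^ k) * (g ^ (2 ^ k)) ^ x y)] (mod int p)"
      by (intro cong_mult cong_refl)
    have "[y + i * int (Y 0 mod 2 ^ k) = (2 ^ k * i) * y + i * int (Y 0 mod 2 ^ k)] (mod int p)"
      using cong_add[OF cong_mult[OF cong_sym[OF i] cong_refl[of y]] cong_refl] by simp
    also have "(2 ^ k * i) * y + i * int (Y 0 mod 2 ^ k) = i * (2 ^ k * y + int (Y 0 mod 2 ^ k))"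
      by (simp add: algebra_simps)
    also note 1
    finally show "[y + i * int (Y 0 mod 2 ^ k) = i * g ^ (X 0 mod 2 ^ k) * (g ^ (2 ^ k)) ^ x y] (mod int p)"
      by (simp add: mult.assoc)
  qed
qed

section \<open>Bounds for the cycle length\<close>

context log_points begin

text \<open>Only the interval of the points is cut; the exponents keep their range, for which reason
  the locale separates \<open>K\<close> from \<open>H\<close>. The fullest block of length
  \<open>L\<close>, shifted to start at 0, is again an instance of the locale. There are (H - 1) div
  L + 1 blocks, at most 2 H / L because L <= H.\<close>

lemma card_S_split:
  assumes L: "1 \<le> L" "L \<le> H" "2000 * L ^ 6 < p"
  obtains N where "int (card S) * L \<le> 2 * H * int N"
    "N ^ 3 \<le> 400 * K * D ^ 3 \<or> real N ^ 10 * of_int p \<le> 6000000 * real K ^ 2 * real D ^ 6 * of_int L ^ 8"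
proof (cases "S = {}")
  case True
  then show thesis using that[of 0] by simp
next
  case False
  define I where "I = (\<lambda>y. y div L) ` S"
  define M where "M = Max ((\<lambda>i. card {y\<in>S. y div L = i}) ` I)"
  have finI: "finite I" "I \<noteq> {}" unfolding I_def using finite_S False by auto
  then have "M \<in> (\<lambda>i. card {y\<in>S. y div L = i}) ` I" unfolding M_def by (intro Max_in) auto
  then obtain i where i: "M = card {y\<in>S. y div L = i}" by blast
  have "card S \<le> M * card I" unfolding I_def
    by (rule card_le_fibres[OF finite_S]) (unfold M_def, rule Max_ge, use finI in \<open>auto simp: I_def\<close>)
  moreover have "int (card I) * L \<le> 2 * H"
  proof -
    have "I \<subseteq> {0..(H - 1) div L}"
    proof
      fix j assume "j \<in> I"
      then obtain y where y: "y \<in> S" "j = y div L" unfolding I_def by blast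
      then show "j \<in> {0..(H - 1) div L}" using S_bounds[OF y(1)] L
        by (auto intro: zdiv_mono1 simp: pos_imp_zdiv_nonneg_iff)
    qed
    then have "card I \<le> card {0..(H - 1) div L}" by (rule card_mono[rotated]) simp
    moreover have "0 \<le> (H - 1) div L" using L by (simp add: pos_imp_zdiv_nonneg_iff)
    ultimately have "int (card I) \<le> (H - 1) div L + 1" by simp
    then have "int (card I) * L \<le> ((H - 1) div L + 1) * L" using L by (intro mult_right_mono) auto
    also have "\<dots> = (H - 1) div L * L + L" by (simp add: algebra_simps)
    also have "(H - 1) div L * L \<le> H - 1"
      using div_mult_mod_eq[of "H - 1" L] pos_mod_sign[of L "H - 1"] L(1) by linarith
    finally show ?thesis using L by simp
  qed
  ultimately have "int (card S) * L \<le> int M * (int (card I) * L)"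
    using L mult_right_mono[of "int (card S)" "int M * int (card I)" L]
    by (simp add: mult.assoc flip: of_nat_mult)
  also have "\<dots> \<le> int M * (2 * H)" by (intro mult_left_mono \<open>int (card I) * L \<le> 2 * H\<close>) simp
  finally have le: "int (card S) * L \<le> 2 * H * int M" by (simp add: mult_ac)
  define S' where "S' = (\<lambda>y. y - i * L) ` {y\<in>S. y div L = i}"
  have S'_D: "y + i * L \<in> S" "0 \<le> y \<and> y < L" if "y \<in> S'" for y
  proof -
    obtain z where z: "z \<in> S" "z div L = i" "y = z - i * L" using \<open>y \<in> S'\<close> unfolding S'_def by auto
    have "y = z mod L" unfolding z(3) z(2)[symmetric] by (rule minus_div_mult_eq_mod)
    then show "y + i * L \<in> S" "0 \<le> y \<and> y < L" using z L by auto
  qed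
  interpret piece: log_points p "b + i * L" c G L S' "\<lambda>y. x (y + i * L)" K D
  proof
    show "inj_on (\<lambda>y. x (y + i * L)) S'"
      by (rule inj_onI) (use S'_D(1) x_eq in force)
    fix m :: int assume m: "m \<noteq> 0" "\<bar>m\<bar> \<le> 3000000 * L ^ 12"
    have "L ^ 12 \<le> H ^ 12" using L by (intro power_mono) auto
    then show "card {d. d dvd m} \<le> D" using divisors m by simp
  next
    fix y assume "y \<in> S'"
    show "[y + (b + i * L) = c * G ^ x (y + i * L)] (mod p)"
      using log[OF S'_D(1)[OF \<open>y \<in> S'\<close>]] by (simp add: algebra_simps)
  qed (use L H_le p_prime S'_D x_less in auto)
  have "card S' = M" unfolding S'_def i by (rule card_image) (simp add: inj_on_def)
  then show thesis using that[OF le] piece.card_S_bound3[OF L(3)] by simp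
qed

end

text \<open>The largest admissible \<open>L\<close> is of order p^(1/6): it fails for L + 1, and (L
  + 1)^6 <= 64 L^6 gives 128000 = 64 * 2000.\<close>

lemma sixth_root_scale:
  fixes p :: int
  assumes "p > 2000"
  obtains L where "1 \<le> L" "2000 * L ^ 6 < p" "p \<le> 128000 * L ^ 6"
proof -
  define A where "A = {L::nat. 2000 * int L ^ 6 < p}"
  have "A \<subseteq> {..nat p}"
  proof
    fix L assume "L \<in> A"
    then have "2000 * int L ^ 6 < p" unfolding A_def by simp
    moreover have "int L ^ 1 \<le> int L ^ 6" by (cases "L = 0") (simp, intro power_increasing, auto)
    moreover have "0 \<le> int L" by simp
    ultimately have "int L \<le> p" unfolding power_one_right by linarith
    then show "L \<in> {..nat p}" by (simp add: le_nat_iff)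
  qed
  then have fin: "finite A" by (rule finite_subset) simp
  have "1 \<in> A" using assms unfolding A_def by simp
  define L where "L = Max A"
  have LA: "L \<in> A" unfolding L_def using fin \<open>1 \<in> A\<close> by (intro Max_in) auto
  have L1: "1 \<le> L" unfolding L_def using fin \<open>1 \<in> A\<close> by (rule Max_ge)
  have "L + 1 \<notin> A" using Max_ge[OF fin, of "L + 1"] unfolding L_def by auto
  then have "p \<le> 2000 * int (L + 1) ^ 6" unfolding A_def by simp
  also have "\<dots> \<le> 2000 * (2 * int L) ^ 6" using L1 by (intro mult_left_mono power_mono) auto
  also have "\<dots> = 128000 * int L ^ 6" by (simp add: power_mult_distrib)
  finally show thesis using that[of "int L"] LA L1 unfolding A_def by simp
qed

section \<open>Logarithmic form of the estimates and the six ranges\<close>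

lemma lsb_factor_pos: "p > 0 \<Longrightarrow> lsb_factor p r k > 0"
  unfolding lsb_factor_def Let_def by simp

lemma ln_powr_mult_powr:
  fixes y z :: real
  shows "y > 0 \<Longrightarrow> z > 0 \<Longrightarrow> ln (y powr u * z powr v) = u * ln y + v * ln z"
  by (simp add: ln_mult)

theorem corollary5:
  shows "\<forall>\<epsilon>::real. \<epsilon> > 0 \<longrightarrow>
    (\<exists>p0::nat. \<forall>(p::nat) (r::nat) (g::int) (u0::nat) (k::nat).
       p \<ge> p0 \<and> bit_prime r p \<and> \<not> int p dvd g \<and> u0 \<in> {1..p - 1} \<and> 1 \<le> k \<and> k \<le> r \<longrightarrow>
       real (cycle_length (low_bits k (exp_seq p g u0)))
         \<ge> real (cycle_length (exp_seq p g u0)) * real p powr (- \<epsilon>) * lsb_factor p r k)"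
proof (intro allI impI)
  fix \<epsilon> :: real assume \<epsilon>: "\<epsilon> > 0"
  \<comment> \<open>Integers up to 3000000 H^12 are at most p^13 once p >= 3000000, so their divisor
    counts are at most a constant times p^(13 \<eta>) = p^(\<epsilon> / 4).\<close>
  define \<eta> where "\<eta> = \<epsilon> / 52"
  have \<eta>: "\<eta> > 0" using \<epsilon> by (simp add: \<eta>_def)
  obtain C where C: "C \<ge> 1" "\<And>n::nat. n > 0 \<Longrightarrow> real (card {d. d dvd n}) \<le> C * real n powr \<eta>"
    using divisor_bound[OF \<eta>] by blast
  \<comment> \<open>The logarithm of the largest absolute constant in the estimates; it stands in
    for all of them.\<close>
  define c where "c = ln (6000000::real)"
  have c0: "c > 0" unfolding c_def by simp
  have ln_le_c: "ln z \<le> c" if "0 < z" "z \<le> 6000000" for z :: real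
    unfolding c_def using that by (subst ln_le_cancel_iff) auto
  define p0 where "p0 = nat \<lceil>exp ((20 * c + 10 * ln (2 * C)) / \<epsilon>)\<rceil> + 3000000"
  show "\<exists>p0::nat. \<forall>(p::nat) (r::nat) (g::int) (u0::nat) (k::nat).
       p \<ge> p0 \<and> bit_prime r p \<and> \<not> int p dvd g \<and> u0 \<in> {1..p - 1} \<and> 1 \<le> k \<and> k \<le> r \<longrightarrow>
       real (cycle_length (low_bits k (exp_seq p g u0)))
         \<ge> real (cycle_length (exp_seq p g u0)) * real p powr (- \<epsilon>) * lsb_factor p r k"
  proof (intro exI[of _ p0] allI impI, elim conjE)
    fix p r :: nat and g :: int and u0 k :: nat
    assume p_ge: "p0 \<le> p" and bit: "bit_prime r p" and g: "\<not> int p dvd g" and u0: "u0 \<in> {1..p - 1}"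
      and k: "1 \<le> k" "k \<le> r"
    have p: "prime p" "2 ^ (r - 1) \<le> p" "p < 2 ^ r" using bit unfolding bit_prime_def by auto
    have p_large: "p \<ge> 3000000" using p_ge unfolding p0_def by simp
    then have podd: "odd p" using p(1) prime_odd_nat by simp
    define l where "l = ln (real p)"
    have l_large: "20 * c + 10 * ln (2 * C) \<le> \<epsilon> * l"
    proof -
      have "exp ((20 * c + 10 * ln (2 * C)) / \<epsilon>) \<le> real p" using p_ge unfolding p0_def by linarith
      then have "ln (exp ((20 * c + 10 * ln (2 * C)) / \<epsilon>)) \<le> l"
        unfolding l_def using p_large by (subst ln_le_cancel_iff) auto
      then show ?thesis using \<epsilon> by (simp add: field_simps)
    qed
    have l0: "l > 0" unfolding l_def using p_large by simp
    have ln2: "0 < ln (2::real)" "ln (2::real) \<le> c" using ln_le_c[of 2] by auto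
    define a where "a = l - real k * ln 2"
    have r1: "r \<ge> 1" using k by simp
    have r_low: "l \<le> real r * ln 2"
    proof -
      have "real p \<le> 2 ^ r" using p(3) by (metis less_imp_le of_nat_le_iff of_nat_numeral of_nat_power)
      then have "l \<le> ln (2 ^ r)" unfolding l_def using p_large by (subst ln_le_cancel_iff) auto
      then show ?thesis by (simp add: ln_realpow)
    qed
    have r_up: "real r * ln 2 \<le> l + ln 2"
    proof -
      have "2 ^ (r - 1) \<le> real p" using p(2) by (metis of_nat_le_iff of_nat_numeral of_nat_power)
      then have "ln (2 ^ (r - 1)) \<le> l" unfolding l_def using p_large by (subst ln_le_cancel_iff) auto
      then show ?thesis using r1 by (simp add: ln_realpow algebra_simps of_nat_diff)
    qed
    have a_ge: "a \<ge> - ln 2"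
    proof -
      have "real k * ln 2 \<le> real r * ln 2" using k ln2 by (intro mult_right_mono) auto
      then show ?thesis using r_up unfolding a_def by linarith
    qed
    define n where "n = p div 2 ^ k + 1"
    define H where "H = int n"
    define \<kappa> where "\<kappa> = ln (real n)"
    have n1: "n \<ge> 1" unfolding n_def by simp
    have h_eq: "exp a = real p / 2 ^ k"
      unfolding a_def l_def using p_large by (simp add: exp_diff exp_of_nat_mult)
    have \<kappa>_le: "\<kappa> \<le> a + c"
    proof -
      have "real (p div 2 ^ k) \<le> real p / real (2 ^ k)" by (rule of_nat_div_le_of_nat)
      then have "real n \<le> exp a + 1" unfolding n_def h_eq by simp
      moreover have "exp (- ln 2) \<le> exp a" using a_ge by simp
      then have "1 \<le> 2 * exp a" by (simp add: exp_minus)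
      ultimately have "real n \<le> 3 * exp a" by simp
      then have "\<kappa> \<le> ln (3 * exp a)" unfolding \<kappa>_def using n1 by (subst ln_le_cancel_iff) auto
      also have "\<dots> = ln 3 + a" by (simp add: ln_mult)
      finally show ?thesis using ln_le_c[of 3] by simp
    qed
    have n_le_p: "n \<le> p"
    proof -
      have "p div 2 ^ k \<le> p div 2 ^ 1" using k by (intro div_le_mono2 power_increasing) auto
      then show ?thesis unfolding n_def using p_large by simp
    qed
    obtain b c' G S x where S: "S \<subseteq> {0..<int n}" "inj_on x S" "\<And>y. y \<in> S \<Longrightarrow> x y < n"
      "\<And>y. y \<in> S \<Longrightarrow> [y + b = c' * G ^ x y] (mod int p)" "\<not> int p dvd G"
      "cycle_length (exp_seq p g u0) \<le> card S * cycle_length (low_bits k (exp_seq p g u0))"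
      using cycle_points[OF p(1) podd g u0, of k] unfolding n_def by metis
    define D where "D = nat \<lfloor>2 * C * real p powr (\<epsilon> / 4)\<rfloor>"
    define \<delta> where "\<delta> = ln (real D)"
    have div: "card {d. d dvd m} \<le> D" if m: "m \<noteq> 0" "\<bar>m\<bar> \<le> 3000000 * H ^ 12" for m :: int
    proof -
      have "\<bar>m\<bar> \<le> int p * int p ^ 12"
        using p_large n_le_p
        by (intro order_trans[OF m(2)] mult_mono power_mono) (simp_all add: H_def)
      also have "\<dots> = int (p ^ 13)" by (simp add: eval_nat_numeral)
      finally have m_le: "nat \<bar>m\<bar> \<le> p ^ 13" by (simp add: nat_le_iff)
      have "real (card {d. d dvd m}) \<le> 2 * real (card {d::nat. d dvd nat \<bar>m\<bar>})"
        using card_int_divisors_le[OF m(1)] by (metis of_nat_le_iff of_nat_mult of_nat_numeral)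
      also have "\<dots> \<le> 2 * (C * real (nat \<bar>m\<bar>) powr \<eta>)" using m(1) by (intro mult_left_mono C) auto
      also have "real (nat \<bar>m\<bar>) powr \<eta> \<le> real (p ^ 13) powr \<eta>"
        by (rule powr_mono2) (use m_le \<eta> in \<open>simp_all only: of_nat_le_iff of_nat_0_le_iff less_imp_le\<close>)
      also have "real (p ^ 13) = real p powr 13" using p_large by (subst powr_numeral) auto
      also have "(real p powr 13) powr \<eta> = real p powr (\<epsilon> / 4)" unfolding powr_powr \<eta>_def by simp
      finally have "real (card {d. d dvd m}) \<le> 2 * C * real p powr (\<epsilon> / 4)" using C(1) by simp
      then show ?thesis unfolding D_def by linarith
    qed
    interpret log_points "int p" b c' G H S x n D
      by standard (use p(1) n1 n_le_p S div in \<open>auto simp: H_def\<close>)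
    have \<delta>: "\<delta> \<le> ln (2 * C) + \<epsilon> * l / 4"
    proof -
      have "real D \<le> 2 * C * real p powr (\<epsilon> / 4)" unfolding D_def using C(1) by simp
      then have "\<delta> \<le> ln (2 * C * real p powr (\<epsilon> / 4))"
        unfolding \<delta>_def using D_pos C(1) p_large by (subst ln_le_cancel_iff) auto
      also have "\<dots> = ln (2 * C) + \<epsilon> / 4 * l" using C(1) p_large by (simp add: ln_mult ln_powr l_def)
      finally show ?thesis by simp
    qed
    define N where "N = card S"
    have N1: "N \<ge> 1"
    proof (rule ccontr)
      assume "\<not> ?thesis"
      then have "card S = 0" unfolding N_def by simp
      then have "cycle_length (exp_seq p g u0) = 0" using S(6) by (metis le_zero_eq mult_0)
      then show False using cycle_length_attained(1)[OF exp_seq_eventually_periodic[OF p(1) g u0]] by simp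
    qed
    define \<nu> where "\<nu> = ln (real N)"
    have pos: "real N > 0" "real n > 0" "real D > 0" "real p > 0" using N1 n1 D_pos p_large by auto
    have bound2: "2 * \<nu> \<le> c + \<kappa> + 2 * \<delta> \<or> 3 * \<nu> + l \<le> c + 4 * \<kappa> + \<delta>"
    proof -
      from card_S_bound2 consider "N\<^sup>2 \<le> 12 * n * D\<^sup>2" | "real N ^ 3 * real p \<le> 256 * real n * real D * real n ^ 3"
        unfolding N_def H_def by auto
      then show ?thesis
      proof cases
        case 1
        then have "real (N\<^sup>2) \<le> real (12 * n * D\<^sup>2)" by (simp only: of_nat_le_iff)
        then have "ln (real N ^ 2) \<le> ln (12 * real n * real D ^ 2)" using pos by (subst ln_le_cancel_iff) auto
        then have "2 * \<nu> \<le> ln 12 + \<kappa> + 2 * \<delta>" using pos by (simp add: ln_mult ln_realpow \<nu>_def \<kappa>_def \<delta>_def)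
        then show ?thesis using ln_le_c[of 12] by simp
      next
        case 2
        then have "ln (real N ^ 3 * real p) \<le> ln (256 * real n * real D * real n ^ 3)"
          using pos by (subst ln_le_cancel_iff) auto
        then have "3 * \<nu> + l \<le> ln 256 + \<kappa> + \<delta> + 3 * \<kappa>"
          using pos by (simp add: ln_mult ln_realpow \<nu>_def \<kappa>_def \<delta>_def l_def)
        then show ?thesis using ln_le_c[of 256] by simp
      qed
    qed
    \<comment> \<open>Here \<open>\<theta>\<close> is the logarithm of the length of a piece: either
      the piece is the whole interval, or its length is at least of order p^(1/6).\<close>
    have bound3: "\<exists>\<theta> \<nu>'. \<nu> + \<theta> \<le> c + \<kappa> + \<nu>' \<and> (\<theta> = \<kappa> \<or> l \<le> c + 6 * \<theta>) \<and> \<theta> \<le> \<kappa> \<and> 0 \<le> \<theta>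
        \<and> (3 * \<nu>' \<le> c + \<kappa> + 3 * \<delta> \<or> 10 * \<nu>' + l \<le> c + 2 * \<kappa> + 6 * \<delta> + 8 * \<theta>)"
    proof -
      obtain L0 where L0: "1 \<le> L0" "2000 * L0 ^ 6 < int p" "int p \<le> 128000 * L0 ^ 6"
        using sixth_root_scale[of "int p"] p_large by auto
      define L where "L = min L0 H"
      have L: "1 \<le> L" "L \<le> H" using L0 H_pos unfolding L_def by auto
      have "L ^ 6 \<le> L0 ^ 6" using L unfolding L_def by (intro power_mono) auto
      then have L6: "2000 * L ^ 6 < int p" using L0 by linarith
      obtain N' where N': "int N * L \<le> 2 * H * int N'"
        "N' ^ 3 \<le> 400 * n * D ^ 3 \<or> real N' ^ 10 * of_int (int p) \<le> 6000000 * real n ^ 2 * real D ^ 6 * of_int L ^ 8"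
        using card_S_split[OF L L6] unfolding N_def by metis
      define \<nu>' \<theta> where "\<nu>' = ln (real N')" and "\<theta> = ln (real_of_int L)"
      have "int N * L > 0" using N1 L by simp
      then have "2 * H * int N' > 0" using N'(1) by linarith
      then have N'0: "real N' > 0" using H_pos by (simp add: zero_less_mult_iff)
      have L0': "real_of_int L > 0" using L by simp
      have "real_of_int (int N * L) \<le> real_of_int (2 * H * int N')" using N'(1) by (simp only: of_int_le_iff)
      then have "ln (real N * real_of_int L) \<le> ln (2 * real n * real N')"
        using pos L0' N'0 by (subst ln_le_cancel_iff) (auto simp: H_def)
      then have "\<nu> + \<theta> \<le> ln 2 + \<kappa> + \<nu>'"
        using pos L0' N'0 by (simp add: ln_mult \<nu>_def \<theta>_def \<kappa>_def \<nu>'_def)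
      then have 1: "\<nu> + \<theta> \<le> c + \<kappa> + \<nu>'" using ln2 by simp
      have 2: "\<theta> \<le> \<kappa>" "0 \<le> \<theta>" unfolding \<theta>_def \<kappa>_def using L by (auto simp: H_def)
      have 3: "\<theta> = \<kappa> \<or> l \<le> c + 6 * \<theta>"
      proof (cases "L = H")
        case True
        then show ?thesis unfolding \<theta>_def \<kappa>_def H_def by simp
      next
        case False
        then have "L = L0" unfolding L_def by auto
        then have "real_of_int (int p) \<le> real_of_int (128000 * L ^ 6)" using L0(3) by (simp only: of_int_le_iff)
        then have "l \<le> ln (128000 * real_of_int L ^ 6)" unfolding l_def using pos L0' by (subst ln_le_cancel_iff) auto
        also have "\<dots> = ln 128000 + 6 * \<theta>" using L0' by (simp add: ln_mult ln_realpow \<theta>_def)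
        finally show ?thesis using ln_le_c[of 128000] by simp
      qed
      have 4: "3 * \<nu>' \<le> c + \<kappa> + 3 * \<delta> \<or> 10 * \<nu>' + l \<le> c + 2 * \<kappa> + 6 * \<delta> + 8 * \<theta>"
        using N'(2)
      proof
        assume "N' ^ 3 \<le> 400 * n * D ^ 3"
        then have "real (N' ^ 3) \<le> real (400 * n * D ^ 3)" by (simp only: of_nat_le_iff)
        then have "ln (real N' ^ 3) \<le> ln (400 * real n * real D ^ 3)" using pos N'0 by (subst ln_le_cancel_iff) auto
        then have "3 * \<nu>' \<le> ln 400 + \<kappa> + 3 * \<delta>" using pos N'0 by (simp add: ln_mult ln_realpow \<nu>'_def \<kappa>_def \<delta>_def)
        then show ?thesis using ln_le_c[of 400] by simp
      next
        assume "real N' ^ 10 * of_int (int p) \<le> 6000000 * real n ^ 2 * real D ^ 6 * of_int L ^ 8"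
        then have "ln (real N' ^ 10 * real p) \<le> ln (6000000 * real n ^ 2 * real D ^ 6 * of_int L ^ 8)"
          using pos N'0 L0' by (subst ln_le_cancel_iff) auto
        then have "10 * \<nu>' + l \<le> c + 2 * \<kappa> + 6 * \<delta> + 8 * \<theta>"
          using pos N'0 L0' by (simp add: ln_mult ln_realpow \<nu>'_def \<kappa>_def \<delta>_def l_def \<theta>_def c_def)
        then show ?thesis by simp
      qed
      show ?thesis using 1 2 3 4 by blast
    qed
    have bound_large: "\<nu> \<le> c + (2 * \<kappa> - l) \<or> \<nu> \<le> c + l / 2"
    proof -
      have b: "real N \<le> 4 * real n ^ 2 / real p + 2 * sqrt (real p)"
        using card_S_bound_large[OF _ S(5)] unfolding N_def H_def by simp
      consider "real N \<le> 8 * real n ^ 2 / real p" | "real N \<le> 4 * sqrt (real p)" using b by linarith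
      then show ?thesis
      proof cases
        case 1
        then have "\<nu> \<le> ln (8 * real n ^ 2 / real p)" unfolding \<nu>_def using pos by (subst ln_le_cancel_iff) auto
        also have "\<dots> = ln 8 + 2 * \<kappa> - l" using pos by (simp add: ln_div ln_mult ln_realpow \<kappa>_def l_def)
        finally show ?thesis using ln_le_c[of 8] by simp
      next
        case 2
        then have "\<nu> \<le> ln (4 * sqrt (real p))" unfolding \<nu>_def using pos by (subst ln_le_cancel_iff) auto
        also have "\<dots> = ln 4 + l / 2" using pos by (simp add: ln_mult ln_sqrt l_def)
        finally show ?thesis using ln_le_c[of 4] by simp
      qed
    qed
    \<comment> \<open>By the size of an r-bit prime, l and r ln 2 differ by at most ln 2, so a bound
      for k / r turns into one for a / l up to a constant.\<close>
    have \<rho>_ge: "a \<le> (1 - q) * l" if "real k / real r \<ge> q" "q \<ge> 0" for q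
    proof -
      have "q * l \<le> q * (real r * ln 2)" using r_low that by (intro mult_left_mono) auto
      also have "\<dots> = (q * real r) * ln 2" by simp
      also have "\<dots> \<le> real k * ln 2" using that r1 ln2 by (intro mult_right_mono) (auto simp: field_simps)
      finally show ?thesis unfolding a_def by (simp add: algebra_simps)
    qed
    have \<rho>_less: "(1 - q) * l - c \<le> a" if "\<not> real k / real r \<ge> q" "0 \<le> q" "q \<le> 1" for q
    proof -
      have "real k * ln 2 \<le> (q * real r) * ln 2" using that r1 ln2 by (intro mult_right_mono) (auto simp: field_simps)
      also have "\<dots> = q * (real r * ln 2)" by simp
      also have "\<dots> \<le> q * (l + ln 2)" using r_up that by (intro mult_left_mono) auto
      also have "\<dots> = q * l + q * ln 2" by (simp add: algebra_simps)
      also have "q * ln 2 \<le> c" using mult_left_le_one_le[of "ln 2" q] that(2,3) ln2 by linarith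
      finally show ?thesis unfolding a_def by (simp add: algebra_simps)
    qed
    have ln_pow: "ln (2 ^ k / real p) = - a"
      unfolding a_def l_def using pos by (simp add: ln_div ln_realpow)
    have kl: "real k * ln 2 = l - a" unfolding a_def by simp
    have key: "\<nu> + ln (lsb_factor p r k) \<le> \<epsilon> * l"
    proof -
      \<comment> \<open>Naming the product \<epsilon> l leaves linear inequalities only, which
        decide each of the six cases.\<close>
      define e where "e = \<epsilon> * l"
      have small: "20 * c + 10 * ln (2 * C) \<le> e" "\<delta> \<le> ln (2 * C) + e / 4" "0 \<le> ln (2 * C)"
        using l_large \<delta> C(1) unfolding e_def by auto
      consider (1) "real k / real r \<ge> 17/20"
        | (2) "\<not> real k / real r \<ge> 17/20" "real k / real r \<ge> 13/16"
        | (3) "\<not> real k / real r \<ge> 17/20" "\<not> real k / real r \<ge> 13/16" "real k / real r \<ge> 3/5"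
        | (4) "\<not> real k / real r \<ge> 17/20" "\<not> real k / real r \<ge> 13/16" "\<not> real k / real r \<ge> 3/5" "real k / real r \<ge> 3/8"
        | (5) "\<not> real k / real r \<ge> 17/20" "\<not> real k / real r \<ge> 13/16" "\<not> real k / real r \<ge> 3/5" "\<not> real k / real r \<ge> 3/8"
            "real k / real r \<ge> 1/4"
        | (6) "\<not> real k / real r \<ge> 17/20" "\<not> real k / real r \<ge> 13/16" "\<not> real k / real r \<ge> 3/5" "\<not> real k / real r \<ge> 3/8"
            "\<not> real k / real r \<ge> 1/4"
        by blast
      then have "\<nu> + ln (lsb_factor p r k) \<le> e"
      proof cases
        case 1
        have L: "lsb_factor p r k = (2 ^ k / real p) powr (1/3)"
          unfolding lsb_factor_def Let_def using 1 by (simp only: if_True if_False)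
        have F: "ln (lsb_factor p r k) = - a / 3"
          unfolding L ln_powr ln_pow by simp
        \<comment> \<open>As 3/20 < 1/6, cutting into pieces loses only a constant here. With h =
          exp a, N is at most h^(1/3) or h p^(-1/10), and the latter is no larger for h <=
          p^(3/20).\<close>
        have "a \<le> 3/20 * l" using \<rho>_ge[OF 1] by simp
        then show ?thesis unfolding F using bound3 \<kappa>_le c0 small l0 by auto
      next
        case 2
        have L: "lsb_factor p r k = 2 powr (7 * real k / 6) * real p powr (- 25/24)"
          unfolding lsb_factor_def Let_def using 2 by (simp only: if_True if_False)
        have "ln (lsb_factor p r k) = 7/6 * (real k * ln 2) - 25/24 * l"
          unfolding L l_def by (subst ln_powr_mult_powr) (use pos in simp_all)
        then have F: "ln (lsb_factor p r k) = l / 8 - 7/6 * a" unfolding kl by (simp add: algebra_simps)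
        \<comment> \<open>The target h^(7/6) p^(-1/8) dominates every alternative: h^(1/3) and h
          p^(-1/10), for an uncut interval, because h >= p^(3/20); h^(4/3) p^(-1/6) and h^(6/5)
          p^(-2/15), for pieces of length p^(1/6), because h <= p^(1/4).\<close>
        have "a \<le> 3/16 * l" "3/20 * l - c \<le> a" using \<rho>_ge[OF 2(2)] \<rho>_less[OF 2(1)] by simp_all
        then show ?thesis unfolding F using bound3 \<kappa>_le c0 small l0 by auto
      next
        case 3
        have L: "lsb_factor p r k = (2 ^ k / real p) powr (1/2)"
          unfolding lsb_factor_def Let_def using 3 by (simp only: if_True if_False)
        have F: "ln (lsb_factor p r k) = - a / 2"
          unfolding L ln_powr ln_pow by simp
        \<comment> \<open>The two alternatives h^(1/2) and h^(4/3) p^(-1/3) of \<open>bound2\<close>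
          cross at h = p^(2/5); this range and the next are the two sides.\<close>
        have "a \<le> 2/5 * l" using \<rho>_ge[OF 3(3)] by simp
        then show ?thesis unfolding F using bound2 \<kappa>_le c0 small l0 by auto
      next
        case 4
        have L: "lsb_factor p r k = 2 powr (4 * real k / 3) * real p powr (- 1)"
          unfolding lsb_factor_def Let_def using 4 by (simp only: if_True if_False)
        have "ln (lsb_factor p r k) = 4/3 * (real k * ln 2) - l"
          unfolding L l_def by (subst ln_powr_mult_powr) (use pos in simp_all)
        then have F: "ln (lsb_factor p r k) = l / 3 - 4/3 * a" unfolding kl by (simp add: algebra_simps)
        have "2/5 * l - c \<le> a" using \<rho>_less[OF 4(3)] by simp
        then show ?thesis unfolding F using bound2 \<kappa>_le c0 small l0 by auto
      next
        case 5
        have L: "lsb_factor p r k = real p powr (- 1/2)"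
          unfolding lsb_factor_def Let_def using 5 by (simp only: if_True if_False)
        have F: "ln (lsb_factor p r k) = - l / 2"
          unfolding L ln_powr l_def by simp
        \<comment> \<open>Likewise p^(1/2) and h^2 / p of \<open>bound_large\<close> cross at h =
          p^(3/4).\<close>
        have "a \<le> 3/4 * l" using \<rho>_ge[OF 5(5)] by simp
        then show ?thesis unfolding F using bound_large \<kappa>_le c0 small l0 by auto
      next
        case 6
        have L: "lsb_factor p r k = 2 powr (2 * real k) * real p powr (- 1)"
          unfolding lsb_factor_def Let_def using 6 by (simp only: if_True if_False)
        have "ln (lsb_factor p r k) = 2 * (real k * ln 2) - l"
          unfolding L l_def by (subst ln_powr_mult_powr) (use pos in simp_all)
        then have F: "ln (lsb_factor p r k) = l - 2 * a" unfolding kl by (simp add: algebra_simps)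
        have "3/4 * l - c \<le> a" using \<rho>_less[OF 6(5)] by simp
        then show ?thesis unfolding F using bound_large \<kappa>_le c0 small l0 by auto
      qed
      then show ?thesis unfolding e_def .
    qed
    have F0: "lsb_factor p r k > 0" using lsb_factor_pos pos by simp
    have "ln (real N * (real p powr (- \<epsilon>) * lsb_factor p r k)) \<le> 0"
      using key pos F0 by (simp add: ln_mult ln_powr \<nu>_def l_def)
    then have "real N * (real p powr (- \<epsilon>) * lsb_factor p r k) \<le> 1"
      using pos F0 by (subst (asm) ln_le_zero_iff) auto
    then have "real (cycle_length (low_bits k (exp_seq p g u0))) * (real N * (real p powr (- \<epsilon>) * lsb_factor p r k))
        \<le> real (cycle_length (low_bits k (exp_seq p g u0)))"
      by (rule mult_left_le) simp
    moreover have "real (cycle_length (exp_seq p g u0)) \<le> real (N * cycle_length (low_bits k (exp_seq p g u0)))"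
      using S(6) unfolding N_def by (simp only: of_nat_le_iff)
    then have "real (cycle_length (exp_seq p g u0)) * (real p powr (- \<epsilon>) * lsb_factor p r k)
        \<le> real (N * cycle_length (low_bits k (exp_seq p g u0))) * (real p powr (- \<epsilon>) * lsb_factor p r k)"
      using F0 by (intro mult_right_mono) auto
    ultimately show "real (cycle_length (low_bits k (exp_seq p g u0)))
         \<ge> real (cycle_length (exp_seq p g u0)) * real p powr (- \<epsilon>) * lsb_factor p r k"
      by (simp add: mult_ac)
  qed
qed

end
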